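(* There is a universal constant $C>0$ such that for every integer $d\ge 1$ the (uniform) mixing time $\tau_{\rm mix}$ of the Thorp shuffle with $2^d$ cards satisfies $\tau_{\rm mix}\le C d^{44}$.
   Context: Deck and state space: $2^d$ distinct cards occupy the vertices of the hypercube $\{0,1\}^d$, one card per vertex. Let $V$ be the set of all $(2^d)!$ arrangements (bijections from cards to vertices). For $1\le j\le d$, an edge in direction $j$ is a pair of vertices that differ exactly in the $j$-th coordinate. $K_j$ denotes the transition kernel on $V$ in which, independently for each of the $2^{d-1}$ edges in direction $j$, the two cards at the endpoints of the edge are interchanged with probability $\frac12$ and left in place with probability $\frac12$. Thorp shuffle: the (time-inhomogeneous) Markov chain on $V$ whose transition kernel at time $n=0,1,2,\dots$ is $K_{j+1}$, where $j\in\{0,\dots,d-1\}$ and $j\equiv n \pmod d$. Its $n$-step transition probability $p^n(x,y)$ is the $(x,y)$ entry of the product $K_1K_2\cdots$ of the first $n$ kernels, taken cyclically as $K_1,\dots,K_d,K_1,\dots,K_d,\dots$. The uniform distribution on $V$ is stationary. (Uniform) mixing time: $$\tau_{\rm mix}=\min\Bigl\{n:\ \bigl|\,p^n(x,y)\,|V|-1\,\bigr|\le \tfrac14\ \text{ for all } x,y\in V\Bigr\}.$$ *)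

theory Defs
  imports "HOL-Probability.Probability" "HOL-Probability.Product_PMF"
begin

definition hypercube :: "nat \<Rightarrow> (nat \<Rightarrow> nat) set" where
  "hypercube d = {1..d} \<rightarrow>\<^sub>E {0, 1}"

definition cards :: "nat \<Rightarrow> nat set" where
  "cards d = {..<2 ^ d}"

definition arrangements :: "nat \<Rightarrow> (nat \<Rightarrow> nat \<Rightarrow> nat) set" where
  "arrangements d = {x \<in> extensional (cards d). bij_betw x (cards d) (hypercube d)}"

definition edges :: "nat \<Rightarrow> nat \<Rightarrow> (nat \<Rightarrow> nat) set set" where
  "edges d j = {{u, v} | u v. u \<in> hypercube d \<and> v \<in> hypercube d \<and> {i \<in> {1..d}. u i \<noteq> v i} = {j}}"

definition flip :: "nat \<Rightarrow> (nat \<Rightarrow> nat) \<Rightarrow> (nat \<Rightarrow> nat)" where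
  "flip j v = v(j := 1 - v j)"

text \<open>The unique edge in direction \<open>j\<close> containing the vertex \<open>v\<close> is \<open>{v, flip j v}\<close>; the function
  \<open>c\<close> says which edges have their two cards interchanged.\<close>

definition interchange ::
  "nat \<Rightarrow> nat \<Rightarrow> ((nat \<Rightarrow> nat) set \<Rightarrow> bool) \<Rightarrow> (nat \<Rightarrow> nat \<Rightarrow> nat) \<Rightarrow> (nat \<Rightarrow> nat \<Rightarrow> nat)" where
  "interchange d j c x =
     (\<lambda>k\<in>cards d. if c {x k, flip j (x k)} then flip j (x k) else x k)"

definition kernel_pmf :: "nat \<Rightarrow> nat \<Rightarrow> (nat \<Rightarrow> nat \<Rightarrow> nat) \<Rightarrow> (nat \<Rightarrow> nat \<Rightarrow> nat) pmf" where
  "kernel_pmf d j x =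
     map_pmf (\<lambda>c. interchange d j c x) (Pi_pmf (edges d j) False (\<lambda>_. bernoulli_pmf (1 / 2)))"

definition kernel :: "nat \<Rightarrow> nat \<Rightarrow> (nat \<Rightarrow> nat \<Rightarrow> nat) \<Rightarrow> (nat \<Rightarrow> nat \<Rightarrow> nat) \<Rightarrow> real" where
  "kernel d j x y = pmf (kernel_pmf d j x) y"

primrec thorp_prob ::
  "nat \<Rightarrow> nat \<Rightarrow> (nat \<Rightarrow> nat \<Rightarrow> nat) \<Rightarrow> (nat \<Rightarrow> nat \<Rightarrow> nat) \<Rightarrow> real" where
  "thorp_prob d 0 x y = (if x = y then 1 else 0)"
| "thorp_prob d (Suc n) x y =
     (\<Sum>z\<in>arrangements d. thorp_prob d n x z * kernel d (n mod d + 1) z y)"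

text \<open>The infimum is taken in \<^typ>\<open>enat\<close>, so the mixing time would be \<open>\<infinity>\<close> if no \<open>n\<close> qualified;
  otherwise it is attained, i.e. a minimum.\<close>

definition mixing_time :: "nat \<Rightarrow> enat" where
  "mixing_time d = Inf {enat n | n.
     \<forall>x\<in>arrangements d. \<forall>y\<in>arrangements d.
       \<bar>thorp_prob d n x y * real (card (arrangements d)) - 1\<bar> \<le> 1 / 4}"

end

theory Submission
  imports Defs "HOL-Combinatorics.Permutations"
begin

text \<open>
The relative entropy of the law of the paths conditioned to lead from \<open>x\<close> to \<open>y\<close> expresses
\<open>p\<^sup>n(x, y)\<close>: one has \<open>N! p\<^sup>n(x, y) \<le> e\<close> as soon as forcing the coins to steer the shuffle from
\<open>x\<close> to \<open>y\<close> costs entropy at least \<open>ln N! - 1\<close>. Everything rests on a robust entropy contraction: for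
an arbitrary law of the start and of the coins during one round of \<open>d\<close> steps, the entropy deficit \<open>D\<close>
of the arrangement becomes \<open>D' \<le> (1 - c / d\<^sup>2) D + 3 d \<kappa>\<close>, where \<open>\<kappa>\<close> is the entropy deficit of
the coins given the start.

For the contraction, fix a direction \<open>j\<close> and reveal the cards of the upper half \<open>H\<close> of a
\<open>j\<close>-dimensional subcube one vertex at a time. During its first \<open>j - 1\<close> steps a card of \<open>H\<close> is moved
to a nearly uniform place opposite a card of the lower half, and step \<open>j\<close> mixes the two with a coin
whose conditional entropy deficit is dissipated. This dissipation controls the Hellinger distance
between the law of a card in \<open>H\<close> and the average law over the lower half, hence, after averaging over
the unrevealed vertices, the distance to uniform, and finally the deficit itself up to a factor \<open>O(d)\<close>.

In a bridge either the deficit minus the accumulated cost shrinks geometrically or the cost grows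
geometrically, so after \<open>O(d\<^sup>4)\<close> rounds the cost is large enough and the density is at most \<open>e\<close>.
Combined with the total variation mixing that the case \<open>\<kappa> = 0\<close> provides, this gives uniform mixing
after \<open>O(d\<^sup>5)\<close> steps.
\<close>

section \<open>Entropy of functions on a finite uniform space\<close>


text \<open>Pinning the endpoint makes the coins dependent and biased, so no estimate may rely on
  their independence. Every error is charged to \<open>\<kappa>\<close> instead, and by the chain
  rule the costs of all rounds add up to at most the entropy lost by conditioning.

  Relative entropy has a chain rule but no triangle inequality. The squared Hellinger distance has
  one up to a factor 2, does not increase under maps and is compatible with averaging. Passing back
  to entropy costs the logarithm of the largest possible density, at most \<open>ln (2 ^ d)\<close>:
  this is one of the two factors \<open>d\<close> in the contraction. The other arises because the
  start is peeled along \<open>d\<close> nested subcubes, and each of them may be charged the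
  dissipation of the same round.

  Dissipation bounds the deficits only after summation over the unrevealed vertices. Hence the order
  of revelation cannot be fixed in advance: at each stage a vertex that satisfies the bound on its
  own is revealed next, and the chain rule makes the totals independent of that order.\<close>

definition freq :: "'a set \<Rightarrow> ('a \<Rightarrow> 'b) \<Rightarrow> 'b \<Rightarrow> real" where
  "freq S f b = real (card {x \<in> S. f x = b}) / real (card S)"

text \<open>Shannon entropy in nats, as a mean over sample points instead of a sum over values. For
  finite \<open>S\<close> each logarithm then has a positive argument, no convention for
  \<open>0 * ln 0\<close> is involved, and monotonicity is checked pointwise.\<close>

definition entr :: "'a set \<Rightarrow> ('a \<Rightarrow> 'b) \<Rightarrow> real" where
  "entr S f = - (\<Sum>x\<in>S. ln (freq S f (f x))) / real (card S)"

definition centr :: "'a set \<Rightarrow> ('a \<Rightarrow> 'b) \<Rightarrow> ('a \<Rightarrow> 'c) \<Rightarrow> real" where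
  "centr S f g = entr S (\<lambda>x. (f x, g x)) - entr S g"

lemma freq_nonneg: "freq S f b \<ge> 0"
  by (simp add: freq_def)

lemma freq_pos: "finite S \<Longrightarrow> x \<in> S \<Longrightarrow> freq S f (f x) > 0"
  unfolding freq_def by (auto simp: card_gt_0_iff intro!: divide_pos_pos)

lemma freq_zero: "b \<notin> f ` S \<Longrightarrow> freq S f b = 0"
proof -
  assume "b \<notin> f ` S"
  then have "{x \<in> S. f x = b} = {}" by auto
  then show ?thesis unfolding freq_def by (metis card.empty div_0 of_nat_0)
qed

lemma freq_mono:
  assumes "finite S" "\<And>x. x \<in> S \<Longrightarrow> f x = b \<Longrightarrow> g x = c"
  shows "freq S f b \<le> freq S g c"
  unfolding freq_def using assms by (auto intro!: divide_right_mono card_mono)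

lemma freq_cong:
  assumes "\<And>x. x \<in> S \<Longrightarrow> f x = b \<longleftrightarrow> g x = c"
  shows "freq S f b = freq S g c"
  unfolding freq_def using assms by (metis (mono_tags, lifting) Collect_cong)

lemma freq_sum:
  assumes "finite S" "finite T" "\<And>x. x \<in> S \<Longrightarrow> f x = b \<longleftrightarrow> g x \<in> T"
  shows "freq S f b = (\<Sum>c\<in>T. freq S g c)"
proof -
  have "{x \<in> S. f x = b} = (\<Union>c\<in>T. {x \<in> S. g x = c})"
    using assms by auto
  then have "card {x \<in> S. f x = b} = (\<Sum>c\<in>T. card {x \<in> S. g x = c})"
    using assms by (simp only:) (subst card_UN_disjoint, auto)
  then show ?thesis
    by (simp add: freq_def sum_divide_distrib)
qed

lemma freq_sum_one:
  assumes "finite S" "S \<noteq> {}" "finite T" "f ` S \<subseteq> T"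
  shows "(\<Sum>c\<in>T. freq S f c) = 1"
proof -
  have "freq S (\<lambda>_. ()) () = (\<Sum>c\<in>T. freq S f c)"
    using assms by (intro freq_sum) auto
  then show ?thesis using assms by (simp add: freq_def)
qed

lemma sum_as_freq:
  assumes "finite S" "finite T" "f ` S \<subseteq> T"
  shows "(\<Sum>x\<in>S. F (f x)) / real (card S) = (\<Sum>b\<in>T. freq S f b * F b)"
proof -
  have "(\<Sum>x\<in>S. F (f x)) = (\<Sum>b\<in>T. \<Sum>x\<in>{x \<in> S. f x = b}. F (f x))"
    using assms by (intro sum.group[symmetric]) auto
  also have "\<dots> = (\<Sum>b\<in>T. real (card {x \<in> S. f x = b}) * F b)"
    by (intro sum.cong) auto
  finally show ?thesis by (simp add: sum_divide_distrib freq_def)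
qed

lemma entr_mono:
  assumes "finite S" "\<And>x y. x \<in> S \<Longrightarrow> y \<in> S \<Longrightarrow> g x = g y \<Longrightarrow> f x = f y"
  shows "entr S f \<le> entr S g"
proof -
  have "(\<Sum>x\<in>S. ln (freq S g (g x))) \<le> (\<Sum>x\<in>S. ln (freq S f (f x)))"
  proof (rule sum_mono)
    fix x assume x: "x \<in> S"
    have "freq S g (g x) \<le> freq S f (f x)"
      by (rule freq_mono[OF assms(1)]) (use x assms(2) in blast)
    then show "ln (freq S g (g x)) \<le> ln (freq S f (f x))"
      using freq_pos[OF assms(1) x, of g] by (intro ln_mono)
  qed
  then show ?thesis unfolding entr_def by (intro divide_right_mono) auto
qed

lemma entr_eq:
  assumes "finite S" "\<And>x y. x \<in> S \<Longrightarrow> y \<in> S \<Longrightarrow> g x = g y \<longleftrightarrow> f x = f y"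
  shows "entr S f = entr S g"
  by (rule order.antisym; rule entr_mono[OF assms(1)]) (use assms(2) in blast)+

lemma entr_inj:
  assumes "finite S" "inj_on f S"
  shows "entr S f = ln (real (card S))"
proof (cases "S = {}")
  case False
  have "freq S f (f x) = 1 / real (card S)" if "x \<in> S" for x
  proof -
    have "{y \<in> S. f y = f x} = {x}" using that assms by (auto simp: inj_on_def)
    then show ?thesis by (simp add: freq_def)
  qed
  then have "(\<Sum>x\<in>S. ln (freq S f (f x))) = (\<Sum>x\<in>S. - ln (real (card S)))"
    using False assms by (intro sum.cong) (auto simp: ln_div card_gt_0_iff)
  then show ?thesis using False assms by (simp add: entr_def)
qed (simp add: entr_def)

lemma entr_const:
  assumes "finite S" "\<And>x y. x \<in> S \<Longrightarrow> y \<in> S \<Longrightarrow> f x = f y"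
  shows "entr S f = 0"
proof -
  have "freq S f (f x) = 1" if "x \<in> S" for x
  proof -
    have "{y \<in> S. f y = f x} = S" using that assms(2) by blast
    moreover have "card S > 0" using that assms(1) by (auto simp: card_gt_0_iff)
    ultimately show ?thesis by (simp add: freq_def)
  qed
  then show ?thesis by (simp add: entr_def)
qed

text \<open>Nonnegativity of the conditional mutual information of \<open>f\<close> and
  \<open>g\<close> given \<open>h\<close>. With \<open>F\<close> the ratio of the conditionally
  independent law to the true one, \<open>ln F \<le> F - 1\<close> reduces the claim to the mean of
  \<open>F\<close> being at most 1.\<close>

lemma entr_submod:
  assumes "finite S"
  shows "entr S (\<lambda>x. (f x, g x, h x)) + entr S h \<le> entr S (\<lambda>x. (f x, h x)) + entr S (\<lambda>x. (g x, h x))"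
proof (cases "S = {}")
  case False
  let ?fh = "\<lambda>x. (f x, h x)" and ?gh = "\<lambda>x. (g x, h x)" and ?fgh = "\<lambda>x. (f x, g x, h x)"
  define F where "F = (\<lambda>(a,b,c). freq S ?fh (a,c) * freq S ?gh (b,c) / (freq S ?fgh (a,b,c) * freq S h c))"
  have pos: "freq S ?fh (?fh x) > 0" "freq S ?gh (?gh x) > 0" "freq S ?fgh (?fgh x) > 0" "freq S h (h x) > 0"
    if "x \<in> S" for x
    using freq_pos[OF assms that, of ?fh] freq_pos[OF assms that, of ?gh]
      freq_pos[OF assms that, of ?fgh] freq_pos[OF assms that, of h] by auto
  have "(\<Sum>x\<in>S. ln (freq S ?fh (?fh x)) + ln (freq S ?gh (?gh x)) - ln (freq S ?fgh (?fgh x)) - ln (freq S h (h x)))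
      \<le> (\<Sum>x\<in>S. F (?fgh x) - 1)"
  proof (rule sum_mono)
    fix x assume x: "x \<in> S"
    have Fp: "F (?fgh x) > 0" using pos[OF x] by (simp add: F_def)
    have "ln (freq S ?fh (?fh x)) + ln (freq S ?gh (?gh x)) - ln (freq S ?fgh (?fgh x)) - ln (freq S h (h x))
      = ln (F (?fgh x))"
      using pos[OF x] by (simp add: F_def ln_div ln_mult)
    also have "\<dots> \<le> F (?fgh x) - 1" using Fp by (rule ln_le_minus_one)
    finally show "ln (freq S ?fh (?fh x)) + ln (freq S ?gh (?gh x)) - ln (freq S ?fgh (?fgh x)) - ln (freq S h (h x))
      \<le> F (?fgh x) - 1" .
  qed
  also have "\<dots> = (\<Sum>x\<in>S. F (?fgh x)) - real (card S)" by (simp add: sum_subtractf)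
  also have "\<dots> \<le> 0"
  proof -
    have "(\<Sum>x\<in>S. F (?fgh x)) / real (card S)
        = (\<Sum>t\<in>f ` S \<times> g ` S \<times> h ` S. freq S ?fgh t * F t)"
      using assms by (intro sum_as_freq) auto
    \<comment> \<open>The new sum also counts triples that never occur, where the old summand is 0;
      elsewhere the summands agree.\<close>
    also have "\<dots> \<le> (\<Sum>t\<in>f ` S \<times> g ` S \<times> h ` S. case t of (a,b,c) \<Rightarrow> freq S ?fh (a,c) * freq S ?gh (b,c) / freq S h c)"
      by (intro sum_mono) (auto simp: F_def freq_nonneg intro!: mult_nonneg_nonneg divide_nonneg_nonneg)
    also have "\<dots> = (\<Sum>a\<in>f ` S. \<Sum>b\<in>g ` S. \<Sum>c\<in>h ` S. freq S ?fh (a,c) * freq S ?gh (b,c) / freq S h c)"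
      by (simp add: sum.cartesian_product)
    also have "\<dots> = (\<Sum>c\<in>h ` S. \<Sum>a\<in>f ` S. \<Sum>b\<in>g ` S. freq S ?fh (a,c) * freq S ?gh (b,c) / freq S h c)"
      by (subst (2) sum.swap, subst sum.swap, rule refl)
    also have "\<dots> = (\<Sum>c\<in>h ` S. (\<Sum>a\<in>f ` S. freq S ?fh (a,c)) * (\<Sum>b\<in>g ` S. freq S ?gh (b,c)) / freq S h c)"
      by (simp add: sum_product sum_divide_distrib)
    also have "\<dots> = (\<Sum>c\<in>h ` S. freq S h c)"
    proof (rule sum.cong[OF refl])
      fix c assume "c \<in> h ` S"
      then have "freq S h c > 0" using freq_pos[OF assms] by auto
      moreover have "freq S h c = (\<Sum>t\<in>f ` S \<times> {c}. freq S ?fh t)" "freq S h c = (\<Sum>t\<in>g ` S \<times> {c}. freq S ?gh t)"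
        using assms by (auto intro!: freq_sum)
      moreover have "(\<Sum>t\<in>f ` S \<times> {c}. freq S ?fh t) = (\<Sum>a\<in>f ` S. freq S ?fh (a,c))"
         "(\<Sum>t\<in>g ` S \<times> {c}. freq S ?gh t) = (\<Sum>a\<in>g ` S. freq S ?gh (a,c))"
        by (simp_all add: sum.cartesian_product' image_constant_conv)
      ultimately show "(\<Sum>a\<in>f ` S. freq S ?fh (a,c)) * (\<Sum>b\<in>g ` S. freq S ?gh (b,c)) / freq S h c = freq S h c"
        by simp
    qed
    also have "\<dots> = 1" using assms False by (intro freq_sum_one) auto
    finally show ?thesis using False assms by (simp add: divide_le_eq card_gt_0_iff)
  qed
  finally have *: "(\<Sum>x\<in>S. ln (freq S ?fh (?fh x))) + (\<Sum>x\<in>S. ln (freq S ?gh (?gh x)))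
     \<le> (\<Sum>x\<in>S. ln (freq S ?fgh (?fgh x))) + (\<Sum>x\<in>S. ln (freq S h (h x)))"
    by (simp add: sum.distrib sum_subtractf)
  show ?thesis unfolding entr_def add_divide_distrib[symmetric]
    using * by (intro divide_right_mono) auto
qed (simp add: entr_def)

lemma centr_anti:
  assumes "finite S" "\<And>x y. x \<in> S \<Longrightarrow> y \<in> S \<Longrightarrow> g' x = g' y \<Longrightarrow> g x = g y"
  shows "centr S f g' \<le> centr S f g"
proof -
  have "entr S (\<lambda>x. (f x, g' x, g x)) = entr S (\<lambda>x. (f x, g' x))"
       "entr S (\<lambda>x. (g' x, g x)) = entr S g'"
    by (rule entr_eq[OF assms(1)]; use assms(2) in blast)+
  with entr_submod[OF assms(1), of f g' g] show ?thesis by (simp add: centr_def)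
qed

lemma centr_cong:
  assumes "finite S" "\<And>x y. x \<in> S \<Longrightarrow> y \<in> S \<Longrightarrow> g' x = g' y \<longleftrightarrow> g x = g y"
    "\<And>x y. x \<in> S \<Longrightarrow> y \<in> S \<Longrightarrow> g x = g y \<Longrightarrow> f' x = f' y \<longleftrightarrow> f x = f y"
  shows "centr S f' g' = centr S f g"
proof -
  have "entr S (\<lambda>x. (f' x, g' x)) = entr S (\<lambda>x. (f x, g x))" "entr S g' = entr S g"
    by (rule entr_eq[OF assms(1)]; use assms(2,3) in blast)+
  then show ?thesis by (simp add: centr_def)
qed

lemma centr_nonneg: "finite S \<Longrightarrow> centr S f g \<ge> 0"
  unfolding centr_def using entr_mono[of S "\<lambda>x. (f x, g x)" g] by simp

lemma centr_mono:
  assumes "finite S" "\<And>x y. x \<in> S \<Longrightarrow> y \<in> S \<Longrightarrow> g x = g y \<Longrightarrow> f x = f y \<Longrightarrow> f' x = f' y"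
  shows "centr S f' g \<le> centr S f g"
proof -
  have "entr S (\<lambda>x. (f' x, g x)) \<le> entr S (\<lambda>x. (f x, g x))"
    by (rule entr_mono[OF assms(1)]) (use assms(2) in blast)
  then show ?thesis by (simp add: centr_def)
qed

lemma centr_pair:
  assumes "finite S"
  shows "centr S (\<lambda>x. (f x, g x)) h = centr S f (\<lambda>x. (g x, h x)) + centr S g h"
proof -
  have "entr S (\<lambda>x. ((f x, g x), h x)) = entr S (\<lambda>x. (f x, g x, h x))"
    by (rule entr_eq[OF assms(1)]) auto
  then show ?thesis by (simp add: centr_def)
qed

lemma centr_determined:
  assumes "finite S" "\<And>x y. x \<in> S \<Longrightarrow> y \<in> S \<Longrightarrow> g x = g y \<Longrightarrow> f x = f y"
  shows "centr S f g = 0"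
proof -
  have "entr S (\<lambda>x. (f x, g x)) = entr S g"
    by (rule entr_eq[OF assms(1)]) (use assms(2) in blast)
  then show ?thesis by (simp add: centr_def)
qed

text \<open>Subadditivity turns an entropy bound for a whole block of coins into one for the sum
  over single coins; \<open>restrict\<close> keeps values outside \<open>A\<close> from counting as
  information.\<close>

lemma centr_family_le:
  assumes "finite S" "finite A"
  shows "centr S (\<lambda>x. restrict (F x) A) g \<le> (\<Sum>a\<in>A. centr S (\<lambda>x. F x a) g)"
  using assms(2)
proof induction
  case empty
  then show ?case using assms by (simp add: centr_determined)
next
  case (insert a A)
  have "centr S (\<lambda>x. restrict (F x) (insert a A)) g = centr S (\<lambda>x. (F x a, restrict (F x) A)) g"
    by (rule centr_cong[OF assms(1)]) (auto simp: restrict_def fun_eq_iff)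
  also have "\<dots> = centr S (\<lambda>x. F x a) (\<lambda>x. (restrict (F x) A, g x)) + centr S (\<lambda>x. restrict (F x) A) g"
    using assms by (intro centr_pair)
  also have "\<dots> \<le> centr S (\<lambda>x. F x a) g + (\<Sum>a\<in>A. centr S (\<lambda>x. F x a) g)"
    by (rule add_mono[OF centr_anti[OF assms(1)] insert.IH]) auto
  finally show ?case by (simp only: sum.insert[OF insert.hyps])
qed

section \<open>Entropy deficit and Hellinger distance\<close>


text \<open>\<open>ln t \<le> t - 1\<close> at \<open>t = sqrt (w / q)\<close>. The correction
  \<open>- q + w\<close> sums to 0 for laws of equal mass and makes every single term
  nonnegative.\<close>

lemma kl_term_ge:
  fixes q w :: real
  assumes "0 \<le> q" "0 < w"
  shows "(sqrt q - sqrt w)\<^sup>2 \<le> q * ln (q / w) - q + w"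
proof (cases "q = 0")
  case False
  then have q: "q > 0" using assms by simp
  have "ln (q / w) = - (2 * ln (sqrt (w / q)))"
    using q assms by (simp add: ln_sqrt ln_div field_simps)
  moreover have "ln (sqrt (w / q)) \<le> sqrt (w / q) - 1"
    using q assms by (intro ln_le_minus_one) auto
  ultimately have "q * ln (q / w) \<ge> q * (2 - 2 * sqrt (w / q))"
    using q by (intro mult_left_mono) auto
  moreover have "q * sqrt (w / q) = sqrt q * sqrt w"
    using q by (simp add: real_sqrt_divide field_simps)
  ultimately show ?thesis using q assms
    by (simp add: power2_diff algebra_simps)
qed (use assms in auto)

text \<open>The converse of \<open>kl_term_ge\<close> pays the logarithm of the density. With
  \<open>s = sqrt x\<close>, the case \<open>s \<le> 2\<close> uses \<open>ln s \<le> s - 1\<close>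
  and \<open>2 * s + 1 \<le> 5\<close>; for larger \<open>s\<close>,
  \<open>s \<le> 2 * (s - 1)\<close> and \<open>ln x \<le> ln M\<close> give
  \<open>4 * ln M\<close>.\<close>

lemma entropy_poly_le:
  fixes x M :: real
  assumes "0 \<le> x" "x \<le> M" "1 \<le> M"
  shows "x * ln x - x + 1 \<le> (5 + 4 * ln M) * (sqrt x - 1)\<^sup>2"
proof (cases "x = 0")
  case True
  then show ?thesis using assms by auto
next
  case False
  define s where "s = sqrt x"
  have s: "s > 0" "x = s\<^sup>2" using False assms by (auto simp: s_def)
  have lnM: "ln M \<ge> 0" using assms by simp
  have lnx: "ln x = 2 * ln s" using s by (simp add: ln_realpow)
  show ?thesis
  proof (cases "s \<le> 2")
    case True
    have "x * ln x - x + 1 \<le> s\<^sup>2 * (2 * (s - 1)) - s\<^sup>2 + 1"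
      using s lnx ln_le_minus_one[OF s(1)] by (auto intro!: mult_left_mono)
    also have "\<dots> = (2 * s + 1) * (s - 1)\<^sup>2" by (simp add: power2_eq_square algebra_simps)
    also have "\<dots> \<le> (5 + 4 * ln M) * (s - 1)\<^sup>2"
      using True lnM by (intro mult_right_mono) auto
    finally show ?thesis by (simp add: s_def)
  next
    case F: False
    then have "x \<ge> 1" using s by (simp add: one_le_power)
    have "s\<^sup>2 \<le> 4 * (s - 1)\<^sup>2"
    proof -
      have "s\<^sup>2 \<le> (2 * (s - 1))\<^sup>2"
        using F by (intro power_mono) auto
      also have "\<dots> = 4 * (s - 1)\<^sup>2" by (simp only: power_mult_distrib) simp
      finally show ?thesis .
    qed
    then have "x * ln x \<le> 4 * (s - 1)\<^sup>2 * ln M"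
      using s(1,2) \<open>x \<ge> 1\<close> assms by (intro mult_mono[of x _ "ln x" "ln M"] ln_mono) simp_all
    also have "\<dots> = (4 * ln M) * (s - 1)\<^sup>2" by (simp only: mult_ac)
    also have "\<dots> \<le> (5 + 4 * ln M) * (s - 1)\<^sup>2"
      by (rule mult_right_mono) auto
    finally show ?thesis using \<open>x \<ge> 1\<close> by (simp add: s_def)
  qed
qed

lemma kl_term_le:
  fixes q w M :: real
  assumes "0 \<le> q" "0 < w" "q \<le> M * w" "1 \<le> M"
  shows "q * ln (q / w) - q + w \<le> (5 + 4 * ln M) * (sqrt q - sqrt w)\<^sup>2"
proof -
  define x where "x = q / w"
  have q: "q = x * w" using assms by (simp add: x_def)
  have "x * ln x - x + 1 \<le> (5 + 4 * ln M) * (sqrt x - 1)\<^sup>2"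
    using assms by (intro entropy_poly_le) (auto simp: x_def divide_le_eq)
  then have "w * (x * ln x - x + 1) \<le> w * ((5 + 4 * ln M) * (sqrt x - 1)\<^sup>2)"
    using assms by (intro mult_left_mono) auto
  moreover have "w * (sqrt x - 1)\<^sup>2 = (sqrt q - sqrt w)\<^sup>2"
    using assms by (simp add: q real_sqrt_mult power2_eq_square algebra_simps)
  moreover have "q * ln (q / w) - q + w = w * (x * ln x - x + 1)"
    using assms by (simp add: x_def algebra_simps)
  ultimately show ?thesis
    by (metis mult.left_commute)
qed

text \<open>Neither halved nor under a root, so that it compares termwise with relative entropy and
  adds up over fibres. Joint laws are inserted, so that conditioning needs no division.\<close>

definition hel :: "'a set \<Rightarrow> ('a \<Rightarrow> real) \<Rightarrow> ('a \<Rightarrow> real) \<Rightarrow> real" where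
  "hel T P Q = (\<Sum>t\<in>T. (sqrt (P t) - sqrt (Q t))\<^sup>2)"

lemma hel_nonneg: "hel T P Q \<ge> 0"
  by (simp add: hel_def sum_nonneg)

lemma hel_commute: "hel T P Q = hel T Q P"
  by (simp add: hel_def power2_commute)

lemma square_diff_triangle: "(a - c)\<^sup>2 \<le> 2 * (a - b)\<^sup>2 + 2 * (b - c)\<^sup>2" for a b c :: real
proof -
  have "2 * (a - b)\<^sup>2 + 2 * (b - c)\<^sup>2 - (a - c)\<^sup>2 = (a - 2 * b + c)\<^sup>2"
    by (simp add: power2_eq_square algebra_simps)
  then show ?thesis by (smt (verit) zero_le_power2)
qed

lemma hel_triangle: "hel T P R \<le> 2 * hel T P Q + 2 * hel T Q R"
  unfolding hel_def sum_distrib_left sum.distrib[symmetric]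
  by (rule sum_mono, rule square_diff_triangle)

text \<open>The reverse triangle inequality for the Euclidean norms of the vectors with entries
  \<open>sqrt (a i)\<close> and \<open>sqrt (b i)\<close>. It yields both data processing and the
  comparison of averages.\<close>

lemma sqrt_sum_diff_le:
  fixes a b :: "'a \<Rightarrow> real"
  assumes "\<And>i. i \<in> I \<Longrightarrow> a i \<ge> 0" "\<And>i. i \<in> I \<Longrightarrow> b i \<ge> 0"
  shows "(sqrt (\<Sum>i\<in>I. a i) - sqrt (\<Sum>i\<in>I. b i))\<^sup>2 \<le> (\<Sum>i\<in>I. (sqrt (a i) - sqrt (b i))\<^sup>2)"
proof -
  have "(\<Sum>i\<in>I. sqrt (a i) * sqrt (b i))\<^sup>2 \<le> (\<Sum>i\<in>I. (sqrt (a i))\<^sup>2) * (\<Sum>i\<in>I. (sqrt (b i))\<^sup>2)"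
    by (rule Cauchy_Schwarz_ineq_sum)
  also have "\<dots> = (\<Sum>i\<in>I. a i) * (\<Sum>i\<in>I. b i)" using assms by simp
  finally have "(\<Sum>i\<in>I. sqrt (a i) * sqrt (b i)) \<le> sqrt ((\<Sum>i\<in>I. a i) * (\<Sum>i\<in>I. b i))"
    by (rule real_le_rsqrt)
  moreover have "(\<Sum>i\<in>I. (sqrt (a i) - sqrt (b i))\<^sup>2) = (\<Sum>i\<in>I. a i + b i - 2 * (sqrt (a i) * sqrt (b i)))"
    using assms by (intro sum.cong) (auto simp: power2_diff)
  moreover have "\<dots> = (\<Sum>i\<in>I. a i) + (\<Sum>i\<in>I. b i) - 2 * (\<Sum>i\<in>I. sqrt (a i) * sqrt (b i))"
    by (simp add: sum.distrib sum_subtractf sum_distrib_left)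
  ultimately show ?thesis using assms
    by (simp add: power2_diff real_sqrt_mult sum_nonneg)
qed

lemma hel_group:
  assumes "finite T" "finite T'" "\<phi> ` T \<subseteq> T'"
    "\<And>t. t \<in> T \<Longrightarrow> P t \<ge> 0" "\<And>t. t \<in> T \<Longrightarrow> Q t \<ge> 0"
    "\<And>t'. t' \<in> T' \<Longrightarrow> P' t' = (\<Sum>t\<in>{t \<in> T. \<phi> t = t'}. P t)"
    "\<And>t'. t' \<in> T' \<Longrightarrow> Q' t' = (\<Sum>t\<in>{t \<in> T. \<phi> t = t'}. Q t)"
  shows "hel T' P' Q' \<le> hel T P Q"
proof -
  have "hel T' P' Q' \<le> (\<Sum>t'\<in>T'. \<Sum>t\<in>{t \<in> T. \<phi> t = t'}. (sqrt (P t) - sqrt (Q t))\<^sup>2)"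
    unfolding hel_def
  proof (rule sum_mono)
    fix t' assume t': "t' \<in> T'"
    show "(sqrt (P' t') - sqrt (Q' t'))\<^sup>2 \<le> (\<Sum>t\<in>{t \<in> T. \<phi> t = t'}. (sqrt (P t) - sqrt (Q t))\<^sup>2)"
      unfolding assms(6)[OF t'] assms(7)[OF t'] using assms by (intro sqrt_sum_diff_le) auto
  qed
  also have "\<dots> = hel T P Q"
    unfolding hel_def using assms by (intro sum.group) auto
  finally show ?thesis .
qed

text \<open>The deficit is a relative entropy; under the reference law \<open>f\<close> is uniform
  on \<open>B z\<close> given \<open>g = z\<close>. The range depends on \<open>z\<close> because
  revealed cards are no longer available. The terms \<open>- q + w\<close> cancel within each fibre,
  as both sum to \<open>freq S g z\<close>.\<close>

lemma deficit_eq: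
  fixes M :: nat
  assumes S: "finite S" "S \<noteq> {}" and "M > 0"
    and B: "\<And>z. z \<in> g ` S \<Longrightarrow> finite (B z)" "\<And>z. z \<in> g ` S \<Longrightarrow> card (B z) = M"
    and fB: "\<And>x. x \<in> S \<Longrightarrow> f x \<in> B (g x)"
  defines "q \<equiv> \<lambda>b z. freq S (\<lambda>x. (f x, g x)) (b, z)" and "w \<equiv> \<lambda>z. freq S g z / real M"
  shows "ln (real M) - centr S f g = (\<Sum>z\<in>g ` S. \<Sum>b\<in>B z. q b z * ln (q b z / w z) - q b z + w z)"
proof -
  have wpos: "w z > 0" if "z \<in> g ` S" for z
    using that freq_pos[OF S(1), of _ g] \<open>M > 0\<close> by (auto simp: w_def)
  have qpos: "q (f x) (g x) > 0" if "x \<in> S" for x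
    using freq_pos[OF S(1) that, of "\<lambda>x. (f x, g x)"] by (simp add: q_def)
  have cpos: "real (card S) > 0" using S by (simp add: card_gt_0_iff)
  have "ln (real M) - centr S f g
     = (\<Sum>x\<in>S. ln (real M)) / card S + (\<Sum>x\<in>S. ln (q (f x) (g x))) / card S - (\<Sum>x\<in>S. ln (freq S g (g x))) / card S"
    using cpos by (simp add: centr_def entr_def q_def)
  also have "\<dots> = (\<Sum>x\<in>S. ln (real M) + ln (q (f x) (g x)) - ln (freq S g (g x))) / card S"
    by (simp only: sum.distrib sum_subtractf add_divide_distrib diff_divide_distrib)
  also have "\<dots> = (\<Sum>x\<in>S. (\<lambda>(z, b). ln (q b z / w z)) (g x, f x)) / card S"
  proof (intro arg_cong2[of _ _ _ _ "(/)"] sum.cong refl)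
    fix x assume x: "x \<in> S"
    have "freq S g (g x) > 0" using freq_pos[OF S(1) x] .
    then show "ln (real M) + ln (q (f x) (g x)) - ln (freq S g (g x)) = (case (g x, f x) of (z, b) \<Rightarrow> ln (q b z / w z))"
      using qpos[OF x] \<open>M > 0\<close> by (simp add: w_def ln_div ln_mult)
  qed
  also have "\<dots> = (\<Sum>t\<in>Sigma (g ` S) B. freq S (\<lambda>x. (g x, f x)) t * (\<lambda>(z, b). ln (q b z / w z)) t)"
    using S B fB by (intro sum_as_freq) (auto intro!: finite_SigmaI)
  also have "\<dots> = (\<Sum>(z, b)\<in>Sigma (g ` S) B. q b z * ln (q b z / w z))"
  proof (rule sum.cong[OF refl])
    fix t assume "t \<in> Sigma (g ` S) B"
    obtain z b where t: "t = (z, b)" by (cases t)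
    have "freq S (\<lambda>x. (g x, f x)) (z, b) = q b z"
      unfolding q_def by (rule freq_cong) auto
    then show "freq S (\<lambda>x. (g x, f x)) t * (\<lambda>(z, b). ln (q b z / w z)) t = (case t of (z, b) \<Rightarrow> q b z * ln (q b z / w z))"
      by (simp add: t)
  qed
  also have "\<dots> = (\<Sum>z\<in>g ` S. \<Sum>b\<in>B z. q b z * ln (q b z / w z))"
    using S B by (subst sum.Sigma) auto
  also have "\<dots> = (\<Sum>z\<in>g ` S. \<Sum>b\<in>B z. q b z * ln (q b z / w z) - q b z + w z)"
  proof (rule sum.cong[OF refl])
    fix z assume z: "z \<in> g ` S"
    have "freq S g z = (\<Sum>t\<in>B z \<times> {z}. freq S (\<lambda>x. (f x, g x)) t)"
    proof (rule freq_sum[OF S(1)])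
      show "finite (B z \<times> {z})" using B z by simp
      show "g x = z \<longleftrightarrow> (f x, g x) \<in> B z \<times> {z}" if "x \<in> S" for x
        using fB[OF that] by auto
    qed
    also have "\<dots> = (\<Sum>b\<in>B z. q b z)"
      by (simp add: sum.cartesian_product' q_def)
    finally have "(\<Sum>b\<in>B z. q b z) = freq S g z" ..
    moreover have "(\<Sum>b\<in>B z. w z) = freq S g z" using B z \<open>M > 0\<close> by (simp add: w_def)
    ultimately show "(\<Sum>b\<in>B z. q b z * ln (q b z / w z)) = (\<Sum>b\<in>B z. q b z * ln (q b z / w z) - q b z + w z)"
      by (simp only: sum.distrib sum_subtractf)
  qed
  finally show ?thesis .
qed

lemma deficit_ge_hel:
  fixes M :: nat
  assumes S: "finite S" "S \<noteq> {}" and "M > 0"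
    and B: "\<And>z. z \<in> g ` S \<Longrightarrow> finite (B z)" "\<And>z. z \<in> g ` S \<Longrightarrow> card (B z) = M"
    and fB: "\<And>x. x \<in> S \<Longrightarrow> f x \<in> B (g x)"
  shows "(\<Sum>z\<in>g ` S. hel (B z) (\<lambda>b. freq S (\<lambda>x. (f x, g x)) (b, z)) (\<lambda>b. freq S g z / real M))
     \<le> ln (real M) - centr S f g"
  apply (subst deficit_eq[of S M g B f])
  apply (use assms in auto)[6]
  unfolding hel_def
  using freq_pos[OF S(1), of _ g] \<open>M > 0\<close>
  by (intro sum_mono kl_term_ge) (auto simp: freq_nonneg)

text \<open>A joint probability is at most \<open>freq S g z\<close>, which is \<open>M\<close>
  times the reference weight. So the density is at most \<open>M\<close>, and a factor of order
  \<open>ln M\<close> enters here.\<close>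

lemma deficit_le_hel:
  fixes M :: nat
  assumes S: "finite S" "S \<noteq> {}" and "M > 0"
    and B: "\<And>z. z \<in> g ` S \<Longrightarrow> finite (B z)" "\<And>z. z \<in> g ` S \<Longrightarrow> card (B z) = M"
    and fB: "\<And>x. x \<in> S \<Longrightarrow> f x \<in> B (g x)"
  shows "ln (real M) - centr S f g \<le> (5 + 4 * ln (real M)) *
     (\<Sum>z\<in>g ` S. hel (B z) (\<lambda>b. freq S (\<lambda>x. (f x, g x)) (b, z)) (\<lambda>b. freq S g z / real M))"
  apply (subst deficit_eq[of S M g B f])
  apply (use assms in auto)[6]
  unfolding hel_def sum_distrib_left
proof (intro sum_mono kl_term_le)
  fix z b assume "z \<in> g ` S"
  then show "freq S g z / real M > 0" using freq_pos[OF S(1), of _ g] \<open>M > 0\<close> by auto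
  have "freq S (\<lambda>x. (f x, g x)) (b, z) \<le> freq S g z"
    using S by (intro freq_mono) auto
  then show "freq S (\<lambda>x. (f x, g x)) (b, z) \<le> real M * (freq S g z / real M)"
    using \<open>M > 0\<close> by simp
qed (use \<open>M > 0\<close> in \<open>auto simp: freq_nonneg\<close>)

lemma centr_le_ln:
  fixes M :: nat
  assumes S: "finite S" "S \<noteq> {}" and "M > 0"
    and B: "\<And>z. z \<in> g ` S \<Longrightarrow> finite (B z)" "\<And>z. z \<in> g ` S \<Longrightarrow> card (B z) = M"
    and fB: "\<And>x. x \<in> S \<Longrightarrow> f x \<in> B (g x)"
  shows "centr S f g \<le> ln (real M)"
  using order.trans[OF _ deficit_ge_hel[of S M g B f, OF assms], of 0]
  by (simp add: sum_nonneg hel_nonneg)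

section \<open>Subcubes and one round of the shuffle\<close>


lemma hypercube_iff: "v \<in> hypercube d \<longleftrightarrow> (\<forall>i\<in>{1..d}. v i = 0 \<or> v i = 1) \<and> v \<in> extensional {1..d}"
  by (auto simp: hypercube_def PiE_iff)

lemma vertex_bit: "v \<in> hypercube d \<Longrightarrow> i \<in> {1..d} \<Longrightarrow> v i \<noteq> 0 \<Longrightarrow> v i = 1"
  using PiE_mem[of v "{1..d}" "\<lambda>_. {0, 1}" i] by (simp add: hypercube_def)

lemma finite_hypercube [simp]: "finite (hypercube d)"
  by (auto simp: hypercube_def intro!: finite_PiE)

lemma flip_other [simp]: "i \<noteq> j \<Longrightarrow> flip j v i = v i"
  by (simp add: flip_def)

lemma flip_same: "flip j v j = 1 - v j"
  by (simp add: flip_def)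

lemma flip_in_hypercube: "v \<in> hypercube d \<Longrightarrow> j \<in> {1..d} \<Longrightarrow> flip j v \<in> hypercube d"
  by (auto simp: hypercube_iff flip_def extensional_def)

lemma flip_flip: "v \<in> hypercube d \<Longrightarrow> j \<in> {1..d} \<Longrightarrow> flip j (flip j v) = v"
  using vertex_bit[of v d j] by (cases "v j = 0") (auto simp: flip_def fun_eq_iff)

lemma flip_neq: "flip j v \<noteq> v"
proof
  assume "flip j v = v"
  then have "flip j v j = v j" by simp
  then show False by (simp add: flip_def) presburger
qed

text \<open>Coordinates above \<open>j\<close> are frozen at 0, so these cubes are nested and the
  lower face of each is the next smaller one. This makes the contributions of the directions
  telescope.\<close>

definition subcube :: "nat \<Rightarrow> nat \<Rightarrow> (nat \<Rightarrow> nat) set" where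
  "subcube d j = {v \<in> hypercube d. \<forall>i\<in>{j<..d}. v i = 0}"

definition upper :: "nat \<Rightarrow> nat \<Rightarrow> (nat \<Rightarrow> nat) set" where
  "upper d j = {v \<in> subcube d j. v j = 1}"

definition lower :: "nat \<Rightarrow> nat \<Rightarrow> (nat \<Rightarrow> nat) set" where
  "lower d j = {v \<in> subcube d j. v j = 0}"

lemma subcube_subset: "subcube d j \<subseteq> hypercube d"
  by (auto simp: subcube_def)

lemma upper_subset: "upper d j \<subseteq> hypercube d"
  by (auto simp: upper_def subcube_def)

lemma lower_subset: "lower d j \<subseteq> hypercube d"
  by (auto simp: lower_def subcube_def)

lemma finite_subcube [simp]: "finite (subcube d j)" "finite (upper d j)" "finite (lower d j)"
  using finite_subset[OF subcube_subset] finite_subset[OF upper_subset] finite_subset[OF lower_subset]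
  by auto

lemma subcube_full: "subcube d d = hypercube d"
  by (auto simp: subcube_def)

lemma lower_eq: "j \<in> {1..d} \<Longrightarrow> lower d j = subcube d (j - 1)"
proof -
  assume j: "j \<in> {1..d}"
  then have "{j - 1<..d} = insert j {j<..d}" by auto
  then show ?thesis by (auto simp: lower_def subcube_def)
qed

lemma subcube_split: "j \<in> {1..d} \<Longrightarrow> subcube d j = upper d j \<union> lower d j"
  using vertex_bit[of _ d j] by (auto simp: lower_def upper_def subcube_def)

lemma upper_lower_disjoint: "upper d j \<inter> lower d j = {}"
  by (auto simp: lower_def upper_def)

lemma flip_subcube:
  assumes "v \<in> subcube d j" "s \<in> {1..j}" "j \<le> d"
  shows "flip s v \<in> subcube d j"
  using assms flip_in_hypercube[of v d s] by (auto simp: subcube_def)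

lemma flip_upper:
  assumes "v \<in> upper d j" "s \<in> {1..<j}" "j \<le> d"
  shows "flip s v \<in> upper d j"
  using assms flip_subcube[of v d j s] by (auto simp: upper_def)

lemma flip_lower:
  assumes "v \<in> lower d j" "s \<in> {1..<j}" "j \<le> d"
  shows "flip s v \<in> lower d j"
  using assms flip_subcube[of v d j s] by (auto simp: lower_def)

lemma bij_flip_upper_lower:
  assumes "j \<in> {1..d}"
  shows "bij_betw (flip j) (upper d j) (lower d j)"
proof (rule bij_betw_byWitness[where f' = "flip j"])
  show "\<forall>v\<in>upper d j. flip j (flip j v) = v" "\<forall>v\<in>lower d j. flip j (flip j v) = v"
    using assms flip_flip[of _ d j] upper_subset lower_subset by blast+
  show "flip j ` upper d j \<subseteq> lower d j" "flip j ` lower d j \<subseteq> upper d j"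
    using assms flip_subcube[of _ d j j] by (auto simp: upper_def lower_def flip_same)
qed

lemma card_subcube: "j \<le> d \<Longrightarrow> card (subcube d j) = 2 ^ j"
proof -
  assume j: "j \<le> d"
  have "subcube d j = PiE {1..d} (\<lambda>i. if i \<le> j then {0, 1} else {0})"
    using j by (auto simp: subcube_def hypercube_def PiE_iff extensional_def split: if_splits)
  then have "card (subcube d j) = (\<Prod>i\<in>{1..d}. card (if i \<le> j then {0, 1 :: nat} else {0}))"
    by (simp add: card_PiE)
  also have "\<dots> = (\<Prod>i\<in>{1..d}. if i \<le> j then 2 else 1)"
    by (intro prod.cong) auto
  also have "\<dots> = 2 ^ card ({1..d} \<inter> {i. i \<le> j})"
    by (simp add: prod.If_cases)
  also have "{1..d} \<inter> {i. i \<le> j} = {1..j}" using j by auto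
  finally show ?thesis by simp
qed

lemma card_hypercube: "card (hypercube d) = 2 ^ d"
  using card_subcube[of d d] by (simp add: subcube_full)

lemma card_lower: "j \<in> {1..d} \<Longrightarrow> card (lower d j) = 2 ^ (j - 1)"
  using card_subcube[of "j - 1" d] by (simp add: lower_eq le_diff_conv)

lemma card_upper: "j \<in> {1..d} \<Longrightarrow> card (upper d j) = 2 ^ (j - 1)"
  using bij_betw_same_card[OF bij_flip_upper_lower] card_lower by simp

text \<open>Each edge is represented by its endpoint with vanishing \<open>s\<close>-th coordinate.\<close>

definition coin_sites :: "nat \<Rightarrow> (nat \<times> (nat \<Rightarrow> nat)) set" where
  "coin_sites d = (SIGMA s:{1..d}. {v \<in> hypercube d. v s = 0})"

lemma card_coordinate_zero:
  assumes "s \<in> {1..d}"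
  shows "card {v \<in> hypercube d. v s = 0} = 2 ^ (d - 1)"
proof -
  have "{v \<in> hypercube d. v s = 0} = PiE {1..d} (\<lambda>i. if i = s then {0} else {0, 1})"
    using assms by (auto simp: hypercube_def PiE_iff extensional_def split: if_splits)
  then have "card {v \<in> hypercube d. v s = 0} = (\<Prod>i\<in>{1..d}. card (if i = s then {0} else {0, 1 :: nat}))"
    by (simp add: card_PiE)
  also have "\<dots> = (\<Prod>i\<in>{1..d}. if i = s then 1 else 2)"
    by (intro prod.cong) auto
  also have "\<dots> = 2 ^ card ({1..d} \<inter> - {i. i = s})"
    by (simp add: prod.If_cases)
  also have "{1..d} \<inter> - {i. i = s} = {1..d} - {s}" by auto
  finally show ?thesis using assms by simp
qed

lemma finite_coin_sites [simp]: "finite (coin_sites d)"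
  by (auto simp: coin_sites_def)

lemma card_coin_sites: "card (coin_sites d) = d * 2 ^ (d - 1)"
proof -
  have "card (coin_sites d) = (\<Sum>s\<in>{1..d}. card {v \<in> hypercube d. v s = 0})"
    unfolding coin_sites_def by (rule card_SigmaI) auto
  also have "\<dots> = (\<Sum>s\<in>{1..d}. 2 ^ (d - 1))"
    by (intro sum.cong card_coordinate_zero) auto
  finally show ?thesis by simp
qed

text \<open>The sample space \<open>S\<close> carries its uniform law. \<open>Y s \<omega> v\<close> is the card at the vertex \<open>v\<close> after \<open>s\<close>
  steps, and \<open>c s \<omega> v\<close> tells whether the edge of direction \<open>s\<close> at \<open>v\<close> is interchanged in step \<open>s\<close>;
  neither the starting arrangement nor the coins need be uniform or independent.\<close>

locale thorp_round =
  fixes d :: nat and S :: "'w set"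
    and Y :: "nat \<Rightarrow> 'w \<Rightarrow> (nat \<Rightarrow> nat) \<Rightarrow> nat"
    and c :: "nat \<Rightarrow> 'w \<Rightarrow> (nat \<Rightarrow> nat) \<Rightarrow> bool"
  assumes finS: "finite S" and Sne: "S \<noteq> {}" and d_pos: "d \<ge> 1"
    and Y_bij: "\<omega> \<in> S \<Longrightarrow> s \<le> d \<Longrightarrow> bij_betw (Y s \<omega>) (hypercube d) (cards d)"
    and c_flip: "\<omega> \<in> S \<Longrightarrow> s \<in> {1..d} \<Longrightarrow> v \<in> hypercube d \<Longrightarrow> c s \<omega> (flip s v) = c s \<omega> v"
    and Y_Suc: "\<omega> \<in> S \<Longrightarrow> s < d \<Longrightarrow> v \<in> hypercube d \<Longrightarrow>
      Y (Suc s) \<omega> v = Y s \<omega> (if c (Suc s) \<omega> v then flip (Suc s) v else v)"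
begin

abbreviation "V \<equiv> hypercube d"

section \<open>Trajectories of cards within a round\<close>

definition mv :: "nat \<Rightarrow> 'w \<Rightarrow> (nat \<Rightarrow> nat) \<Rightarrow> (nat \<Rightarrow> nat)" where
  "mv s \<omega> v = (if c s \<omega> v then flip s v else v)"

definition cont :: "nat \<Rightarrow> (nat \<Rightarrow> nat) set \<Rightarrow> 'w \<Rightarrow> (nat \<Rightarrow> nat) \<Rightarrow> nat" where
  "cont s A \<omega> = restrict (Y s \<omega>) A"

definition coins :: "(nat \<times> (nat \<Rightarrow> nat)) set \<Rightarrow> 'w \<Rightarrow> nat \<times> (nat \<Rightarrow> nat) \<Rightarrow> bool" where
  "coins A \<omega> = restrict (\<lambda>(s, v). c s \<omega> v) A"

text \<open>A card is named by its starting vertex \<open>k\<close>, so its trajectory depends on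
  the coins alone and not on the starting arrangement; \<open>Y_pos\<close> links the two
  descriptions.\<close>

primrec pos :: "nat \<Rightarrow> 'w \<Rightarrow> (nat \<Rightarrow> nat) \<Rightarrow> (nat \<Rightarrow> nat)" where
  "pos 0 \<omega> k = k"
| "pos (Suc s) \<omega> k = mv (Suc s) \<omega> (pos s \<omega> k)"

definition \<kappa> :: real where
  "\<kappa> = real (card (coin_sites d)) * ln 2 - centr S (coins (coin_sites d)) (cont 0 V)"

lemma cont_eq_iff: "cont s A \<omega> = cont s A \<omega>' \<longleftrightarrow> (\<forall>v\<in>A. Y s \<omega> v = Y s \<omega>' v)"
  by (auto simp: cont_def restrict_def fun_eq_iff)

lemma coins_eq_iff: "coins A \<omega> = coins A \<omega>' \<longleftrightarrow> (\<forall>(s, v)\<in>A. c s \<omega> v = c s \<omega>' v)"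
  by (force simp: coins_def restrict_def fun_eq_iff)

lemma mv_mv: "\<omega> \<in> S \<Longrightarrow> s \<in> {1..d} \<Longrightarrow> v \<in> V \<Longrightarrow> mv s \<omega> (mv s \<omega> v) = v"
  using c_flip flip_flip by (auto simp: mv_def)

lemma mv_other: "i \<noteq> s \<Longrightarrow> mv s \<omega> v i = v i"
  by (simp add: mv_def)

lemma mv_closed: "v \<in> A \<Longrightarrow> flip s v \<in> A \<Longrightarrow> mv s \<omega> v \<in> A"
  by (simp add: mv_def)

lemma c_base:
  assumes "\<omega> \<in> S" "s \<in> {1..d}" "v \<in> V"
  shows "c s \<omega> v = c s \<omega> (v(s := 0))"
proof (cases "v s = 0")
  case False
  then have "v s = 1" using assms vertex_bit by blast
  then have "v(s := 0) = flip s v" by (simp add: flip_def)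
  then show ?thesis using c_flip[OF assms] by simp
qed (simp add: fun_upd_idem)

lemma base_cases:
  assumes "v \<in> V" "s \<in> {1..d}"
  shows "v(s := 0) = v \<or> v(s := 0) = flip s v"
proof (cases "v s = 0")
  case False
  then have "v s = 1" using assms vertex_bit by blast
  then show ?thesis by (simp add: flip_def)
qed (simp add: fun_upd_idem)

text \<open>Such a set exchanges no cards with the rest of the cube during the first
  \<open>t\<close> steps, so the coins at its own vertices decide all that happens in it.\<close>

definition closed_upto :: "nat \<Rightarrow> (nat \<Rightarrow> nat) set \<Rightarrow> bool" where
  "closed_upto t A \<longleftrightarrow> A \<subseteq> V \<and> t \<le> d \<and> (\<forall>s\<in>{1..t}. \<forall>v\<in>A. flip s v \<in> A)"

lemma closed_upto_V: "t \<le> d \<Longrightarrow> closed_upto t V"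
  by (auto simp: closed_upto_def flip_in_hypercube)

lemma closed_upto_upper: "j \<in> {1..d} \<Longrightarrow> t < j \<Longrightarrow> closed_upto t (upper d j)"
  using upper_subset[of d j] flip_upper[of _ d j] by (auto simp: closed_upto_def)

lemma closed_upto_lower: "j \<in> {1..d} \<Longrightarrow> t < j \<Longrightarrow> closed_upto t (lower d j)"
  using lower_subset[of d j] flip_lower[of _ d j] by (auto simp: closed_upto_def)

lemma closed_upto_mono: "closed_upto t A \<Longrightarrow> s \<le> t \<Longrightarrow> closed_upto s A"
  by (auto simp: closed_upto_def)

lemma pos_in:
  assumes "closed_upto t A" "k \<in> A" "s \<le> t"
  shows "pos s \<omega> k \<in> A"
  using assms(3)
proof (induction s)
  case (Suc s)
  then have "pos s \<omega> k \<in> A" by simp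
  moreover from this have "flip (Suc s) (pos s \<omega> k) \<in> A"
    using assms(1) Suc.prems by (auto simp: closed_upto_def)
  ultimately show ?case by (auto intro: mv_closed)
qed (use assms in simp)

lemma pos_in_V: "k \<in> V \<Longrightarrow> s \<le> d \<Longrightarrow> pos s \<omega> k \<in> V"
  using pos_in[OF closed_upto_V] by blast

lemma Y_Suc_mv: "\<omega> \<in> S \<Longrightarrow> s < d \<Longrightarrow> v \<in> V \<Longrightarrow> Y (Suc s) \<omega> v = Y s \<omega> (mv (Suc s) \<omega> v)"
  by (simp add: Y_Suc mv_def)

lemma Y_pos: "\<omega> \<in> S \<Longrightarrow> k \<in> V \<Longrightarrow> s \<le> d \<Longrightarrow> Y s \<omega> (pos s \<omega> k) = Y 0 \<omega> k"
proof (induction s)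
  case (Suc s)
  have p: "pos s \<omega> k \<in> V" using Suc.prems by (intro pos_in_V) auto
  then have "pos (Suc s) \<omega> k \<in> V" using Suc.prems by (intro pos_in_V) auto
  then have "Y (Suc s) \<omega> (pos (Suc s) \<omega> k) = Y s \<omega> (mv (Suc s) \<omega> (pos (Suc s) \<omega> k))"
    using Suc.prems by (intro Y_Suc_mv) auto
  also have "mv (Suc s) \<omega> (pos (Suc s) \<omega> k) = pos s \<omega> k"
    using Suc.prems p by (simp add: mv_mv)
  finally show ?case using Suc by simp
qed simp

lemma pos_inj: "\<omega> \<in> S \<Longrightarrow> s \<le> d \<Longrightarrow> inj_on (pos s \<omega>) V"
  by (rule inj_onI) (metis Y_pos Y_bij bij_betw_imp_inj_on inj_onD le0)

lemma pos_bij: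
  assumes "\<omega> \<in> S" "closed_upto t A" "s \<le> t"
  shows "bij_betw (pos s \<omega>) A A"
proof -
  have A: "A \<subseteq> V" "s \<le> d" using assms by (auto simp: closed_upto_def)
  have "inj_on (pos s \<omega>) A" using pos_inj[OF assms(1) A(2)] A(1) by (rule inj_on_subset)
  moreover have "pos s \<omega> ` A \<subseteq> A" using pos_in[OF assms(2) _ assms(3)] by auto
  moreover have "finite A" using finite_subset[OF A(1)] by simp
  ultimately show ?thesis
    by (simp add: bij_betw_def endo_inj_surj)
qed

lemma pos_onto:
  assumes "\<omega> \<in> S" "closed_upto t A" "v \<in> A"
  obtains k where "k \<in> A" "pos t \<omega> k = v"
proof -
  have "pos t \<omega> ` A = A"
    by (rule bij_betw_imp_surj_on, rule pos_bij[OF assms(1,2)]) simp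
  with assms(3) have "v \<in> pos t \<omega> ` A" by simp
  then show thesis using that by (elim imageE) simp
qed

lemma pos_later: "s < i \<Longrightarrow> pos s \<omega> k i = k i"
  by (induction s) (auto simp: mv_other)

text \<open>Step \<open>Suc s\<close> touches only coordinate \<open>Suc s\<close>, which still has
  its starting value before. A position thus remembers the whole trajectory, which makes the chain
  rule along the steps exact.\<close>

lemma pos_prev: "pos s \<omega> k = (pos (Suc s) \<omega> k)(Suc s := k (Suc s))"
proof
  fix i
  show "pos s \<omega> k i = ((pos (Suc s) \<omega> k)(Suc s := k (Suc s))) i"
    by (cases "i = Suc s") (auto simp: mv_other pos_later)
qed

definition agree :: "nat \<Rightarrow> (nat \<Rightarrow> nat) set \<Rightarrow> 'w \<Rightarrow> 'w \<Rightarrow> bool" where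
  "agree t A \<omega> \<omega>' \<longleftrightarrow> (\<forall>s\<in>{1..t}. \<forall>v\<in>A. c s \<omega> v = c s \<omega>' v)"

lemma pos_agree:
  assumes "agree t A \<omega> \<omega>'" "closed_upto t A" "k \<in> A" "s \<le> t"
  shows "pos s \<omega> k = pos s \<omega>' k"
  using assms(4)
proof (induction s)
  case (Suc s)
  then have "pos s \<omega> k = pos s \<omega>' k" "pos s \<omega>' k \<in> A" using pos_in[OF assms(2,3)] by auto
  then show ?case using assms(1) Suc.prems by (auto simp: agree_def mv_def)
qed simp

lemma Y_agree:
  assumes "agree t A \<omega> \<omega>'" "closed_upto t A" "\<omega> \<in> S" "\<omega>' \<in> S" "\<forall>v\<in>A. Y 0 \<omega> v = Y 0 \<omega>' v"
  shows "s \<le> t \<Longrightarrow> v \<in> A \<Longrightarrow> Y s \<omega> v = Y s \<omega>' v"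
proof (induction s arbitrary: v)
  case (Suc s)
  have cc: "c (Suc s) \<omega> v = c (Suc s) \<omega>' v" using assms(1) Suc.prems by (auto simp: agree_def)
  have "mv (Suc s) \<omega> v \<in> A" using Suc.prems assms(2) by (auto simp: closed_upto_def intro!: mv_closed)
  moreover have "mv (Suc s) \<omega> v = mv (Suc s) \<omega>' v" using cc by (simp add: mv_def)
  moreover have "v \<in> V" "s < d" using Suc.prems assms(2) by (auto simp: closed_upto_def)
  ultimately show ?case using Suc assms(3,4) by (auto simp: Y_Suc_mv)
qed (use assms in simp)

lemma agree_coins:
  assumes "closed_upto t A" "\<omega> \<in> S" "\<omega>' \<in> S" "coins B \<omega> = coins B \<omega>'"
    and "\<And>s v. s \<in> {1..t} \<Longrightarrow> v \<in> A \<Longrightarrow> v s = 0 \<Longrightarrow> (s, v) \<in> B"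
  shows "agree t A \<omega> \<omega>'"
  unfolding agree_def
proof (intro ballI)
  fix s v assume s: "s \<in> {1..t}" and v: "v \<in> A"
  then have sv: "s \<in> {1..d}" "v \<in> V" using assms(1) by (auto simp: closed_upto_def)
  have "v(s := 0) \<in> A"
    using base_cases[OF sv(2,1)] s v assms(1) by (auto simp: closed_upto_def)
  then have "(s, v(s := 0)) \<in> B" using assms(5)[OF s] by simp
  then have "c s \<omega> (v(s := 0)) = c s \<omega>' (v(s := 0))" using assms(4) by (auto simp: coins_eq_iff)
  then show "c s \<omega> v = c s \<omega>' v" using c_base[OF _ sv] assms(2,3) by simp
qed

lemma bit_entropy_le: "centr S (\<lambda>\<omega>. b \<omega> :: bool) g \<le> ln 2"
  using centr_le_ln[OF finS Sne, of 2 g "\<lambda>_. UNIV" b] by simp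

lemma coins_entropy_le:
  assumes "finite A"
  shows "centr S (coins A) g \<le> real (card A) * ln 2"
proof -
  have "centr S (coins A) g \<le> (\<Sum>a\<in>A. centr S (\<lambda>\<omega>. (case a of (s, v) \<Rightarrow> c s \<omega> v)) g)"
    unfolding coins_def by (rule centr_family_le[OF finS assms])
  also have "\<dots> \<le> (\<Sum>a\<in>A. ln 2)" by (intro sum_mono bit_entropy_le)
  finally show ?thesis by simp
qed

text \<open>By the chain rule \<open>\<kappa>\<close> is the deficit of the coins outside
  \<open>A\<close> plus that of \<open>A\<close> given all of them. The first is nonnegative, and
  conditioning on \<open>B\<close> alone only lowers the second.\<close>

lemma coin_deficit:
  assumes "A \<subseteq> coin_sites d" "B \<subseteq> coin_sites d" "A \<inter> B = {}"
  shows "real (card A) * ln 2 - centr S (coins A) (\<lambda>\<omega>. (cont 0 V \<omega>, coins B \<omega>)) \<le> \<kappa>"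
proof -
  let ?C = "coin_sites d"
  have fin: "finite A" "finite (?C - A)" using finite_subset[OF assms(1)] by simp_all
  have "centr S (coins ?C) (cont 0 V) = centr S (\<lambda>\<omega>. (coins A \<omega>, coins (?C - A) \<omega>)) (cont 0 V)"
    by (rule centr_cong[OF finS]) (use assms(1) in \<open>auto simp: coins_eq_iff\<close>)
  also have "\<dots> = centr S (coins A) (\<lambda>\<omega>. (coins (?C - A) \<omega>, cont 0 V \<omega>)) + centr S (coins (?C - A)) (cont 0 V)"
    by (rule centr_pair[OF finS])
  also have "\<dots> \<le> centr S (coins A) (\<lambda>\<omega>. (cont 0 V \<omega>, coins B \<omega>)) + real (card (?C - A)) * ln 2"
    by (rule add_mono[OF centr_anti[OF finS] coins_entropy_le[OF fin(2)]])
      (use assms(2,3) in \<open>auto simp: coins_eq_iff\<close>)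
  also have "real (card (?C - A)) = real (card ?C) - real (card A)"
    using assms(1) by (simp add: card_Diff_subset fin of_nat_diff card_mono)
  finally show ?thesis by (simp add: \<kappa>_def algebra_simps)
qed

lemma \<kappa>_nonneg: "\<kappa> \<ge> 0"
  using coins_entropy_le[of "coin_sites d" "cont 0 V"] by (simp add: \<kappa>_def)

end

section \<open>Nearly uniform positions\<close>


context thorp_round
begin

definition past_coins :: "nat \<Rightarrow> (nat \<times> (nat \<Rightarrow> nat)) set" where
  "past_coins j = {(s, v) \<in> coin_sites d. s < j}"

text \<open>For \<open>t = 1\<close> no upper coin is included; raising \<open>t\<close> adds the
  upper coins direction by direction, in the order in which a trajectory unfolds.\<close>

definition side_coins :: "nat \<Rightarrow> nat \<Rightarrow> (nat \<times> (nat \<Rightarrow> nat)) set" where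
  "side_coins j t = {(s, v) \<in> coin_sites d. s < j \<and> v \<in> lower d j \<or> s < t \<and> v \<in> upper d j}"

definition beta :: "nat \<Rightarrow> 'w \<Rightarrow> (nat \<Rightarrow> nat) \<Rightarrow> bool" where
  "beta j \<omega> k = c j \<omega> (pos (j - 1) \<omega> k)"

text \<open>The background against which the position and the coin of an upper card should look
  random: the whole start and the lower face as step \<open>j\<close> finds it, but no coins of the
  upper face.\<close>

definition side :: "nat \<Rightarrow> 'w \<Rightarrow> ((nat \<Rightarrow> nat) \<Rightarrow> nat) \<times> ((nat \<Rightarrow> nat) \<Rightarrow> nat)" where
  "side j \<omega> = (cont 0 V \<omega>, cont (j - 1) (lower d j) \<omega>)"

text \<open>The entropy by which the coin and the position met in step \<open>j\<close> by the card starting at \<open>k\<close> fall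
  short of being uniform on \<open>2 * 2 ^ (j - 1)\<close> values, given \<open>side j\<close>.\<close>

definition eps :: "nat \<Rightarrow> (nat \<Rightarrow> nat) \<Rightarrow> real" where
  "eps j k = ln 2 + real (j - 1) * ln 2
     - centr S (\<lambda>\<omega>. (beta j \<omega> k, pos (j - 1) \<omega> k)) (side j)"

lemma in_coin_sites: "(s, v) \<in> coin_sites d \<longleftrightarrow> s \<in> {1..d} \<and> v \<in> V \<and> v s = 0"
  by (simp add: coin_sites_def)

text \<open>A trajectory amounts to the sequence of coins it meets. After the chain rule, the coin
  of step \<open>s\<close> is conditioned on all earlier upper coins instead of the position alone,
  which can only lower its entropy.\<close>

lemma pos_entropy_ge:
  assumes j: "j \<in> {1..d}" and k: "k \<in> upper d j" and "t < j"
  shows "(\<Sum>s\<in>{1..t}. centr S (\<lambda>\<omega>. c s \<omega> (pos (s - 1) \<omega> k)) (\<lambda>\<omega>. (cont 0 V \<omega>, coins (side_coins j s) \<omega>)))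
      \<le> centr S (\<lambda>\<omega>. pos t \<omega> k) (\<lambda>\<omega>. (cont 0 V \<omega>, coins (side_coins j 1) \<omega>))"
  using \<open>t < j\<close>
proof (induction t)
  case 0
  then show ?case using centr_nonneg[OF finS] by simp
next
  case (Suc t)
  let ?Z = "\<lambda>s \<omega>. (cont 0 V \<omega>, coins (side_coins j s) \<omega>)"
  have cl: "closed_upto t (upper d j)" using Suc.prems j by (intro closed_upto_upper) auto
  have flipped: "pos (Suc t) \<omega> k \<noteq> pos t \<omega> k \<longleftrightarrow> c (Suc t) \<omega> (pos t \<omega> k)" for \<omega>
    by (simp add: mv_def flip_neq)
  have "centr S (\<lambda>\<omega>. pos (Suc t) \<omega> k) (?Z 1)
      = centr S (\<lambda>\<omega>. (c (Suc t) \<omega> (pos t \<omega> k), pos t \<omega> k)) (?Z 1)"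
  proof (rule centr_cong[OF finS])
    fix x y assume "x \<in> S" "y \<in> S"
    show "pos (Suc t) x k = pos (Suc t) y k \<longleftrightarrow>
        (c (Suc t) x (pos t x k), pos t x k) = (c (Suc t) y (pos t y k), pos t y k)"
    proof
      assume eq: "pos (Suc t) x k = pos (Suc t) y k"
      then have "pos t x k = pos t y k" by (simp only: pos_prev[of t _ k])
      then show "(c (Suc t) x (pos t x k), pos t x k) = (c (Suc t) y (pos t y k), pos t y k)"
        using flipped[of x] flipped[of y] eq by auto
    next
      assume "(c (Suc t) x (pos t x k), pos t x k) = (c (Suc t) y (pos t y k), pos t y k)"
      then show "pos (Suc t) x k = pos (Suc t) y k" by (auto simp: mv_def)
    qed
  qed auto
  also have "\<dots> = centr S (\<lambda>\<omega>. c (Suc t) \<omega> (pos t \<omega> k)) (\<lambda>\<omega>. (pos t \<omega> k, ?Z 1 \<omega>)) + centr S (\<lambda>\<omega>. pos t \<omega> k) (?Z 1)"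
    by (rule centr_pair[OF finS])
  also have "\<dots> \<ge> centr S (\<lambda>\<omega>. c (Suc t) \<omega> (pos t \<omega> k)) (?Z (Suc t))
      + (\<Sum>s\<in>{1..t}. centr S (\<lambda>\<omega>. c s \<omega> (pos (s - 1) \<omega> k)) (?Z s))"
  proof (rule add_mono)
    show "(\<Sum>s\<in>{1..t}. centr S (\<lambda>\<omega>. c s \<omega> (pos (s - 1) \<omega> k)) (?Z s)) \<le> centr S (\<lambda>\<omega>. pos t \<omega> k) (?Z 1)"
      using Suc by simp
    show "centr S (\<lambda>\<omega>. c (Suc t) \<omega> (pos t \<omega> k)) (?Z (Suc t))
        \<le> centr S (\<lambda>\<omega>. c (Suc t) \<omega> (pos t \<omega> k)) (\<lambda>\<omega>. (pos t \<omega> k, ?Z 1 \<omega>))"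
    proof (rule centr_anti[OF finS])
      fix x y assume xy: "x \<in> S" "y \<in> S" "?Z (Suc t) x = ?Z (Suc t) y"
      then have "agree t (upper d j) x y"
        using upper_subset[of d j] j Suc.prems
        by (intro agree_coins[OF cl xy(1,2), of "side_coins j (Suc t)"]) (auto simp: side_coins_def in_coin_sites)
      then have "pos t x k = pos t y k"
        using cl k by (rule pos_agree) simp
      moreover have "coins (side_coins j 1) x = coins (side_coins j 1) y"
        using xy Suc.prems by (auto simp: coins_eq_iff side_coins_def)
      ultimately show "(pos t x k, ?Z 1 x) = (pos t y k, ?Z 1 y)" using xy by simp
    qed
  qed
  finally show ?case by (simp add: add.commute)
qed

text \<open>Before step \<open>s\<close> the coordinate \<open>s\<close> of a card has not moved, so the cards starting in the half
  \<open>k s = b\<close> of the upper face meet every edge of direction \<open>s\<close> exactly once.\<close>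

lemma half_face_deficit:
  assumes j: "j \<in> {1..d}" and s: "s \<in> {1..<j}" and b: "b \<in> {0, 1}"
  shows "(\<Sum>k\<in>{k \<in> upper d j. k s = b}. ln 2
     - centr S (\<lambda>\<omega>. c s \<omega> (pos (s - 1) \<omega> k)) (\<lambda>\<omega>. (cont 0 V \<omega>, coins (side_coins j s) \<omega>))) \<le> \<kappa>"
proof -
  let ?Z = "\<lambda>\<omega>. (cont 0 V \<omega>, coins (side_coins j s) \<omega>)"
  let ?K = "{k \<in> upper d j. k s = b}" and ?A = "{s} \<times> {v \<in> upper d j. v s = 0}"
  have sd: "s \<in> {1..d}" using s j by auto
  have cl: "closed_upto (s - 1) (upper d j)" using s j by (intro closed_upto_upper) auto
  have "card ?K = card {v \<in> upper d j. v s = 0}"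
  proof (cases "b = 0")
    case False
    then have b: "b = 1" using b by auto
    have "bij_betw (flip s) ?K {v \<in> upper d j. v s = 0}"
    proof (rule bij_betw_byWitness[where f' = "flip s"])
      show "\<forall>v\<in>?K. flip s (flip s v) = v" "\<forall>v\<in>{v \<in> upper d j. v s = 0}. flip s (flip s v) = v"
        using flip_flip[OF _ sd] upper_subset by blast+
      show "flip s ` ?K \<subseteq> {v \<in> upper d j. v s = 0}" "flip s ` {v \<in> upper d j. v s = 0} \<subseteq> ?K"
        using s j b flip_upper[of _ d j s] by (auto simp: flip_same)
    qed
    then show ?thesis by (rule bij_betw_same_card)
  qed simp
  then have card: "card ?K = card ?A" by (simp add: card_cartesian_product)
  have "real (card ?A) * ln 2 - \<kappa> \<le> centr S (coins ?A) ?Z"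
  proof -
    have "?A \<subseteq> coin_sites d" "side_coins j s \<subseteq> coin_sites d" "?A \<inter> side_coins j s = {}"
      using sd upper_subset[of d j] upper_lower_disjoint[of d j] by (auto simp: in_coin_sites side_coins_def)
    then show ?thesis using coin_deficit[of ?A "side_coins j s"] by linarith
  qed
  \<comment> \<open>Given the earlier coins of the upper face the positions before step
    \<open>s\<close> are known, so the coins met by the cards of \<open>?K\<close> reveal every coin
    of \<open>?A\<close>.\<close>
  also have "\<dots> \<le> centr S (\<lambda>\<omega>. restrict (\<lambda>k. c s \<omega> (pos (s - 1) \<omega> k)) ?K) ?Z"
  proof (rule centr_mono[OF finS])
    fix x y assume xy: "x \<in> S" "y \<in> S" "?Z x = ?Z y"
      "restrict (\<lambda>k. c s x (pos (s - 1) x k)) ?K = restrict (\<lambda>k. c s y (pos (s - 1) y k)) ?K"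
    have ag: "agree (s - 1) (upper d j) x y"
      using upper_subset[of d j] sd xy(3)
      by (intro agree_coins[OF cl xy(1,2), of "side_coins j s"]) (auto simp: side_coins_def in_coin_sites)
    have "c s x v = c s y v" if v: "v \<in> upper d j" "v s = 0" for v
    proof -
      define v' where "v' = (if b = 0 then v else flip s v)"
      have v': "v' \<in> upper d j" "v' s = b" using v b flip_upper[of v d j s] s j
        by (auto simp: v'_def flip_same)
      obtain k where k: "k \<in> upper d j" "pos (s - 1) x k = v'"
        by (rule pos_onto[OF xy(1) cl v'(1)])
      have "k s = b" using pos_later[of "s - 1" s x k] k(2) v'(2) s by auto
      then have "c s x (pos (s - 1) x k) = c s y (pos (s - 1) y k)"
        using xy(4) k(1) by (metis (mono_tags, lifting) mem_Collect_eq restrict_apply')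
      moreover have "pos (s - 1) y k = v'" using pos_agree[OF ag cl k(1), of "s - 1"] k(2) by simp
      ultimately have "c s x v' = c s y v'" using k(2) by simp
      moreover have "v \<in> V" using v upper_subset by auto
      ultimately show ?thesis
        using c_flip[OF xy(1) sd] c_flip[OF xy(2) sd] by (auto simp: v'_def split: if_splits)
    qed
    then show "coins ?A x = coins ?A y" by (auto simp: coins_eq_iff)
  qed
  also have "\<dots> \<le> (\<Sum>k\<in>?K. centr S (\<lambda>\<omega>. c s \<omega> (pos (s - 1) \<omega> k)) ?Z)"
    by (rule centr_family_le[OF finS]) simp
  finally show ?thesis by (simp add: sum_subtractf card)
qed

text \<open>At step \<open>j\<close> the cards of the upper face meet all edges of direction
  \<open>j\<close> inside the subcube, each exactly once, so no split into halves occurs. All coins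
  before step \<open>j\<close> and the start determine the position and
  \<open>side j\<close>.\<close>

lemma beta_deficit:
  assumes j: "j \<in> {1..d}"
  shows "(\<Sum>k\<in>upper d j. ln 2 - centr S (\<lambda>\<omega>. beta j \<omega> k) (\<lambda>\<omega>. (pos (j - 1) \<omega> k, side j \<omega>))) \<le> \<kappa>"
proof -
  let ?Z = "\<lambda>\<omega>. (cont 0 V \<omega>, coins (past_coins j) \<omega>)" and ?A = "{j} \<times> lower d j"
  have clV: "closed_upto (j - 1) V" using j by (intro closed_upto_V) auto
  have cl: "closed_upto (j - 1) (upper d j)" using j by (intro closed_upto_upper) auto
  have ag: "agree (j - 1) V x y" if "x \<in> S" "y \<in> S" "?Z x = ?Z y" for x y
    using j that by (intro agree_coins[OF clV that(1,2), of "past_coins j"]) (auto simp: past_coins_def in_coin_sites)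
  have card: "card (upper d j) = card ?A" using j by (simp add: card_cartesian_product card_upper card_lower)
  have "real (card ?A) * ln 2 - \<kappa> \<le> centr S (coins ?A) ?Z"
  proof -
    have "?A \<subseteq> coin_sites d" "past_coins j \<subseteq> coin_sites d" "?A \<inter> past_coins j = {}"
      using j lower_subset[of d j] by (auto simp: in_coin_sites past_coins_def lower_def)
    then show ?thesis using coin_deficit[of ?A "past_coins j"] by linarith
  qed
  also have "\<dots> \<le> centr S (\<lambda>\<omega>. restrict (beta j \<omega>) (upper d j)) ?Z"
  proof (rule centr_mono[OF finS])
    fix x y assume xy: "x \<in> S" "y \<in> S" "?Z x = ?Z y" "restrict (beta j x) (upper d j) = restrict (beta j y) (upper d j)"
    have "c j x v = c j y v" if v: "v \<in> lower d j" for v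
    proof -
      have vV: "v \<in> V" using v lower_subset by auto
      have "flip j v \<in> upper d j" using v j flip_subcube[of v d j j] by (auto simp: upper_def lower_def flip_same)
      then obtain k where k: "k \<in> upper d j" "pos (j - 1) x k = flip j v"
        by (rule pos_onto[OF xy(1) cl])
      have kV: "k \<in> V" using k upper_subset by auto
      have "pos (j - 1) y k = flip j v" using pos_agree[OF ag[OF xy(1-3)] clV kV, of "j - 1"] k(2) by simp
      moreover have "beta j x k = beta j y k" using xy(4) k(1) by (metis restrict_apply')
      ultimately show ?thesis using c_flip[OF xy(1) j vV] c_flip[OF xy(2) j vV] k(2) by (simp add: beta_def)
    qed
    then show "coins ?A x = coins ?A y" by (auto simp: coins_eq_iff)
  qed
  also have "\<dots> \<le> (\<Sum>k\<in>upper d j. centr S (\<lambda>\<omega>. beta j \<omega> k) ?Z)"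
    by (rule centr_family_le[OF finS]) simp
  also have "\<dots> \<le> (\<Sum>k\<in>upper d j. centr S (\<lambda>\<omega>. beta j \<omega> k) (\<lambda>\<omega>. (pos (j - 1) \<omega> k, side j \<omega>)))"
  proof (rule sum_mono, rule centr_anti[OF finS])
    fix k x y assume k: "k \<in> upper d j" and xy: "x \<in> S" "y \<in> S" "?Z x = ?Z y"
    have kV: "k \<in> V" using k upper_subset by auto
    have "pos (j - 1) x k = pos (j - 1) y k" using pos_agree[OF ag[OF xy] clV kV] by simp
    moreover have "\<forall>v\<in>V. Y (j - 1) x v = Y (j - 1) y v"
      using Y_agree[OF ag[OF xy] clV xy(1,2)] xy(3) by (auto simp: cont_eq_iff)
    ultimately show "(pos (j - 1) x k, side j x) = (pos (j - 1) y k, side j y)"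
      using xy(3) lower_subset[of d j] by (auto simp: side_def cont_eq_iff)
  qed
  finally show ?thesis by (simp add: sum_subtractf card)
qed

text \<open>The chain rule splits \<open>eps\<close> into one coin per step. Each of the
  \<open>j - 1\<close> earlier directions costs at most \<open>\<kappa>\<close> for each of its two
  halves and step \<open>j\<close> once more, hence \<open>2 * (j - 1) + 1\<close>.\<close>

lemma eps_sum_le:
  assumes j: "j \<in> {1..d}"
  shows "(\<Sum>k\<in>upper d j. eps j k) \<le> 2 * real d * \<kappa>"
proof -
  let ?Z = "\<lambda>s \<omega>. (cont 0 V \<omega>, coins (side_coins j s) \<omega>)"
  let ?D = "\<lambda>s k. ln 2 - centr S (\<lambda>\<omega>. c s \<omega> (pos (s - 1) \<omega> k)) (?Z s)"
  let ?b = "\<lambda>k. ln 2 - centr S (\<lambda>\<omega>. beta j \<omega> k) (\<lambda>\<omega>. (pos (j - 1) \<omega> k, side j \<omega>))"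
  have clL: "closed_upto (j - 1) (lower d j)" using j by (intro closed_upto_lower) auto
  have "eps j k \<le> (\<Sum>s\<in>{1..j-1}. ?D s k) + ?b k" if k: "k \<in> upper d j" for k
  proof -
    have "centr S (\<lambda>\<omega>. (beta j \<omega> k, pos (j - 1) \<omega> k)) (side j)
      = centr S (\<lambda>\<omega>. beta j \<omega> k) (\<lambda>\<omega>. (pos (j - 1) \<omega> k, side j \<omega>)) + centr S (\<lambda>\<omega>. pos (j - 1) \<omega> k) (side j)"
      by (rule centr_pair[OF finS])
    moreover have "centr S (\<lambda>\<omega>. pos (j - 1) \<omega> k) (?Z 1) \<le> centr S (\<lambda>\<omega>. pos (j - 1) \<omega> k) (side j)"
    proof (rule centr_anti[OF finS])
      fix x y assume xy: "x \<in> S" "y \<in> S" "?Z 1 x = ?Z 1 y"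
      have "agree (j - 1) (lower d j) x y"
        using lower_subset[of d j] j xy(3)
        by (intro agree_coins[OF clL xy(1,2), of "side_coins j 1"]) (auto simp: side_coins_def in_coin_sites)
      moreover have "\<forall>v\<in>lower d j. Y 0 x v = Y 0 y v" using xy(3) lower_subset[of d j] by (auto simp: cont_eq_iff)
      ultimately have "\<forall>v\<in>lower d j. Y (j - 1) x v = Y (j - 1) y v" using Y_agree[OF _ clL xy(1,2)] by blast
      then show "side j x = side j y" using xy(3) by (simp add: side_def cont_eq_iff)
    qed
    moreover have "(\<Sum>s\<in>{1..j-1}. centr S (\<lambda>\<omega>. c s \<omega> (pos (s - 1) \<omega> k)) (?Z s)) \<le> centr S (\<lambda>\<omega>. pos (j - 1) \<omega> k) (?Z 1)"
      using j by (intro pos_entropy_ge[OF j k]) auto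
    ultimately show ?thesis by (simp add: eps_def sum_subtractf)
  qed
  then have "(\<Sum>k\<in>upper d j. eps j k) \<le> (\<Sum>k\<in>upper d j. (\<Sum>s\<in>{1..j-1}. ?D s k) + ?b k)"
    by (rule sum_mono)
  also have "\<dots> = (\<Sum>s\<in>{1..j-1}. \<Sum>k\<in>upper d j. ?D s k) + (\<Sum>k\<in>upper d j. ?b k)"
    by (subst sum.swap) (simp only: sum.distrib)
  also have "\<dots> \<le> (\<Sum>s\<in>{1..j-1}. 2 * \<kappa>) + \<kappa>"
  proof (rule add_mono[OF sum_mono beta_deficit[OF j]])
    fix s assume "s \<in> {1..j-1}"
    then have s: "s \<in> {1..<j}" by auto
    have "upper d j = {k \<in> upper d j. k s = 0} \<union> {k \<in> upper d j. k s = 1}"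
      using s j vertex_bit[of _ d s] upper_subset[of d j] by auto
    then have "(\<Sum>k\<in>upper d j. ?D s k) = (\<Sum>k\<in>{k \<in> upper d j. k s = 0}. ?D s k) + (\<Sum>k\<in>{k \<in> upper d j. k s = 1}. ?D s k)"
      by (subst sum.union_disjoint[symmetric]) auto
    also have "\<dots> \<le> \<kappa> + \<kappa>"
      using half_face_deficit[OF j s, of 0] half_face_deficit[OF j s, of 1] by simp
    finally show "(\<Sum>k\<in>upper d j. ?D s k) \<le> 2 * \<kappa>" by simp
  qed
  also have "\<dots> = (2 * real (j - 1) + 1) * \<kappa>" by (simp add: algebra_simps)
  also have "\<dots> \<le> 2 * real d * \<kappa>"
    using \<kappa>_nonneg j by (intro mult_right_mono) (auto simp: of_nat_diff)
  finally show ?thesis .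
qed

end

section \<open>Dissipation controls the deficit\<close>


text \<open>Distinct places hold distinct values, so the events that \<open>u\<close> sits at
  \<open>a\<close> are disjoint, and their union is that \<open>u\<close> sits somewhere in
  \<open>A\<close>.\<close>

lemma sum_freq_occupied:
  assumes "finite S" "finite A" "\<And>x. x \<in> S \<Longrightarrow> inj_on (g x) A"
  shows "(\<Sum>a\<in>A. freq S (\<lambda>x. (g x a, R x)) (u, z)) = freq S (\<lambda>x. (u \<in> g x ` A, R x)) (True, z)"
proof -
  have "{x \<in> S. (u \<in> g x ` A, R x) = (True, z)} = (\<Union>a\<in>A. {x \<in> S. (g x a, R x) = (u, z)})"
    by auto
  also have "card \<dots> = (\<Sum>a\<in>A. card {x \<in> S. (g x a, R x) = (u, z)})"
    using assms by (intro card_UN_disjoint) (auto dest: inj_onD)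
  finally show ?thesis by (simp add: freq_def sum_divide_distrib)
qed

lemma hel_sum_product:
  "(\<Sum>z\<in>Z. hel B (\<lambda>b. P (b, z)) (\<lambda>b. Q (b, z))) = hel (B \<times> Z) P Q"
  unfolding hel_def by (subst sum.swap) (simp add: sum.cartesian_product')

lemma finite_cards [simp]: "finite (cards d)"
  by (simp add: cards_def)

context thorp_round
begin

definition law :: "(nat \<Rightarrow> nat) set \<Rightarrow> (nat \<Rightarrow> nat) \<Rightarrow> nat \<times> ((nat \<Rightarrow> nat) \<Rightarrow> nat) \<Rightarrow> real" where
  "law W a = freq S (\<lambda>\<omega>. (Y 0 \<omega> a, cont 0 W \<omega>))"

definition lower_law :: "nat \<Rightarrow> (nat \<Rightarrow> nat) set \<Rightarrow> nat \<times> ((nat \<Rightarrow> nat) \<Rightarrow> nat) \<Rightarrow> real" where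
  "lower_law j W t = (\<Sum>b\<in>lower d j. law W b t) / real (card (lower d j))"

definition contrast :: "nat \<Rightarrow> (nat \<Rightarrow> nat) set \<Rightarrow> (nat \<Rightarrow> nat) \<Rightarrow> real" where
  "contrast j W k = hel (cards d \<times> cont 0 W ` S) (law W k) (lower_law j W)"

text \<open>The card found after step \<open>j\<close> at the vertex which the card from
  \<open>k\<close> occupied just before. It is that card itself unless step \<open>j\<close> swapped
  it away.\<close>

definition landing :: "nat \<Rightarrow> 'w \<Rightarrow> (nat \<Rightarrow> nat) \<Rightarrow> nat" where
  "landing j \<omega> k = Y j \<omega> (pos (j - 1) \<omega> k)"

text \<open>For a fair coin this is the information that the landed card and the revealed cards
  carry about it. It is small only if swapped and unswapped outcomes are hard to tell apart; in this
  way dissipation detects that two laws are close.\<close>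

definition loss :: "nat \<Rightarrow> (nat \<Rightarrow> nat) set \<Rightarrow> (nat \<Rightarrow> nat) \<Rightarrow> real" where
  "loss j W k = ln 2 - centr S (\<lambda>\<omega>. beta j \<omega> k) (\<lambda>\<omega>. (landing j \<omega> k, cont 0 W \<omega>))"

lemma Y_in_cards: "\<omega> \<in> S \<Longrightarrow> s \<le> d \<Longrightarrow> v \<in> V \<Longrightarrow> Y s \<omega> v \<in> cards d"
  using Y_bij[of \<omega> s] by (auto simp: bij_betw_def)

lemma landing_cases:
  assumes "\<omega> \<in> S" "j \<in> {1..d}" "k \<in> V"
  shows "landing j \<omega> k = (if beta j \<omega> k then Y (j - 1) \<omega> (flip j (pos (j - 1) \<omega> k)) else Y 0 \<omega> k)"
proof -
  have "pos (j - 1) \<omega> k \<in> V" "j - 1 < d" using assms by (auto intro!: pos_in_V)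
  then have "landing j \<omega> k = Y (j - 1) \<omega> (mv j \<omega> (pos (j - 1) \<omega> k))"
    using Y_Suc_mv[of \<omega> "j - 1"] assms by (simp add: landing_def)
  moreover have "Y (j - 1) \<omega> (pos (j - 1) \<omega> k) = Y 0 \<omega> k"
    using assms by (intro Y_pos) auto
  ultimately show ?thesis by (simp add: mv_def beta_def)
qed

text \<open>The lower face is not left during the first \<open>j - 1\<close> steps; its cards are
  only permuted. So the card at a uniformly chosen place of it has the same law at time
  \<open>j - 1\<close> as at time 0.\<close>

lemma lower_image:
  assumes "\<omega> \<in> S" "j \<in> {1..d}"
  shows "Y (j - 1) \<omega> ` lower d j = Y 0 \<omega> ` lower d j"
proof -
  have "closed_upto (j - 1) (lower d j)" using assms by (intro closed_upto_lower) auto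
  then have "lower d j = pos (j - 1) \<omega> ` lower d j"
    using pos_bij[OF assms(1), of "j - 1" "lower d j" "j - 1"] by (simp add: bij_betw_def)
  then have "Y (j - 1) \<omega> ` lower d j = (\<lambda>k. Y (j - 1) \<omega> (pos (j - 1) \<omega> k)) ` lower d j"
    by (metis image_image)
  also have "\<dots> = Y 0 \<omega> ` lower d j"
    using assms lower_subset[of d j] by (intro image_cong refl Y_pos) auto
  finally show ?thesis .
qed

lemma Y_inj_on: "\<omega> \<in> S \<Longrightarrow> s \<le> d \<Longrightarrow> A \<subseteq> V \<Longrightarrow> inj_on (Y s \<omega>) A"
  using Y_bij[of \<omega> s] by (auto simp: bij_betw_def intro: inj_on_subset)

text \<open>What the law of \<open>(beta j \<omega> k, landing j \<omega> k, cont 0 W \<omega>)\<close> would be with a fresh uniform coin and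
  position: without a swap the card of \<open>k\<close> lands, with a swap a uniformly random card of the lower face.\<close>

definition fresh_law :: "nat \<Rightarrow> (nat \<Rightarrow> nat) set \<Rightarrow> (nat \<Rightarrow> nat) \<Rightarrow> bool \<times> nat \<times> ((nat \<Rightarrow> nat) \<Rightarrow> nat) \<Rightarrow> real" where
  "fresh_law j W k = (\<lambda>(b, t). (if b then lower_law j W t else law W k t) / 2)"

text \<open>Given \<open>side j\<close>, coin and position are within \<open>eps j k\<close> of
  uniform. Both laws are pushed forward to what is observed, which cannot increase the distance; the
  work is to identify the image of the uniform reference with \<open>fresh_law\<close>.\<close>

lemma hel_fresh_le_eps:
  assumes j: "j \<in> {1..d}" and W: "W \<subseteq> V" and k: "k \<in> upper d j"
  shows "hel (UNIV \<times> cards d \<times> cont 0 W ` S)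
      (freq S (\<lambda>\<omega>. (beta j \<omega> k, landing j \<omega> k, cont 0 W \<omega>))) (fresh_law j W k) \<le> eps j k"
proof -
  define M :: nat where "M = 2 * 2 ^ (j - 1)"
  define f where "f = (\<lambda>\<omega>. (beta j \<omega> k, pos (j - 1) \<omega> k))"
  define B where "B = (UNIV :: bool set) \<times> upper d j"
  define T where "T = B \<times> side j ` S"
  define T' where "T' = (UNIV :: bool set) \<times> cards d \<times> cont 0 W ` S"
  \<comment> \<open>Computes the landed card: after a swap it is the lower card opposite to the
    position, otherwise the card that started at \<open>k\<close>.\<close>
  define \<phi> where "\<phi> = (\<lambda>((b :: bool, v), (y0 :: (nat \<Rightarrow> nat) \<Rightarrow> nat, yl :: (nat \<Rightarrow> nat) \<Rightarrow> nat)).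
     (b, if b then yl (flip j v) else y0 k, restrict y0 W))"
  have kV: "k \<in> V" using k upper_subset by auto
  have cl: "closed_upto (j - 1) (upper d j)" using j by (intro closed_upto_upper) auto
  have posk: "pos (j - 1) \<omega> k \<in> upper d j" for \<omega> using pos_in[OF cl k] by simp
  have flipL: "flip j v \<in> lower d j" if "v \<in> upper d j" for v
    using bij_flip_upper_lower[OF j] that by (auto simp: bij_betw_def)
  have \<phi>_side: "\<phi> ((b, v), side j \<omega>) = (b, if b then Y (j - 1) \<omega> (flip j v) else Y 0 \<omega> k, cont 0 W \<omega>)"
    if "v \<in> upper d j" for b v \<omega>
    using flipL[OF that] kV W by (auto simp: \<phi>_def side_def cont_def restrict_def fun_eq_iff)
  have \<phi>_real: "\<phi> (f \<omega>, side j \<omega>) = (beta j \<omega> k, landing j \<omega> k, cont 0 W \<omega>)" if "\<omega> \<in> S" for \<omega>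
    using \<phi>_side[OF posk] landing_cases[OF that j kV] by (simp add: f_def)
  have fin: "finite T" "finite T'" using finS by (auto simp: T_def T'_def B_def)
  have "ln (real M) = ln 2 + real (j - 1) * ln 2" by (simp add: M_def ln_mult ln_realpow)
  moreover have "(\<Sum>z\<in>side j ` S. hel B (\<lambda>b. freq S (\<lambda>\<omega>. (f \<omega>, side j \<omega>)) (b, z)) (\<lambda>b. freq S (side j) z / real M))
      \<le> ln (real M) - centr S f (side j)"
    using posk card_upper[OF j] by (intro deficit_ge_hel finS Sne)
      (auto simp: M_def B_def f_def card_cartesian_product)
  ultimately have dev: "hel T (freq S (\<lambda>\<omega>. (f \<omega>, side j \<omega>))) (\<lambda>(b, z). freq S (side j) z / real M) \<le> eps j k"
    using hel_sum_product[of B "freq S (\<lambda>\<omega>. (f \<omega>, side j \<omega>))" "\<lambda>(b, z). freq S (side j) z / real M" "side j ` S"]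
    by (simp add: T_def eps_def f_def)
  have "hel T' (freq S (\<lambda>\<omega>. (beta j \<omega> k, landing j \<omega> k, cont 0 W \<omega>))) (fresh_law j W k)
     \<le> hel T (freq S (\<lambda>\<omega>. (f \<omega>, side j \<omega>))) (\<lambda>(b, z). freq S (side j) z / real M)"
  proof (rule hel_group[OF fin, where \<phi> = \<phi>])
    show "\<phi> ` T \<subseteq> T'"
    proof
      fix t assume "t \<in> \<phi> ` T"
      then obtain b v \<omega> where v: "v \<in> upper d j" and \<omega>: "\<omega> \<in> S" and t: "t = \<phi> ((b, v), side j \<omega>)"
        by (auto simp: T_def B_def)
      have "flip j v \<in> V" using flipL[OF v] lower_subset by auto
      then have "(if b then Y (j - 1) \<omega> (flip j v) else Y 0 \<omega> k) \<in> cards d"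
        using Y_in_cards[OF \<omega>] kV j by auto
      then show "t \<in> T'" using \<omega> unfolding t \<phi>_side[OF v] T'_def by blast
    qed
    show "0 \<le> freq S (\<lambda>\<omega>. (f \<omega>, side j \<omega>)) t" for t by (rule freq_nonneg)
    show "0 \<le> (case t of (b, z) \<Rightarrow> freq S (side j) z / real M)" for t
      by (simp add: freq_nonneg split: prod.split)
    show "freq S (\<lambda>\<omega>. (beta j \<omega> k, landing j \<omega> k, cont 0 W \<omega>)) t'
        = (\<Sum>t\<in>{t \<in> T. \<phi> t = t'}. freq S (\<lambda>\<omega>. (f \<omega>, side j \<omega>)) t)" for t'
    proof (rule freq_sum[OF finS])
      fix \<omega> assume \<omega>: "\<omega> \<in> S"
      have "(f \<omega>, side j \<omega>) \<in> T" using \<omega> posk by (auto simp: T_def B_def f_def)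
      then show "(beta j \<omega> k, landing j \<omega> k, cont 0 W \<omega>) = t' \<longleftrightarrow> (f \<omega>, side j \<omega>) \<in> {t \<in> T. \<phi> t = t'}"
        using \<phi>_real[OF \<omega>] by simp
    qed (use fin in simp)
    fix t' assume "t' \<in> T'"
    obtain b u z where t': "t' = (b, u, z)" by (cases t')
    define Z where "Z v = {\<zeta> \<in> side j ` S. \<phi> ((b, v), \<zeta>) = t'}" for v
    have "{t \<in> T. \<phi> t = t'} = (\<lambda>(v, \<zeta>). ((b, v), \<zeta>)) ` (SIGMA v:upper d j. Z v)"
    proof (intro equalityI subsetI)
      fix t assume t: "t \<in> {t \<in> T. \<phi> t = t'}"
      obtain b' v \<zeta> where tt: "t = ((b', v), \<zeta>)" by (metis surj_pair)
      have "fst (\<phi> t) = b'" by (cases \<zeta>) (simp add: \<phi>_def tt)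
      then have "b' = b" using t by (simp add: t')
      then show "t \<in> (\<lambda>(v, \<zeta>). ((b, v), \<zeta>)) ` (SIGMA v:upper d j. Z v)"
        using t by (auto simp: T_def B_def Z_def tt image_iff)
    qed (auto simp: T_def B_def Z_def)
    then have "(\<Sum>t\<in>{t \<in> T. \<phi> t = t'}. case t of (b, z) \<Rightarrow> freq S (side j) z / real M)
        = (\<Sum>(v, \<zeta>)\<in>(SIGMA v:upper d j. Z v). freq S (side j) \<zeta> / real M)"
      by (simp add: sum.reindex inj_on_def case_prod_unfold)
    also have "\<dots> = (\<Sum>v\<in>upper d j. \<Sum>\<zeta>\<in>Z v. freq S (side j) \<zeta> / real M)"
      using finS by (subst sum.Sigma) (auto simp: Z_def)
    also have "\<dots> = (\<Sum>v\<in>upper d j. freq S (\<lambda>\<omega>. (if b then Y (j - 1) \<omega> (flip j v) else Y 0 \<omega> k, cont 0 W \<omega>)) (u, z)) / real M"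
      unfolding sum_divide_distrib
    proof (rule sum.cong[OF refl])
      fix v assume v: "v \<in> upper d j"
      have "freq S (\<lambda>\<omega>. (if b then Y (j - 1) \<omega> (flip j v) else Y 0 \<omega> k, cont 0 W \<omega>)) (u, z)
          = (\<Sum>\<zeta>\<in>Z v. freq S (side j) \<zeta>)"
        using finS \<phi>_side[OF v, of b] by (intro freq_sum) (auto simp: Z_def t')
      then show "(\<Sum>\<zeta>\<in>Z v. freq S (side j) \<zeta> / real M)
          = freq S (\<lambda>\<omega>. (if b then Y (j - 1) \<omega> (flip j v) else Y 0 \<omega> k, cont 0 W \<omega>)) (u, z) / real M"
        by (simp add: sum_divide_distrib)
    qed
    also have "\<dots> = fresh_law j W k t'"
    proof (cases b)
      case False
      then show ?thesis using card_upper[OF j] by (simp add: fresh_law_def t' law_def M_def)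
    next
      case True
      have jd: "j - 1 \<le> d" "0 \<le> d" using j by auto
      \<comment> \<open>A uniform position makes the opposite vertex uniform in the lower face, so
        only the set of cards there matters; \<open>lower_image\<close> then replaces time
        \<open>j - 1\<close> by time 0.\<close>
      have "(\<Sum>v\<in>upper d j. freq S (\<lambda>\<omega>. (Y (j - 1) \<omega> (flip j v), cont 0 W \<omega>)) (u, z))
          = (\<Sum>v\<in>lower d j. freq S (\<lambda>\<omega>. (Y (j - 1) \<omega> v, cont 0 W \<omega>)) (u, z))"
        by (rule sum.reindex_bij_betw[OF bij_flip_upper_lower[OF j]])
      also have "\<dots> = freq S (\<lambda>\<omega>. (u \<in> Y (j - 1) \<omega> ` lower d j, cont 0 W \<omega>)) (True, z)"
        using jd lower_subset by (intro sum_freq_occupied finS Y_inj_on) auto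
      also have "\<dots> = freq S (\<lambda>\<omega>. (u \<in> Y 0 \<omega> ` lower d j, cont 0 W \<omega>)) (True, z)"
        using lower_image[OF _ j] by (intro freq_cong) auto
      also have "\<dots> = (\<Sum>v\<in>lower d j. law W v (u, z))"
        unfolding law_def using jd lower_subset by (intro sum_freq_occupied[symmetric] finS Y_inj_on) auto
      finally show ?thesis using True card_lower[OF j] by (simp add: fresh_law_def t' lower_law_def M_def)
    qed
    finally show "fresh_law j W k t' = (\<Sum>t\<in>{t \<in> T. \<phi> t = t'}. case t of (b, z) \<Rightarrow> freq S (side j) z / real M)" ..
  qed
  with dev show ?thesis by (simp add: T'_def)
qed

lemma law_nonneg: "law W a t \<ge> 0" by (simp add: law_def freq_nonneg)

lemma lower_law_nonneg: "lower_law j W t \<ge> 0" by (simp add: lower_law_def law_nonneg sum_nonneg)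

lemma hel_bool: "hel ((UNIV :: bool set) \<times> T) P Q
   = (\<Sum>t\<in>T. (sqrt (P (False, t)) - sqrt (Q (False, t)))\<^sup>2 + (sqrt (P (True, t)) - sqrt (Q (True, t)))\<^sup>2)"
  unfolding hel_def by (simp add: sum.cartesian_product' UNIV_bool sum.distrib)

text \<open>\<open>Q\<close> attaches a fair independent coin to the observed law, so its two slices
  coincide, while those of \<open>fresh_law\<close> are the two laws to be compared, halved. Undoing
  the halving and the detour through \<open>Q\<close> cost a factor 2 each; passing from
  \<open>fresh_law\<close> to \<open>Q\<close> through the true law \<open>P\<close> costs another
  2.\<close>

lemma contrast_le:
  assumes j: "j \<in> {1..d}" and W: "W \<subseteq> V" and k: "k \<in> upper d j"
  shows "contrast j W k \<le> 8 * (eps j k + loss j W k)"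
proof -
  define g where "g = (\<lambda>\<omega>. (landing j \<omega> k, cont 0 W \<omega>))"
  define D where "D = cards d \<times> cont 0 W ` S"
  define P where "P = freq S (\<lambda>\<omega>. (beta j \<omega> k, g \<omega>))"
  define Q where "Q = (\<lambda>(b :: bool, t). freq S g t / 2)"
  have kV: "k \<in> V" using k upper_subset by auto
  have finD: "finite D" using finS by (simp add: D_def)
  have "landing j \<omega> k \<in> cards d" if "\<omega> \<in> S" for \<omega>
    using that j kV unfolding landing_def by (intro Y_in_cards pos_in_V) auto
  then have gD: "g ` S \<subseteq> D" by (auto simp: g_def D_def)
  have "(\<Sum>z\<in>g ` S. hel UNIV (\<lambda>b. P (b, z)) (\<lambda>b. freq S g z / real 2)) \<le> ln (real 2) - centr S (\<lambda>\<omega>. beta j \<omega> k) g"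
    unfolding P_def by (rule deficit_ge_hel[OF finS Sne]) auto
  moreover have "(\<Sum>z\<in>g ` S. hel UNIV (\<lambda>b. P (b, z)) (\<lambda>b. freq S g z / real 2))
      = (\<Sum>z\<in>D. hel UNIV (\<lambda>b. P (b, z)) (\<lambda>b. freq S g z / real 2))"
  proof (rule sum.mono_neutral_left[OF finD gD], rule ballI)
    fix z assume z: "z \<in> D - g ` S"
    then have "freq S g z = 0" by (intro freq_zero) auto
    moreover have "P (b, z) = 0" for b unfolding P_def using z by (intro freq_zero) auto
    ultimately show "hel UNIV (\<lambda>b. P (b, z)) (\<lambda>b. freq S g z / real 2) = 0" by (simp add: hel_def)
  qed
  ultimately have PQ: "hel (UNIV \<times> D) P Q \<le> loss j W k"
    using hel_sum_product[of UNIV P Q D] by (simp add: loss_def g_def Q_def)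
  have PF: "hel (UNIV \<times> D) P (fresh_law j W k) \<le> eps j k"
    using hel_fresh_le_eps[OF assms] by (simp add: P_def g_def D_def)
  have "contrast j W k \<le> 4 * hel (UNIV \<times> D) (fresh_law j W k) Q"
    unfolding contrast_def D_def[symmetric] hel_bool
    unfolding hel_def sum_distrib_left
  proof (rule sum_mono)
    fix t assume "t \<in> D"
    let ?q = "law W k t" and ?r = "lower_law j W t" and ?s = "sqrt (freq S g t / 2)"
    have "(sqrt ?q - sqrt ?r)\<^sup>2 = 2 * (sqrt (?q / 2) - sqrt (?r / 2))\<^sup>2"
      using law_nonneg[of W k t] lower_law_nonneg[of j W t]
      by (simp add: real_sqrt_divide power_divide flip: diff_divide_distrib)
    also have "\<dots> \<le> 2 * (2 * (sqrt (?q / 2) - ?s)\<^sup>2 + 2 * (?s - sqrt (?r / 2))\<^sup>2)"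
      by (intro mult_left_mono square_diff_triangle) auto
    finally show "(sqrt ?q - sqrt ?r)\<^sup>2
      \<le> 4 * ((sqrt (fresh_law j W k (False, t)) - sqrt (Q (False, t)))\<^sup>2
         + (sqrt (fresh_law j W k (True, t)) - sqrt (Q (True, t)))\<^sup>2)"
      by (simp add: fresh_law_def Q_def power2_commute[of ?s])
  qed
  also have "\<dots> \<le> 4 * (2 * hel (UNIV \<times> D) (fresh_law j W k) P + 2 * hel (UNIV \<times> D) P Q)"
    by (intro mult_left_mono hel_triangle) auto
  also have "\<dots> \<le> 8 * (eps j k + loss j W k)"
    using PQ PF hel_commute[of _ P "fresh_law j W k"] by simp
  finally show ?thesis .
qed

text \<open>Every unrevealed card sits at exactly one unrevealed vertex, so the uniform weight is
  the average of \<open>law W\<close> over these vertices. It differs from \<open>lower_law\<close>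
  only through the upper ones, so contrasts with the lower face control the distance to uniform, at
  the price \<open>2 + 2 = 4\<close>.\<close>

lemma deficit_sum_le:
  assumes j: "j \<in> {1..d}" and W: "V - subcube d j \<subseteq> W" "W \<subseteq> V" "W \<inter> lower d j = {}"
  shows "(\<Sum>k\<in>upper d j - W. ln (real (card (V - W))) - centr S (\<lambda>\<omega>. Y 0 \<omega> k) (cont 0 W))
     \<le> (5 + 4 * ln (real (card (V - W)))) * 4 * (\<Sum>k\<in>upper d j - W. contrast j W k)"
proof -
  define n where "n = card (V - W)"
  define U where "U = upper d j - W"
  define B where "B z = cards d - z ` W" for z :: "(nat \<Rightarrow> nat) \<Rightarrow> nat"
  define Zs where "Zs = cont 0 W ` S"
  have VW: "V - W = U \<union> lower d j"
    using W upper_subset[of d j] lower_subset[of d j] subcube_split[OF j] by (auto simp: U_def)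
  have disj: "U \<inter> lower d j = {}" using upper_lower_disjoint by (auto simp: U_def)
  have lpos: "card (lower d j) > 0" by (simp add: card_lower[OF j])
  have finVW: "finite (V - W)" "finite U" by (auto simp: U_def)
  have nge: "n \<ge> 1" using lpos VW finVW by (simp add: n_def card_Un_disjoint disj)
  have lnn: "ln (real n) \<ge> 0" using nge by simp
  have zimg: "cont 0 W \<omega> ` W = Y 0 \<omega> ` W" for \<omega> by (auto simp: cont_def)
  have Bcard: "finite (B z)" "card (B z) = n" if z: "z \<in> Zs" for z
  proof -
    obtain \<omega> where \<omega>: "\<omega> \<in> S" "z = cont 0 W \<omega>" using z unfolding Zs_def by blast
    have "Y 0 \<omega> ` (V - W) = Y 0 \<omega> ` V - Y 0 \<omega> ` W"
      by (rule inj_on_image_set_diff[OF Y_inj_on[OF \<omega>(1), of 0 V]]) (use W(2) in auto)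
    then have "Y 0 \<omega> ` (V - W) = B z"
      unfolding B_def \<omega>(2) zimg using Y_bij[OF \<omega>(1), of 0] by (simp add: bij_betw_def)
    moreover have "card (Y 0 \<omega> ` (V - W)) = n"
      unfolding n_def by (rule card_image, rule Y_inj_on[OF \<omega>(1)]) auto
    ultimately show "card (B z) = n" by simp
    show "finite (B z)" by (simp add: B_def)
  qed
  have YB: "Y 0 \<omega> a \<in> B (cont 0 W \<omega>)" if \<omega>: "\<omega> \<in> S" and a: "a \<in> V - W" for \<omega> a
  proof -
    have "Y 0 \<omega> a \<noteq> Y 0 \<omega> b" if "b \<in> W" for b
      using inj_onD[OF Y_inj_on[OF \<omega>, of 0 V], of a b] a that W(2) by auto
    then show ?thesis
      using Y_in_cards[OF \<omega>, of 0 a] a unfolding B_def zimg by auto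
  qed
  have key: "(\<Sum>k\<in>U. (sqrt (law W k (u, z)) - sqrt (freq S (cont 0 W) z / real n))\<^sup>2)
       \<le> 4 * (\<Sum>k\<in>U. (sqrt (law W k (u, z)) - sqrt (lower_law j W (u, z)))\<^sup>2)"
    if z: "z \<in> Zs" and u: "u \<in> B z" for u z
  proof -
    let ?q = "\<lambda>a. law W a (u, z)" and ?L = "lower_law j W (u, z)" and ?w = "freq S (cont 0 W) z / real n"
    \<comment> \<open>Replacing every lower entry by their mean keeps the total, hence
      \<open>?w\<close>, and leaves only the vertices of \<open>U\<close> in the comparison of
      \<open>?w\<close> with \<open>?L\<close>.\<close>
    define r where "r a = (if a \<in> U then ?q a else ?L)" for a
    have "(\<Sum>a\<in>V - W. ?q a) = freq S (\<lambda>\<omega>. (u \<in> Y 0 \<omega> ` (V - W), cont 0 W \<omega>)) (True, z)"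
      unfolding law_def using finVW by (intro sum_freq_occupied finS Y_inj_on) auto
    also have "\<dots> = freq S (cont 0 W) z"
    proof (rule freq_cong)
      fix \<omega> assume \<omega>: "\<omega> \<in> S"
      have "u \<in> Y 0 \<omega> ` (V - W)" if "cont 0 W \<omega> = z"
      proof -
        have "u \<in> cards d - Y 0 \<omega> ` W" using u that zimg[of \<omega>] by (simp add: B_def)
        moreover have "Y 0 \<omega> ` V = cards d" using Y_bij[OF \<omega>, of 0] by (simp add: bij_betw_def)
        ultimately show ?thesis by blast
      qed
      then show "(u \<in> Y 0 \<omega> ` (V - W), cont 0 W \<omega>) = (True, z) \<longleftrightarrow> cont 0 W \<omega> = z" by auto
    qed
    finally have tot: "(\<Sum>a\<in>V - W. ?q a) = freq S (cont 0 W) z" .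
    have "(\<Sum>a\<in>V - W. r a) = (\<Sum>a\<in>U. ?q a) + (\<Sum>a\<in>lower d j. ?L)"
    proof -
      have "(\<Sum>a\<in>V - W. r a) = (\<Sum>a\<in>U. r a) + (\<Sum>a\<in>lower d j. r a)"
        unfolding VW by (rule sum.union_disjoint) (use finVW disj in auto)
      moreover have "(\<Sum>a\<in>U. r a) = (\<Sum>a\<in>U. ?q a)" by (rule sum.cong) (auto simp: r_def)
      moreover have "(\<Sum>a\<in>lower d j. r a) = (\<Sum>a\<in>lower d j. ?L)"
        by (rule sum.cong) (use disj in \<open>auto simp: r_def\<close>)
      ultimately show ?thesis by simp
    qed
    also have "(\<Sum>a\<in>lower d j. ?L) = (\<Sum>a\<in>lower d j. ?q a)"
      using lpos by (simp add: lower_law_def)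
    also have "(\<Sum>a\<in>U. ?q a) + (\<Sum>a\<in>lower d j. ?q a) = (\<Sum>a\<in>V - W. ?q a)"
      unfolding VW by (rule sum.union_disjoint[symmetric]) (use finVW disj in auto)
    finally have w: "?w = (\<Sum>a\<in>V - W. r a / real n)" by (simp only: tot sum_divide_distrib[symmetric])
    have L: "?L = (\<Sum>a\<in>V - W. ?L / real n)"
      using nge by (simp only: sum_constant n_def[symmetric]) simp
    have "(sqrt ?L - sqrt ?w)\<^sup>2 \<le> (\<Sum>a\<in>V - W. (sqrt (?L / real n) - sqrt (r a / real n))\<^sup>2)"
      unfolding w by (subst L, rule sqrt_sum_diff_le) (auto simp: r_def law_nonneg lower_law_nonneg)
    also have "\<dots> = (\<Sum>a\<in>V - W. (sqrt ?L - sqrt (r a))\<^sup>2) / real n"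
      by (simp add: real_sqrt_divide power_divide sum_divide_distrib flip: diff_divide_distrib)
    also have "(\<Sum>a\<in>V - W. (sqrt ?L - sqrt (r a))\<^sup>2) = (\<Sum>a\<in>U. (sqrt ?L - sqrt (r a))\<^sup>2)"
      by (rule sum.mono_neutral_right) (use finVW VW in \<open>auto simp: r_def\<close>)
    also have "\<dots> = (\<Sum>a\<in>U. (sqrt (?q a) - sqrt ?L)\<^sup>2)"
      by (intro sum.cong) (auto simp: r_def power2_commute)
    finally have avg: "(sqrt ?L - sqrt ?w)\<^sup>2 \<le> (\<Sum>a\<in>U. (sqrt (?q a) - sqrt ?L)\<^sup>2) / real n" (is "_ \<le> ?A / _") .
    have "(\<Sum>k\<in>U. (sqrt (?q k) - sqrt ?w)\<^sup>2) \<le> (\<Sum>k\<in>U. 2 * (sqrt (?q k) - sqrt ?L)\<^sup>2 + 2 * (sqrt ?L - sqrt ?w)\<^sup>2)"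
      by (rule sum_mono, rule square_diff_triangle)
    also have "\<dots> = 2 * ?A + 2 * (real (card U) * (sqrt ?L - sqrt ?w)\<^sup>2)"
      by (simp add: sum.distrib sum_distrib_left)
    also have "real (card U) * (sqrt ?L - sqrt ?w)\<^sup>2 \<le> real n * (?A / real n)"
      using avg VW finVW disj by (intro mult_mono) (auto simp: n_def card_Un_disjoint sum_nonneg)
    also have "real n * (?A / real n) = ?A" using nge by simp
    finally show ?thesis by simp
  qed
  have "(\<Sum>k\<in>U. ln (real n) - centr S (\<lambda>\<omega>. Y 0 \<omega> k) (cont 0 W))
     \<le> (\<Sum>k\<in>U. (5 + 4 * ln (real n)) *
       (\<Sum>z\<in>Zs. hel (B z) (\<lambda>u. law W k (u, z)) (\<lambda>u. freq S (cont 0 W) z / real n)))"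
  proof (rule sum_mono)
    fix k assume k: "k \<in> U"
    show "ln (real n) - centr S (\<lambda>\<omega>. Y 0 \<omega> k) (cont 0 W) \<le> (5 + 4 * ln (real n)) *
       (\<Sum>z\<in>Zs. hel (B z) (\<lambda>u. law W k (u, z)) (\<lambda>u. freq S (cont 0 W) z / real n))"
      unfolding law_def Zs_def
      using nge Bcard YB k VW by (intro deficit_le_hel finS Sne) (auto simp: Zs_def)
  qed
  also have "\<dots> = (5 + 4 * ln (real n)) * (\<Sum>z\<in>Zs. \<Sum>u\<in>B z. \<Sum>k\<in>U. (sqrt (law W k (u, z)) - sqrt (freq S (cont 0 W) z / real n))\<^sup>2)"
    unfolding hel_def sum_distrib_left[symmetric]
    by (subst sum.swap, subst sum.swap[of _ U]) (rule refl)
  also have "\<dots> \<le> (5 + 4 * ln (real n)) * (\<Sum>z\<in>Zs. \<Sum>u\<in>cards d. 4 * (\<Sum>k\<in>U. (sqrt (law W k (u, z)) - sqrt (lower_law j W (u, z)))\<^sup>2))"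
  proof (rule mult_left_mono[OF sum_mono])
    fix z assume z: "z \<in> Zs"
    have "(\<Sum>u\<in>B z. \<Sum>k\<in>U. (sqrt (law W k (u, z)) - sqrt (freq S (cont 0 W) z / real n))\<^sup>2)
       \<le> (\<Sum>u\<in>B z. 4 * (\<Sum>k\<in>U. (sqrt (law W k (u, z)) - sqrt (lower_law j W (u, z)))\<^sup>2))"
      by (rule sum_mono, rule key[OF z])
    also have "\<dots> \<le> (\<Sum>u\<in>cards d. 4 * (\<Sum>k\<in>U. (sqrt (law W k (u, z)) - sqrt (lower_law j W (u, z)))\<^sup>2))"
      by (rule sum_mono2) (auto simp: B_def sum_nonneg)
    finally show "(\<Sum>u\<in>B z. \<Sum>k\<in>U. (sqrt (law W k (u, z)) - sqrt (freq S (cont 0 W) z / real n))\<^sup>2)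
      \<le> (\<Sum>u\<in>cards d. 4 * (\<Sum>k\<in>U. (sqrt (law W k (u, z)) - sqrt (lower_law j W (u, z)))\<^sup>2))" .
  qed (use lnn in simp)
  also have "(\<Sum>z\<in>Zs. \<Sum>u\<in>cards d. 4 * (\<Sum>k\<in>U. (sqrt (law W k (u, z)) - sqrt (lower_law j W (u, z)))\<^sup>2))
     = 4 * (\<Sum>z\<in>Zs. \<Sum>u\<in>cards d. \<Sum>k\<in>U. (sqrt (law W k (u, z)) - sqrt (lower_law j W (u, z)))\<^sup>2)"
    by (simp only: sum_distrib_left)
  also have "(\<Sum>z\<in>Zs. \<Sum>u\<in>cards d. \<Sum>k\<in>U. (sqrt (law W k (u, z)) - sqrt (lower_law j W (u, z)))\<^sup>2)
     = (\<Sum>k\<in>U. \<Sum>z\<in>Zs. \<Sum>u\<in>cards d. (sqrt (law W k (u, z)) - sqrt (lower_law j W (u, z)))\<^sup>2)"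
    by (subst (2) sum.swap, subst sum.swap) (rule refl)
  also have "\<dots> = (\<Sum>k\<in>U. contrast j W k)"
  proof (rule sum.cong[OF refl])
    fix k assume "k \<in> U"
    show "(\<Sum>z\<in>Zs. \<Sum>u\<in>cards d. (sqrt (law W k (u, z)) - sqrt (lower_law j W (u, z)))\<^sup>2) = contrast j W k"
      unfolding contrast_def hel_sum_product[symmetric] Zs_def by (simp add: hel_def)
  qed
  finally show ?thesis by (simp only: n_def U_def mult.assoc)
qed

end

section \<open>Robust entropy contraction\<close>


lemma restrict_eq_iff: "restrict f A = restrict g A \<longleftrightarrow> (\<forall>a\<in>A. f a = g a)"
  by (auto simp: restrict_def fun_eq_iff)

context thorp_round
begin

text \<open>Hindsight after step \<open>j\<close>: the past coins locate each starting vertex just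
  before the step, and the step-\<open>j\<close> coins met by cards from \<open>W\<close> allow
  these cards to be followed through it.\<close>

definition info :: "nat \<Rightarrow> (nat \<Rightarrow> nat) set \<Rightarrow> 'w \<Rightarrow>
    ((nat \<Rightarrow> nat) \<Rightarrow> nat) \<times> (nat \<times> (nat \<Rightarrow> nat) \<Rightarrow> bool) \<times> ((nat \<Rightarrow> nat) \<Rightarrow> bool)" where
  "info j W \<omega> = (cont j V \<omega>, coins (past_coins j) \<omega>, restrict (beta j \<omega>) W)"

definition deficit :: "nat \<Rightarrow> real" where
  "deficit s = ln (fact (2 ^ d)) - entr S (cont s V)"

lemma past_agree:
  assumes "j \<in> {1..d}" "x \<in> S" "y \<in> S" "coins (past_coins j) x = coins (past_coins j) y"
  shows "agree (j - 1) V x y"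
  using assms by (intro agree_coins[OF closed_upto_V assms(2,3), of _ "past_coins j"])
    (auto simp: past_coins_def in_coin_sites)

lemma past_pos:
  assumes "j \<in> {1..d}" "x \<in> S" "y \<in> S" "coins (past_coins j) x = coins (past_coins j) y" "k \<in> V"
  shows "pos (j - 1) x k = pos (j - 1) y k"
  using assms(1,5) by (intro pos_agree[OF past_agree[OF assms(1-4)] closed_upto_V]) auto

lemma pos_beta:
  "j \<in> {1..d} \<Longrightarrow> pos j \<omega> k = (if beta j \<omega> k then flip j (pos (j - 1) \<omega> k) else pos (j - 1) \<omega> k)"
  by (cases j) (auto simp: beta_def mv_def)

text \<open>\<open>info j W\<close> determines the landed card and the starting contents of
  \<open>W\<close>, so it is the finer condition. Entropies given \<open>info\<close> add up along
  the revelation, whereas \<open>loss\<close> refers to a different landed card for each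
  \<open>k\<close>.\<close>

lemma loss_le:
  assumes j: "j \<in> {1..d}" and W: "W \<subseteq> V" and k: "k \<in> V"
  shows "loss j W k \<le> ln 2 - centr S (\<lambda>\<omega>. beta j \<omega> k) (info j W)"
proof -
  have "centr S (\<lambda>\<omega>. beta j \<omega> k) (info j W)
      \<le> centr S (\<lambda>\<omega>. beta j \<omega> k) (\<lambda>\<omega>. (landing j \<omega> k, cont 0 W \<omega>))"
  proof (rule centr_anti[OF finS])
    fix x y assume xy: "x \<in> S" "y \<in> S" "info j W x = info j W y"
    then have c: "coins (past_coins j) x = coins (past_coins j) y" and Yj: "\<forall>v\<in>V. Y j x v = Y j y v"
      and b: "restrict (beta j x) W = restrict (beta j y) W"
      by (auto simp: info_def cont_eq_iff)
    note pp = past_pos[OF j xy(1,2) c]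
    have "pos (j - 1) x k \<in> V" using j k by (intro pos_in_V) auto
    then have "landing j x k = landing j y k" using Yj pp[OF k] by (simp add: landing_def)
    moreover have "Y 0 x a = Y 0 y a" if a: "a \<in> W" for a
    proof -
      have aV: "a \<in> V" and jd: "j \<le> d" using a W j by auto
      have "beta j x a = beta j y a" using b a by (metis restrict_apply')
      then have "pos j x a = pos j y a" using pp[OF aV] by (simp add: pos_beta[OF j])
      then show ?thesis
        using Y_pos[OF xy(1) aV jd] Y_pos[OF xy(2) aV jd] Yj pos_in_V[OF aV jd, of x] by simp
    qed
    ultimately show "(landing j x k, cont 0 W x) = (landing j y k, cont 0 W y)" by (simp add: cont_eq_iff)
  qed
  then show ?thesis by (simp add: loss_def)
qed

text \<open>32 is the 4 of \<open>deficit_sum_le\<close> times the 8 of \<open>contrast_le\<close>;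
  the other factor converts Hellinger distance to entropy for at most \<open>2 ^ d\<close> available
  cards.\<close>

definition rate :: real where "rate = 32 * (5 + 4 * ln (2 ^ d))"

text \<open>Only the sum over unrevealed upper vertices is controlled, so some vertex obeys the
  bound on its own; it is revealed and the induction goes on. The left side accumulates deficits of
  cards and the right side deficits of coins, both by the chain rule.\<close>

lemma greedy:
  assumes j: "j \<in> {1..d}"
  shows "V - subcube d j \<subseteq> W \<Longrightarrow> W \<subseteq> V \<Longrightarrow> W \<inter> lower d j = {} \<Longrightarrow>
     ln (fact (card (V - W))) - ln (fact (card (lower d j)))
       - (entr S (cont 0 (V - lower d j)) - entr S (cont 0 W))
     \<le> rate * (real (card (upper d j - W)) * ln 2 - (entr S (info j (V - lower d j)) - entr S (info j W))
        + (\<Sum>k\<in>upper d j - W. eps j k))"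
proof (induction "card (upper d j - W)" arbitrary: W)
  case 0
  then have "upper d j \<subseteq> W" by simp
  then have W: "W = V - lower d j"
    using 0 subcube_split[OF j] subcube_subset[of d j] by auto
  have "V - (V - lower d j) = lower d j" "upper d j - (V - lower d j) = {}"
    using lower_subset[of d j] upper_subset[of d j] upper_lower_disjoint[of d j] by auto
  then show ?case unfolding W by (simp only:) simp
next
  case (Suc m)
  let ?U = "upper d j - W"
  let ?e = "\<lambda>k. ln (real (card (V - W))) - centr S (\<lambda>\<omega>. Y 0 \<omega> k) (cont 0 W)"
  have finU: "finite ?U" by simp
  have Une: "?U \<noteq> {}" using Suc(2) by (metis card.empty nat.simps(3))
  have "lower d j \<subseteq> V - W" using Suc(3-5) lower_subset[of d j] by auto
  moreover have "lower d j \<noteq> {}" using card_lower[OF j] by auto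
  ultimately have VW: "card (V - W) > 0" by (auto simp: card_gt_0_iff)
  have VWle: "card (V - W) \<le> 2 ^ d" using card_mono[of V "V - W"] by (simp add: card_hypercube)
  have "(\<Sum>k\<in>?U. ?e k) \<le> (5 + 4 * ln (real (card (V - W)))) * 4 * (\<Sum>k\<in>?U. contrast j W k)"
    using Suc by (intro deficit_sum_le[OF j]) auto
  also have "\<dots> \<le> (5 + 4 * ln (2 ^ d)) * 4 * (\<Sum>k\<in>?U. 8 * (eps j k + loss j W k))"
  proof (intro mult_mono sum_mono contrast_le[OF j])
    have "real (card (V - W)) \<le> real (2 ^ d)" using VWle by (simp only: of_nat_le_iff)
    then have "ln (real (card (V - W))) \<le> ln (2 ^ d)" using VW by (intro ln_mono) auto
    then show "5 + 4 * ln (real (card (V - W))) \<le> 5 + 4 * ln (2 ^ d :: real)" by simp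
    have "0 \<le> ln (2 ^ d :: real)" by simp
    then show "0 \<le> (5 + 4 * ln (2 ^ d :: real)) * 4" by simp
    show "0 \<le> (\<Sum>k\<in>?U. contrast j W k)" by (simp add: sum_nonneg contrast_def hel_nonneg)
  qed (use Suc in auto)
  also have "\<dots> = (\<Sum>k\<in>?U. rate * (eps j k + loss j W k))"
    by (simp add: rate_def sum_distrib_left algebra_simps)
  finally have "\<exists>k\<in>?U. ?e k \<le> rate * (eps j k + loss j W k)"
    using sum_strict_mono[OF finU Une, of "\<lambda>k. rate * (eps j k + loss j W k)" ?e] by (meson not_le)
  then obtain k where k: "k \<in> ?U" and ek: "?e k \<le> rate * (eps j k + loss j W k)" by blast
  define W' where "W' = insert k W"
  have kV: "k \<in> V" and kW: "k \<notin> W" using k upper_subset by auto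
  have rate0: "rate \<ge> 0" by (simp add: rate_def)
  have U': "?U = insert k (upper d j - W')" "k \<notin> upper d j - W'" using k by (auto simp: W'_def)
  then have m: "m = card (upper d j - W')" using Suc(2) by simp
  have IH: "ln (fact (card (V - W'))) - ln (fact (card (lower d j)))
       - (entr S (cont 0 (V - lower d j)) - entr S (cont 0 W'))
     \<le> rate * (real (card (upper d j - W')) * ln 2 - (entr S (info j (V - lower d j)) - entr S (info j W'))
        + (\<Sum>k\<in>upper d j - W'. eps j k))"
    using Suc(3-5) kV k upper_lower_disjoint[of d j] by (intro Suc(1) m) (auto simp: W'_def)
  have "card (V - W) = Suc (card (V - W'))"
  proof -
    have "V - W' = V - W - {k}" by (auto simp: W'_def)
    then show ?thesis using kV kW card_Suc_Diff1[of "V - W" k] by simp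
  qed
  then have lnf: "ln (fact (card (V - W))) = ln (real (card (V - W))) + ln (fact (card (V - W')) :: real)"
    by (simp add: ln_mult)
  have e1: "entr S (cont 0 W') = centr S (\<lambda>\<omega>. Y 0 \<omega> k) (cont 0 W) + entr S (cont 0 W)"
  proof -
    have "entr S (cont 0 W') = entr S (\<lambda>\<omega>. (Y 0 \<omega> k, cont 0 W \<omega>))"
      by (rule entr_eq[OF finS]) (auto simp: cont_eq_iff W'_def)
    then show ?thesis by (simp add: centr_def)
  qed
  have e2: "entr S (info j W') = centr S (\<lambda>\<omega>. beta j \<omega> k) (info j W) + entr S (info j W)"
  proof -
    have "entr S (info j W') = entr S (\<lambda>\<omega>. (beta j \<omega> k, info j W \<omega>))"
    proof (rule entr_eq[OF finS])
      fix x y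
      show "(beta j x k, info j W x) = (beta j y k, info j W y) \<longleftrightarrow> info j W' x = info j W' y"
        unfolding info_def prod.inject restrict_eq_iff W'_def ball_simps by blast
    qed
    then show ?thesis by (simp add: centr_def)
  qed
  have "?e k \<le> rate * (eps j k + (ln 2 - centr S (\<lambda>\<omega>. beta j \<omega> k) (info j W)))"
    using ek loss_le[OF j Suc(4) kV] rate0 by (smt (verit) mult_left_mono)
  with IH have "?e k + (ln (fact (card (V - W'))) - ln (fact (card (lower d j)))
       - (entr S (cont 0 (V - lower d j)) - entr S (cont 0 W')))
    \<le> rate * ((eps j k + (ln 2 - centr S (\<lambda>\<omega>. beta j \<omega> k) (info j W)))
       + (real (card (upper d j - W')) * ln 2 - (entr S (info j (V - lower d j)) - entr S (info j W'))
        + (\<Sum>k\<in>upper d j - W'. eps j k)))"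
    unfolding distrib_left by linarith
  moreover have "real (card ?U) = 1 + real (card (upper d j - W'))" "(\<Sum>k\<in>?U. eps j k) = eps j k + (\<Sum>k\<in>upper d j - W'. eps j k)"
    using U' by simp_all
  ultimately show ?case unfolding lnf e1 e2 by (simp add: algebra_simps)
qed

lemma Y_prev: "\<omega> \<in> S \<Longrightarrow> s < d \<Longrightarrow> v \<in> V \<Longrightarrow> Y s \<omega> v = Y (Suc s) \<omega> (mv (Suc s) \<omega> v)"
proof -
  assume a: "\<omega> \<in> S" "s < d" "v \<in> V"
  have "mv (Suc s) \<omega> v \<in> V" using a flip_in_hypercube by (auto simp: mv_def)
  then show ?thesis using Y_Suc_mv[OF a(1,2), of "mv (Suc s) \<omega> v"] mv_mv[OF a(1) _ a(3), of "Suc s"] a by simp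
qed

lemma Y_back:
  assumes "x \<in> S" "y \<in> S" "\<And>s v. s \<in> {j<..d} \<Longrightarrow> v \<in> V \<Longrightarrow> c s x v = c s y v" "\<forall>v\<in>V. Y d x v = Y d y v"
    and "j \<le> d" "v \<in> V"
  shows "Y j x v = Y j y v"
proof -
  have "\<forall>v\<in>V. Y j x v = Y j y v"
    using \<open>j \<le> d\<close> assms(3)
  proof (induction rule: inc_induct)
    case base
    then show ?case using assms by simp
  next
    case (step n)
    show ?case
    proof
      fix v assume v: "v \<in> V"
      have "c (Suc n) x v = c (Suc n) y v" using step v by auto
      then have "mv (Suc n) x v = mv (Suc n) y v" by (simp add: mv_def)
      moreover have "mv (Suc n) x v \<in> V" using v step flip_in_hypercube by (auto simp: mv_def)
      ultimately show "Y n x v = Y n y v"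
        using step v Y_prev[OF assms(1) _ v, of n] Y_prev[OF assms(2) _ v, of n] by auto
    qed
  qed
  then show ?thesis using assms by blast
qed

lemma coins_eqD:
  assumes "x \<in> S" "y \<in> S" "coins A x = coins A y" "s \<in> {1..d}" "v \<in> V" "(s, v(s := 0)) \<in> A"
  shows "c s x v = c s y v"
  using c_base[OF assms(1,4,5)] c_base[OF assms(2,4,5)] assms(3,6) by (auto simp: coins_eq_iff)

text \<open>With the coins known a round can be run backwards, so the end together with the coins
  has at least the entropy of the start together with the coins; given the end, each coin adds at
  most \<open>ln 2\<close>.\<close>

lemma deficit_le: "deficit d \<le> deficit 0 + \<kappa>"
proof -
  let ?C = "coin_sites d"
  have "entr S (\<lambda>\<omega>. (coins ?C \<omega>, cont 0 V \<omega>)) \<le> entr S (\<lambda>\<omega>. (coins ?C \<omega>, cont d V \<omega>))"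
  proof (rule entr_mono[OF finS])
    fix x y assume xy: "x \<in> S" "y \<in> S" "(coins ?C x, cont d V x) = (coins ?C y, cont d V y)"
    have "c s x v = c s y v" if "s \<in> {0<..d}" "v \<in> V" for s v
      using that xy base_cases[of v s] flip_in_hypercube[of v d s]
      by (intro coins_eqD[of x y ?C]) (auto simp: in_coin_sites)
    then show "(coins ?C x, cont 0 V x) = (coins ?C y, cont 0 V y)"
      using Y_back[OF xy(1,2), of 0] xy(3) by (auto simp: cont_eq_iff)
  qed
  moreover have "centr S (coins ?C) (cont d V) \<le> real (card ?C) * ln 2"
    by (rule coins_entropy_le) simp
  ultimately show ?thesis by (simp add: deficit_def \<kappa>_def centr_def)
qed

text \<open>What the step-\<open>j\<close> coins of the upper face lack in entropy, given the
  hindsight, is deficit that the arrangement has shed by the end of the round, up to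
  \<open>\<kappa>\<close>. The balance compares start and all coins with the end and only the coins
  in \<open>rest\<close>.\<close>

lemma gain_le:
  assumes j: "j \<in> {1..d}"
  defines "W \<equiv> V - subcube d j"
  shows "real (card (upper d j)) * ln 2 - (entr S (info j (V - lower d j)) - entr S (info j W))
    \<le> deficit 0 + \<kappa> - deficit d"
proof -
  let ?C = "coin_sites d" and ?F = "V - lower d j"
  define later where "later = {(s, v) \<in> ?C. j < s}"
  define rest where "rest = ?C - {j} \<times> lower d j"
  have jL: "{j} \<times> lower d j \<subseteq> ?C" using j lower_subset[of d j] by (auto simp: in_coin_sites lower_def)
  have closedW: "closed_upto j W" unfolding closed_upto_def
  proof (intro conjI ballI)
    fix s v assume s: "s \<in> {1..j}" and v: "v \<in> W"
    have vV: "v \<in> V" and sd: "s \<in> {1..d}" using v s j by (auto simp: W_def)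
    show "flip s v \<in> W"
    proof (rule ccontr)
      assume "flip s v \<notin> W"
      then have "flip s v \<in> subcube d j" using flip_in_hypercube[OF vV sd] by (simp add: W_def)
      then have "flip s (flip s v) \<in> subcube d j" using flip_subcube[of "flip s v" d j s] s j by simp
      then show False using v flip_flip[OF vV sd] by (simp add: W_def)
    qed
  qed (use j in \<open>auto simp: W_def\<close>)
  have closedW': "closed_upto (j - 1) W" using closedW by (rule closed_upto_mono) simp
  have closedU: "closed_upto (j - 1) (upper d j)" using j by (intro closed_upto_upper) auto
  have card_rest: "real (card rest) = real (card ?C) - real (card (upper d j))"
    using jL card_mono[OF finite_coin_sites jL] unfolding rest_def
    by (simp add: card_Diff_subset finite_subset[OF jL] of_nat_diff card_cartesian_product card_upper[OF j] card_lower[OF j])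
  \<comment> \<open>Cards from \<open>?F\<close> meet every edge of direction \<open>j\<close>:
    those inside the subcube at the upper endpoint, the others because \<open>W\<close> is closed.
    With the past coins, \<open>beta j\<close> on \<open>?F\<close> therefore gives all coins of
    step \<open>j\<close>.\<close>
  have "entr S (\<lambda>\<omega>. (coins ?C \<omega>, cont 0 V \<omega>)) \<le> entr S (\<lambda>\<omega>. (info j ?F \<omega>, coins later \<omega>))"
  proof (rule entr_mono[OF finS])
    fix x y assume xy: "x \<in> S" "y \<in> S" "(info j ?F x, coins later x) = (info j ?F y, coins later y)"
    have p: "coins (past_coins j) x = coins (past_coins j) y" and Yj: "\<forall>v\<in>V. Y j x v = Y j y v"
      and b: "restrict (beta j x) ?F = restrict (beta j y) ?F" and l: "coins later x = coins later y"
      using xy(3) by (auto simp: info_def cont_eq_iff)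
    note pp = past_pos[OF j xy(1,2) p]
    have bb: "beta j x a = beta j y a" if "a \<in> ?F" for a using b that by (metis restrict_apply')
    have via: "c j x v = c j y v" if A: "closed_upto (j - 1) A" "A \<subseteq> ?F" "v \<in> A" for A v
    proof -
      obtain a where a: "a \<in> A" "pos (j - 1) x a = v" using pos_onto[OF xy(1) A(1,3)] .
      then have "pos (j - 1) y a = v" using pp[of a] A by auto
      then show ?thesis using bb[of a] a A by (auto simp: beta_def)
    qed
    have cj: "c j x v = c j y v" if v: "v \<in> V" "v j = 0" for v
    proof (cases "v \<in> W")
      case True
      then show ?thesis
        using via[OF closedW'] subcube_split[OF j] by (auto simp: W_def)
    next
      case False
      then have "v \<in> lower d j" using v by (auto simp: W_def lower_def)
      then have "flip j v \<in> upper d j" using j flip_subcube[of v d j j] by (auto simp: upper_def lower_def flip_same)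
      moreover have "upper d j \<subseteq> ?F" using upper_subset[of d j] upper_lower_disjoint[of d j] by auto
      ultimately have "c j x (flip j v) = c j y (flip j v)" using via[OF closedU] by blast
      then show ?thesis using c_flip[OF xy(1) j v(1)] c_flip[OF xy(2) j v(1)] by simp
    qed
    have all: "coins ?C x = coins ?C y"
    proof -
      have "c s x v = c s y v" if sv: "(s, v) \<in> ?C" for s v
      proof -
        consider "s < j" | "s = j" | "s > j" by linarith
        then show ?thesis
          using sv p l cj by cases (auto simp: coins_eq_iff past_coins_def later_def in_coin_sites)
      qed
      then show ?thesis by (auto simp: coins_eq_iff)
    qed
    have clV: "closed_upto j V" using j by (intro closed_upto_V) auto
    have ag: "agree j V x y"
      using j by (intro agree_coins[OF clV xy(1,2) all]) (auto simp: in_coin_sites)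
    have "Y 0 x a = Y 0 y a" if a: "a \<in> V" for a
    proof -
      have jd: "j \<le> d" using j by auto
      have "pos j x a = pos j y a" using pos_agree[OF ag clV a] by simp
      then show ?thesis
        using Y_pos[OF xy(1) a jd] Y_pos[OF xy(2) a jd] Yj pos_in_V[OF a jd, of x] by simp
    qed
    then show "(coins ?C x, cont 0 V x) = (coins ?C y, cont 0 V y)" using all by (simp add: cont_eq_iff)
  qed
  also have "\<dots> = entr S (\<lambda>\<omega>. (info j ?F \<omega>, coins later \<omega>, info j W \<omega>))"
    by (rule entr_eq[OF finS])
      (auto simp: info_def W_def restrict_def fun_eq_iff lower_def)
  also have "\<dots> \<le> entr S (\<lambda>\<omega>. (info j ?F \<omega>, info j W \<omega>)) + entr S (\<lambda>\<omega>. (coins later \<omega>, info j W \<omega>)) - entr S (info j W)"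
    using entr_submod[OF finS, of "info j ?F" "coins later" "info j W"] by simp
  also have "entr S (\<lambda>\<omega>. (info j ?F \<omega>, info j W \<omega>)) = entr S (info j ?F)"
    by (rule entr_eq[OF finS])
      (auto simp: info_def W_def restrict_def fun_eq_iff lower_def)
  \<comment> \<open>\<open>rest\<close> omits the direction-\<open>j\<close> edges inside the
    subcube: undoing the later steps takes only later coins, and cards from \<open>W\<close> never
    meet those edges. The omission produces the term \<open>card (upper d j) * ln 2\<close>.\<close>
  also have "entr S (\<lambda>\<omega>. (coins later \<omega>, info j W \<omega>)) \<le> entr S (\<lambda>\<omega>. (coins rest \<omega>, cont d V \<omega>))"
  proof (rule entr_mono[OF finS])
    fix x y assume xy: "x \<in> S" "y \<in> S" "(coins rest x, cont d V x) = (coins rest y, cont d V y)"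
    have r: "coins rest x = coins rest y" and Yd: "\<forall>v\<in>V. Y d x v = Y d y v" using xy(3) by (auto simp: cont_eq_iff)
    have p: "coins (past_coins j) x = coins (past_coins j) y" and l: "coins later x = coins later y"
      using r by (auto simp: coins_eq_iff rest_def past_coins_def later_def)
    have "c s x v = c s y v" if "s \<in> {j<..d}" "v \<in> V" for s v
      using that j base_cases[of v s] flip_in_hypercube[of v d s]
      by (intro coins_eqD[OF xy(1,2) r]) (auto simp: in_coin_sites rest_def)
    then have "\<forall>v\<in>V. Y j x v = Y j y v" using Y_back[OF xy(1,2) _ Yd, of j] j by auto
    moreover have "beta j x a = beta j y a" if a: "a \<in> W" for a
    proof -
      have aV: "a \<in> V" using a by (simp add: W_def)
      define v where "v = pos (j - 1) x a"
      have vW: "v \<in> W" unfolding v_def using pos_in[OF closedW' a] by simp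
      have vV: "v \<in> V" using vW by (simp add: W_def)
      have "v(j := 0) \<in> W"
        using base_cases[OF vV j] vW closedW j by (auto simp: closed_upto_def)
      then have "(j, v(j := 0)) \<in> rest" using j by (auto simp: rest_def in_coin_sites W_def lower_def)
      then have "c j x v = c j y v" by (rule coins_eqD[OF xy(1,2) r j vV])
      then show ?thesis using past_pos[OF j xy(1,2) p aV] by (simp add: beta_def v_def)
    qed
    then have "restrict (beta j x) W = restrict (beta j y) W" by (auto simp: restrict_def)
    ultimately show "(coins later x, info j W x) = (coins later y, info j W y)"
      using p l by (auto simp: info_def cont_eq_iff)
  qed
  also have "entr S (\<lambda>\<omega>. (coins rest \<omega>, cont d V \<omega>)) \<le> real (card rest) * ln 2 + entr S (cont d V)"
    using coins_entropy_le[of rest "cont d V"] by (simp add: centr_def rest_def)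
  finally show ?thesis
    by (simp add: deficit_def \<kappa>_def centr_def card_rest algebra_simps)
qed

text \<open>\<open>?a\<close> telescopes over the nested subcubes, so the deficit of the start is at
  most a sum of one share per direction, each bounded by \<open>rate * X\<close> with the same
  \<open>X\<close>. A large deficit thus forces a large decrease.\<close>

lemma robust_contraction:
  "deficit d \<le> (1 - 1 / (288 * real d ^ 2)) * deficit 0 + 3 * real d * \<kappa>"
proof -
  define X where "X = deficit 0 + \<kappa> - deficit d + 2 * real d * \<kappa>"
  let ?a = "\<lambda>j. ln (fact (2 ^ j) :: real) + entr S (cont 0 (V - subcube d j))"
  have rate0: "rate \<ge> 0" by (simp add: rate_def)
  have X0: "X \<ge> 0" using deficit_le \<kappa>_nonneg by (simp add: X_def)
  have step: "?a j - ?a (j - 1) \<le> rate * X" if j: "j \<in> {1..d}" for j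
  proof -
    let ?W = "V - subcube d j"
    have *: "V - ?W = subcube d j" "upper d j - ?W = upper d j"
      using subcube_subset upper_subset by (auto simp: upper_def)
    have "ln (fact (card (V - ?W))) - ln (fact (card (lower d j)))
       - (entr S (cont 0 (V - lower d j)) - entr S (cont 0 ?W))
     \<le> rate * (real (card (upper d j - ?W)) * ln 2 - (entr S (info j (V - lower d j)) - entr S (info j ?W))
        + (\<Sum>k\<in>upper d j - ?W. eps j k))"
      by (rule greedy[OF j]) (auto simp: lower_def)
    also have "\<dots> \<le> rate * X"
      unfolding * X_def using gain_le[OF j] eps_sum_le[OF j] rate0 by (intro mult_left_mono add_mono) auto
    finally show ?thesis
      unfolding * card_lower[OF j] unfolding lower_eq[OF j] using j by (simp add: card_subcube)
  qed
  have "?a d - ?a 0 = (\<Sum>j\<in>{1..d}. ?a j - ?a (j - 1))"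
    using sum_telescope''[of 0 d ?a] by simp
  also have "\<dots> \<le> (\<Sum>j\<in>{1..d}. rate * X)" by (rule sum_mono, rule step)
  finally have 1: "?a d - ?a 0 \<le> real d * (rate * X)" by simp
  have "entr S (cont 0 (V - subcube d d)) = 0"
    by (rule entr_const[OF finS]) (auto simp: cont_def subcube_full)
  moreover have "entr S (cont 0 (V - subcube d 0)) \<le> entr S (cont 0 V)"
    by (rule entr_mono[OF finS]) (auto simp: cont_eq_iff)
  ultimately have "deficit 0 \<le> ?a d - ?a 0" by (simp add: deficit_def)
  also note 1
  also have "real d * (rate * X) \<le> real d * (288 * real d * X)"
  proof (intro mult_left_mono mult_right_mono X0)
    have "ln (2 ^ d :: real) \<le> real d" using ln_2_less_1 by (simp add: ln_realpow mult_left_le)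
    \<comment> \<open>\<open>5 + 4 * d \<le> 9 * d\<close>, and \<open>32 * 9 = 288\<close>.\<close>
    then show "rate \<le> 288 * real d" using d_pos by (simp add: rate_def)
  qed simp
  finally have "deficit 0 \<le> (288 * real d ^ 2) * X" by (simp add: power2_eq_square mult.assoc)
  then have "deficit 0 / (288 * real d ^ 2) \<le> X" using d_pos by (simp add: divide_le_eq mult.commute)
  moreover have "\<kappa> + 2 * real d * \<kappa> \<le> 3 * real d * \<kappa>"
    using \<kappa>_nonneg d_pos mult_right_mono[of 1 "real d" \<kappa>] by simp
  ultimately show ?thesis by (simp add: X_def algebra_simps)
qed

end

section \<open>Bridges and kernels\<close>


text \<open>A deficit that contracts must be rebuilt by paying. If the cost stayed below
  \<open>\<Lambda> - 1\<close>, then \<open>r = D - E\<close>, which never increases, would end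
  above 1 and so exceed 1 throughout. In each round either \<open>r\<close> shrinks by
  \<open>1 - c / 2\<close>, or the payment makes \<open>E + 1\<close> grow by \<open>1 + a\<close>;
  over \<open>m\<close> rounds this is too much.\<close>

lemma bridge_cost:
  fixes D \<kappa> :: "nat \<Rightarrow> real" and c A \<Lambda> :: real
  assumes c: "0 < c" "c \<le> 1" and A: "1 \<le> A"
    and \<kappa>: "\<And>i. i < m \<Longrightarrow> 0 \<le> \<kappa> i"
    and slack: "\<And>i. i < m \<Longrightarrow> D (Suc i) \<le> D i + \<kappa> i"
    and contr: "\<And>i. i < m \<Longrightarrow> D (Suc i) \<le> (1 - c) * D i + A * \<kappa> i"
    and ends: "D 0 = \<Lambda>" "D m = \<Lambda>" "0 < \<Lambda>"
    and long: "\<Lambda>\<^sup>2 \<le> (1 + c / (2 * A)) ^ m"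
  shows "\<Lambda> - 1 \<le> (\<Sum>i<m. \<kappa> i)"
proof (rule ccontr)
  define E where "E k = (\<Sum>i<k. \<kappa> i)" for k
  define a where "a = c / (2 * A)"
  define r where "r k = D k - E k" for k
  assume "\<not> ?thesis"
  then have Em: "E m < \<Lambda> - 1" by (simp add: E_def)
  have a: "0 \<le> a" "a \<le> c / 2" using c A by (auto simp: a_def field_simps)
  have ac: "(1 + a) * (1 - c / 2) \<le> 1"
  proof -
    have "(1 + a) * (1 - c / 2) \<le> (1 + c / 2) * (1 - c / 2)"
      using a c by (intro mult_right_mono) auto
    also have "\<dots> = 1 - (c / 2)\<^sup>2" by (simp add: power2_eq_square algebra_simps)
    finally show ?thesis using zero_le_power2[of "c / 2"] by linarith
  qed
  have Epos: "0 \<le> E k" if "k \<le> m" for k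
    unfolding E_def using that \<kappa> by (intro sum_nonneg) auto
  have rdec: "r (Suc k) \<le> r k" if "k < m" for k
    using slack[OF that] by (simp add: r_def E_def)
  have rgt: "r k > 1" if "k \<le> m" for k
    using that
  proof (induction rule: inc_induct)
    case base
    then show ?case using Em ends by (simp add: r_def)
  next
    case (step n)
    then show ?case using rdec[of n] by linarith
  qed
  \<comment> \<open>The ratio of \<open>(1 + a) ^ k * r k\<close> to \<open>E k + 1\<close> never
    increases: the factor \<open>1 + a\<close> is offset by a shrinking \<open>r\<close> through
    \<open>ac\<close>, or by the growth of \<open>E + 1\<close>. The added 1 lets growth start from
    cost 0.\<close>
  have main: "(1 + a) ^ k * r k \<le> \<Lambda> * (E k + 1)" if "k \<le> m" for k
    using that
  proof (induction k)
    case 0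
    then show ?case using ends by (simp add: r_def E_def)
  next
    case (Suc k)
    then have k: "k < m" and IH: "(1 + a) ^ k * r k \<le> \<Lambda> * (E k + 1)" by auto
    have p: "(1 + a) ^ k \<ge> 0" using a by simp
    have ES: "E (Suc k) = E k + \<kappa> k" by (simp add: E_def)
    show ?case
    proof (cases "r (Suc k) \<le> (1 - c / 2) * r k")
      case True
      have "(1 + a) ^ Suc k * r (Suc k) \<le> (1 + a) ^ Suc k * ((1 - c / 2) * r k)"
        using True a by (intro mult_left_mono) auto
      also have "\<dots> = ((1 + a) * (1 - c / 2)) * ((1 + a) ^ k * r k)" by (simp add: mult_ac)
      also have "\<dots> \<le> 1 * ((1 + a) ^ k * r k)"
        using ac p rgt[of k] k by (intro mult_right_mono) auto
      also have "\<dots> \<le> \<Lambda> * (E k + 1)" using IH by simp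
      also have "\<dots> \<le> \<Lambda> * (E (Suc k) + 1)"
        using \<kappa>[OF k] ends ES by (intro mult_left_mono) auto
      finally show ?thesis .
    next
      case False
      have "A * \<kappa> k \<ge> r (Suc k) + E (Suc k) - (1 - c) * (r k + E k)"
        using contr[OF k] by (simp add: r_def)
      moreover have "r (Suc k) + E (Suc k) - (1 - c) * (r k + E k) \<ge> (c / 2) * r k + c * E k"
        using False \<kappa>[OF k] ES by (simp add: algebra_simps)
      moreover have "c * E k \<ge> (c / 2) * E k" using c Epos[of k] k by (intro mult_right_mono) auto
      moreover have "(c / 2) * r k \<ge> (c / 2) * 1" using c rgt[of k] k by (intro mult_left_mono) auto
      ultimately have "A * \<kappa> k \<ge> (c / 2) * (E k + 1)" by (simp add: distrib_left)
      then have "\<kappa> k \<ge> a * (E k + 1)" using A by (simp add: a_def field_simps)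
      then have grow: "(1 + a) * (E k + 1) \<le> E (Suc k) + 1" using ES by (simp add: algebra_simps)
      have "(1 + a) ^ Suc k * r (Suc k) \<le> (1 + a) ^ Suc k * r k"
        using rdec[OF k] a by (intro mult_left_mono) auto
      also have "\<dots> = (1 + a) * ((1 + a) ^ k * r k)" by simp
      also have "\<dots> \<le> (1 + a) * (\<Lambda> * (E k + 1))" using IH a by (intro mult_left_mono) auto
      also have "\<dots> = \<Lambda> * ((1 + a) * (E k + 1))" by simp
      also have "\<dots> \<le> \<Lambda> * (E (Suc k) + 1)" using grow ends by (intro mult_left_mono) auto
      finally show ?thesis .
    qed
  qed
  have "\<Lambda>\<^sup>2 * r m \<le> (1 + a) ^ m * r m"
    using long rgt[of m] by (intro mult_right_mono) (auto simp: a_def)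
  also have "\<dots> \<le> \<Lambda> * (E m + 1)" by (rule main) simp
  also have "\<dots> < \<Lambda> * \<Lambda>" using Em ends by (intro mult_strict_left_mono) auto
  finally have "\<Lambda>\<^sup>2 * r m < \<Lambda>\<^sup>2 * 1" by (simp add: power2_eq_square)
  then show False using rgt[of m] ends by (simp add: mult_less_cancel_left)
qed

section \<open>Arrangements and the one-step kernels\<close>

lemma arrangement_bij: "x \<in> arrangements d \<Longrightarrow> bij_betw x (cards d) (hypercube d)"
  by (simp add: arrangements_def)

lemma finite_arrangements [simp]: "finite (arrangements d)"
proof (rule finite_subset)
  show "arrangements d \<subseteq> cards d \<rightarrow>\<^sub>E hypercube d"
    by (auto simp: arrangements_def PiE_iff bij_betw_def extensional_def)
  show "finite (cards d \<rightarrow>\<^sub>E hypercube d)" by (auto intro!: finite_PiE)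
qed

lemma card_arrangements: "card (arrangements d) = fact (2 ^ d)"
proof -
  have "card (cards d) = card (hypercube d)" by (simp add: cards_def card_hypercube)
  then obtain e where e: "bij_betw e (cards d) (hypercube d)"
    using finite_same_card_bij[of "cards d" "hypercube d"] by auto
  have "bij_betw (\<lambda>p. restrict (e \<circ> p) (cards d)) {p. p permutes cards d} (arrangements d)"
  proof (rule bij_betw_byWitness[where f' = "\<lambda>x k. if k \<in> cards d then inv_into (cards d) e (x k) else k"])
    show "\<forall>p\<in>{p. p permutes cards d}. (\<lambda>k. if k \<in> cards d
        then inv_into (cards d) e (restrict (e \<circ> p) (cards d) k) else k) = p"
      using e by (auto simp: fun_eq_iff bij_betw_def permutes_in_image permutes_not_in)
    show "\<forall>x\<in>arrangements d. restrict (e \<circ> (\<lambda>k. if k \<in> cards d then inv_into (cards d) e (x k) else k)) (cards d) = x"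
    proof
      fix x assume x: "x \<in> arrangements d"
      show "restrict (e \<circ> (\<lambda>k. if k \<in> cards d then inv_into (cards d) e (x k) else k)) (cards d) = x"
      proof
        fix k
        show "restrict (e \<circ> (\<lambda>k. if k \<in> cards d then inv_into (cards d) e (x k) else k)) (cards d) k = x k"
          using x e by (cases "k \<in> cards d") (auto simp: arrangements_def bij_betw_def extensional_def intro!: f_inv_into_f)
      qed
    qed
    show "(\<lambda>p. restrict (e \<circ> p) (cards d)) ` {p. p permutes cards d} \<subseteq> arrangements d"
    proof clarify
      fix p assume "p permutes cards d"
      then have "bij_betw (e \<circ> p) (cards d) (hypercube d)"
        using e by (intro bij_betw_trans[of p _ "cards d"] permutes_imp_bij)
      then show "restrict (e \<circ> p) (cards d) \<in> arrangements d"
        by (simp add: arrangements_def bij_betw_restrict_eq)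
    qed
    show "(\<lambda>x k. if k \<in> cards d then inv_into (cards d) e (x k) else k) ` arrangements d \<subseteq> {p. p permutes cards d}"
    proof clarify
      fix x assume "x \<in> arrangements d"
      then have "bij_betw (inv_into (cards d) e \<circ> x) (cards d) (cards d)"
        by (rule bij_betw_trans[OF arrangement_bij bij_betw_inv_into[OF e]])
      moreover have "bij_betw (inv_into (cards d) e \<circ> x) (cards d) (cards d)
         = bij_betw (\<lambda>k. if k \<in> cards d then inv_into (cards d) e (x k) else k) (cards d) (cards d)"
        by (rule bij_betw_cong) simp
      ultimately have "bij_betw (\<lambda>k. if k \<in> cards d then inv_into (cards d) e (x k) else k) (cards d) (cards d)"
        by simp
      then show "(\<lambda>k. if k \<in> cards d then inv_into (cards d) e (x k) else k) permutes cards d"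
        by (rule bij_imp_permutes) auto
    qed
  qed
  then have "card {p. p permutes cards d} = card (arrangements d)" by (rule bij_betw_same_card)
  moreover have "card {p. p permutes cards d} = fact (2 ^ d)" by (rule card_permutations) (auto simp: cards_def)
  ultimately show ?thesis by simp
qed

definition adj :: "nat \<Rightarrow> nat \<Rightarrow> (nat \<Rightarrow> nat \<Rightarrow> nat) \<Rightarrow> (nat \<Rightarrow> nat \<Rightarrow> nat) \<Rightarrow> bool" where
  "adj d j x y \<longleftrightarrow> (\<forall>k\<in>cards d. y k = x k \<or> y k = flip j (x k))"

lemma arrangement_in: "x \<in> arrangements d \<Longrightarrow> k \<in> cards d \<Longrightarrow> x k \<in> hypercube d"
  using arrangement_bij by (auto simp: bij_betw_def)

lemma arrangement_inj: "x \<in> arrangements d \<Longrightarrow> k \<in> cards d \<Longrightarrow> k' \<in> cards d \<Longrightarrow> x k = x k' \<Longrightarrow> k = k'"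
  using arrangement_bij by (auto simp: bij_betw_def dest: inj_onD)

lemma arrangement_onto:
  assumes "x \<in> arrangements d" "v \<in> hypercube d"
  obtains k where "k \<in> cards d" "x k = v"
proof -
  have "v \<in> x ` cards d" using bij_betw_imp_surj_on[OF arrangement_bij[OF assms(1)]] assms(2) by simp
  then show thesis using that by (elim imageE) simp
qed

lemma adj_sym:
  assumes "x \<in> arrangements d" "j \<in> {1..d}" "adj d j x y"
  shows "adj d j y x"
  using assms flip_flip[OF arrangement_in[OF assms(1)] assms(2)] unfolding adj_def by metis

lemma interchange_adj: "adj d j x (interchange d j c x)"
  by (auto simp: adj_def interchange_def)

lemma edge_flip: "v \<in> hypercube d \<Longrightarrow> j \<in> {1..d} \<Longrightarrow> {flip j v, flip j (flip j v)} = {v, flip j v}"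
  by (auto simp: flip_flip)

lemma interchange_arrangement:
  assumes x: "x \<in> arrangements d" and j: "j \<in> {1..d}"
  shows "interchange d j c x \<in> arrangements d"
proof -
  let ?y = "interchange d j c x"
  have "inj_on ?y (cards d)"
  proof (rule inj_onI)
    fix k k' assume k: "k \<in> cards d" "k' \<in> cards d" and eq: "?y k = ?y k'"
    have v: "x k \<in> hypercube d" "x k' \<in> hypercube d" using arrangement_in[OF x] k by auto
    have "x k = x k'"
    proof (rule ccontr)
      assume ne: "x k \<noteq> x k'"
      have "x k' = flip j (x k)"
        using eq k ne flip_flip[OF v(1) j] flip_flip[OF v(2) j]
        by (auto simp: interchange_def split: if_splits)
      then show False using eq k ne edge_flip[OF v(1) j] flip_flip[OF v(1) j]
        by (auto simp: interchange_def split: if_splits)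
    qed
    then show "k = k'" using arrangement_inj[OF x k] by simp
  qed
  moreover have "?y ` cards d \<subseteq> hypercube d"
    using arrangement_in[OF x] flip_in_hypercube[OF _ j] by (auto simp: interchange_def)
  moreover have "card (?y ` cards d) = card (hypercube d)"
    using calculation by (simp add: card_image card_hypercube cards_def)
  ultimately have "bij_betw ?y (cards d) (hypercube d)"
    by (simp add: bij_betw_def card_subset_eq)
  then show ?thesis by (simp add: arrangements_def interchange_def)
qed

lemma edges_eq:
  assumes j: "j \<in> {1..d}"
  shows "edges d j = (\<lambda>v. {v, flip j v}) ` {v \<in> hypercube d. v j = 0}"
proof (intro equalityI subsetI)
  fix e assume "e \<in> edges d j"
  then obtain u v where e: "e = {u, v}" and uv: "u \<in> hypercube d" "v \<in> hypercube d"
      "{i \<in> {1..d}. u i \<noteq> v i} = {j}"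
    by (auto simp: edges_def)
  have v: "v = flip j u"
  proof
    fix i
    show "v i = flip j u i"
    proof (cases "i = j")
      case True
      have "u j \<noteq> v j" using uv(3) by auto
      then show ?thesis using True vertex_bit[OF uv(1) j] vertex_bit[OF uv(2) j]
        by (cases "u j = 0"; cases "v j = 0") (auto simp: flip_same)
    next
      case False
      then show ?thesis using uv by (cases "i \<in> {1..d}") (auto simp: hypercube_iff extensional_def)
    qed
  qed
  show "e \<in> (\<lambda>v. {v, flip j v}) ` {v \<in> hypercube d. v j = 0}"
  proof (cases "u j = 0")
    case True
    then show ?thesis using e v uv by auto
  next
    case False
    then have "v j = 0" using v vertex_bit[OF uv(1) j] by (simp add: flip_same)
    moreover have "u = flip j v" using v flip_flip[OF uv(1) j] by simp
    ultimately show ?thesis using e uv by (auto simp: image_iff insert_commute)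
  qed
next
  fix e assume "e \<in> (\<lambda>v. {v, flip j v}) ` {v \<in> hypercube d. v j = 0}"
  then obtain v where v: "v \<in> hypercube d" "v j = 0" "e = {v, flip j v}" by auto
  have "{i \<in> {1..d}. v i \<noteq> flip j v i} = {j}" using j v(2) by (auto simp: flip_def)
  then show "e \<in> edges d j" using v flip_in_hypercube[OF v(1) j] by (auto simp: edges_def)
qed

lemma edge_in: "v \<in> hypercube d \<Longrightarrow> j \<in> {1..d} \<Longrightarrow> {v, flip j v} \<in> edges d j"
proof -
  assume v: "v \<in> hypercube d" and j: "j \<in> {1..d}"
  have "{i \<in> {1..d}. v i \<noteq> flip j v i} = {j}"
  proof -
    have "v j \<noteq> flip j v j" using vertex_bit[OF v j] by (cases "v j = 0") (auto simp: flip_same)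
    moreover have "v i = flip j v i" if "i \<noteq> j" for i using that by simp
    ultimately show ?thesis using j by blast
  qed
  then show ?thesis using v flip_in_hypercube[OF v j] unfolding edges_def by blast
qed

lemma card_edges: "j \<in> {1..d} \<Longrightarrow> card (edges d j) = 2 ^ (d - 1)"
proof -
  assume j: "j \<in> {1..d}"
  have "inj_on (\<lambda>v. {v, flip j v}) {v \<in> hypercube d. v j = 0}"
    by (rule inj_onI) (metis (mono_tags, lifting) doubleton_eq_iff flip_same mem_Collect_eq diff_zero zero_neq_one)
  then show ?thesis by (simp add: edges_eq[OF j] card_image card_coordinate_zero[OF j])
qed

lemma finite_edges: "j \<in> {1..d} \<Longrightarrow> finite (edges d j)"
  by (simp add: edges_eq)

text \<open>Different coin vectors give different outcomes, so each reachable arrangement comes from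
  exactly one of \<open>2 ^ (2 ^ (d - 1))\<close> equally likely vectors. This turns probabilities
  into path counts.\<close>

lemma kernel_value:
  assumes x: "x \<in> arrangements d" and y: "y \<in> arrangements d" and j: "j \<in> {1..d}"
  shows "kernel d j x y = (if adj d j x y then 1 / 2 ^ (2 ^ (d - 1)) else 0)"
proof -
  let ?p = "Pi_pmf (edges d j) False (\<lambda>_. bernoulli_pmf (1 / 2 :: real))"
  have set: "set_pmf ?p = {c. \<forall>e. e \<notin> edges d j \<longrightarrow> \<not> c e}"
    by (subst set_Pi_pmf[OF finite_edges[OF j]]) (auto simp: PiE_dflt_def)
  have pmf: "pmf ?p c = 1 / 2 ^ (2 ^ (d - 1))" if "c \<in> set_pmf ?p" for c
  proof -
    have "pmf ?p c = (\<Prod>e\<in>edges d j. pmf (bernoulli_pmf (1 / 2)) (c e))"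
      using that by (intro pmf_Pi' finite_edges[OF j]) (auto simp: set)
    also have "\<dots> = (\<Prod>e\<in>edges d j. 1 / 2)"
    proof (rule prod.cong[OF refl])
      fix e show "pmf (bernoulli_pmf (1 / 2)) (c e) = 1 / 2" by (cases "c e") auto
    qed
    finally show ?thesis by (simp add: card_edges[OF j] power_divide)
  qed
  have inj: "inj_on (\<lambda>c. interchange d j c x) (set_pmf ?p)"
  proof (rule inj_onI)
    fix c c' assume cc: "c \<in> set_pmf ?p" "c' \<in> set_pmf ?p" and eq: "interchange d j c x = interchange d j c' x"
    show "c = c'"
    proof
      fix e
      show "c e = c' e"
      proof (cases "e \<in> edges d j")
        case True
        then obtain v where v: "v \<in> hypercube d" "e = {v, flip j v}" by (auto simp: edges_eq[OF j])
        obtain k where k: "k \<in> cards d" "x k = v" using arrangement_onto[OF x v(1)] .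
        have "interchange d j c x k = interchange d j c' x k" using eq by simp
        then show ?thesis using k v(2) flip_neq[of j v] by (auto simp: interchange_def split: if_splits)
      next
        case False
        then show ?thesis using cc by (auto simp: set)
      qed
    qed
  qed
  show ?thesis
  proof (cases "adj d j x y")
    case True
    \<comment> \<open>The coins are read off from the outcome: an edge was interchanged iff a card
      on it moved. Outside \<open>edges d j\<close> the value is \<open>False\<close>, the default
      of \<open>Pi_pmf\<close>.\<close>
    define c where "c e \<longleftrightarrow> e \<in> edges d j \<and> (\<exists>k\<in>cards d. x k \<in> e \<and> y k \<noteq> x k)" for e
    have "y = interchange d j c x"
    proof
      fix k
      show "y k = interchange d j c x k"
      proof (cases "k \<in> cards d")
        case k: True
        have v: "x k \<in> hypercube d" using arrangement_in[OF x k] .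
        have "c {x k, flip j (x k)} \<longleftrightarrow> y k \<noteq> x k"
        proof
          assume "c {x k, flip j (x k)}"
          then obtain k' where k': "k' \<in> cards d" "x k' = x k \<or> x k' = flip j (x k)" "y k' \<noteq> x k'"
            by (auto simp: c_def)
          show "y k \<noteq> x k"
          proof
            assume yk: "y k = x k"
            have "x k' = flip j (x k)" using k' yk arrangement_inj[OF x k'(1) k] by auto
            moreover from this have "y k' = x k"
              using True k' flip_flip[OF v j] by (auto simp: adj_def)
            ultimately show False using yk arrangement_inj[OF y k'(1) k] flip_neq[of j "x k"] by auto
          qed
        next
          assume "y k \<noteq> x k"
          then show "c {x k, flip j (x k)}" using k edge_in[OF v j] by (auto simp: c_def)
        qed
        then show ?thesis using True k by (auto simp: interchange_def adj_def)
      next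
        case False
        then show ?thesis using y by (simp add: interchange_def arrangements_def extensional_def)
      qed
    qed
    moreover have "c \<in> set_pmf ?p" unfolding set by (auto simp: c_def)
    ultimately show ?thesis
      using pmf_map_inj[OF inj] pmf True by (simp add: kernel_def kernel_pmf_def)
  next
    case False
    then have "y \<notin> (\<lambda>c. interchange d j c x) ` set_pmf ?p" using interchange_adj[of d j x] by blast
    then show ?thesis using False by (simp add: kernel_def kernel_pmf_def pmf_map_outside)
  qed
qed

lemma kernel_sum:
  assumes "x \<in> arrangements d" "j \<in> {1..d}"
  shows "(\<Sum>y\<in>arrangements d. kernel d j x y) = 1"
  unfolding kernel_def using interchange_arrangement[OF assms]
  by (intro sum_pmf_eq_1) (auto simp: kernel_pmf_def)

lemma kernel_sym:
  assumes "x \<in> arrangements d" "y \<in> arrangements d" "j \<in> {1..d}"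
  shows "kernel d j x y = kernel d j y x"
  using adj_sym[OF assms(1,3), of y] adj_sym[OF assms(2,3), of x]
  by (auto simp: kernel_value[OF assms] kernel_value[OF assms(2,1,3)])

section \<open>Path counting and the mixing time\<close>


text \<open>\<open>moved\<close> is the coin of an edge: its two cards cannot end at the same
  vertex, so they move together. The inverse arrangements name the card at each vertex, as the round
  model requires.\<close>

lemma adj_inverse:
  assumes a: "a \<in> arrangements d" and b: "b \<in> arrangements d" and j: "j \<in> {1..d}" and adj: "adj d j a b"
    and v: "v \<in> hypercube d"
  defines "moved \<equiv> \<lambda>u. b (inv_into (cards d) a u) \<noteq> u"
  shows "moved (flip j v) = moved v"
    and "inv_into (cards d) b v = inv_into (cards d) a (if moved v then flip j v else v)"
proof -
  have inv: "inv_into (cards d) x u \<in> cards d" "x (inv_into (cards d) x u) = u"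
    if "x \<in> arrangements d" "u \<in> hypercube d" for x u
    using that arrangement_bij[OF that(1)] by (auto simp: bij_betw_def inv_into_into f_inv_into_f)
  have fv: "flip j v \<in> hypercube d" using flip_in_hypercube[OF v j] .
  have ff: "flip j (flip j v) = v" using flip_flip[OF v j] .
  define k k' where "k = inv_into (cards d) a v" and "k' = inv_into (cards d) a (flip j v)"
  have k: "k \<in> cards d" "a k = v" "k' \<in> cards d" "a k' = flip j v"
    using inv[OF a v] inv[OF a fv] by (simp_all add: k_def k'_def)
  have bk: "b k = v \<or> b k = flip j v" "b k' = flip j v \<or> b k' = v"
    using adj k ff by (auto simp: adj_def)
  have "k \<noteq> k'" using k flip_neq[of j v] by auto
  then have ne: "b k \<noteq> b k'" using arrangement_inj[OF b k(1,3)] by auto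
  show 1: "moved (flip j v) = moved v"
    using bk ne flip_neq[of j v] by (auto simp: moved_def simp flip: k_def k'_def)
  have eqI: "inv_into (cards d) b v = l" if "l \<in> cards d" "b l = v" for l
    using arrangement_inj[OF b inv(1)[OF b v] that(1)] inv(2)[OF b v] that(2) by simp
  show "inv_into (cards d) b v = inv_into (cards d) a (if moved v then flip j v else v)"
  proof (cases "moved v")
    case True
    then have "b k \<noteq> v" by (simp add: moved_def k_def)
    then have "b k' = v" using bk ne by auto
    then show ?thesis using True eqI[OF k(3)] by (simp add: k'_def)
  next
    case False
    then have "b k = v" by (simp add: moved_def k_def)
    then show ?thesis using False eqI[OF k(1)] by (simp add: k_def)
  qed
qed

lemma arrangement_eqI:
  assumes a: "a \<in> arrangements d" and b: "b \<in> arrangements d"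
    and eq: "\<And>v. v \<in> hypercube d \<Longrightarrow> inv_into (cards d) a v = inv_into (cards d) b v"
  shows "a = b"
proof
  fix k
  show "a k = b k"
  proof (cases "k \<in> cards d")
    case True
    have v: "a k \<in> hypercube d" using arrangement_in[OF a True] .
    have "inv_into (cards d) a (a k) = k"
      using arrangement_bij[OF a] True by (simp add: bij_betw_def)
    then have "b k = b (inv_into (cards d) b (a k))" using eq[OF v] by simp
    also have "\<dots> = a k" using arrangement_bij[OF b] v by (simp add: bij_betw_def f_inv_into_f)
    finally show ?thesis by simp
  next
    case False
    then show ?thesis using a b by (simp add: arrangements_def extensional_def)
  qed
qed

text \<open>All of these paths are equally likely, so conditioning the chain on a set of them gives
  the uniform law on that set.\<close>

definition paths :: "nat \<Rightarrow> nat \<Rightarrow> (nat \<Rightarrow> nat \<Rightarrow> nat) \<Rightarrow> (nat \<Rightarrow> nat \<Rightarrow> nat \<Rightarrow> nat) set" where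
  "paths d n x = {p \<in> {..n} \<rightarrow>\<^sub>E arrangements d. p 0 = x \<and> (\<forall>i<n. adj d (i mod d + 1) (p i) (p (Suc i)))}"

lemma finite_paths [simp]: "finite (paths d n x)"
  by (rule finite_subset[of _ "{..n} \<rightarrow>\<^sub>E arrangements d"]) (auto simp: paths_def intro!: finite_PiE)

lemma paths_arr: "p \<in> paths d n x \<Longrightarrow> i \<le> n \<Longrightarrow> p i \<in> arrangements d"
  by (auto simp: paths_def PiE_iff)

lemma paths_adj: "p \<in> paths d n x \<Longrightarrow> i < n \<Longrightarrow> adj d (i mod d + 1) (p i) (p (Suc i))"
  by (auto simp: paths_def)

lemma card_paths_Suc:
  assumes y: "y \<in> arrangements d"
  shows "card {p \<in> paths d (Suc n) x. p (Suc n) = y}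
     = (\<Sum>z\<in>arrangements d. if adj d (n mod d + 1) z y then card {p \<in> paths d n x. p n = z} else 0)"
proof -
  let ?A = "{p \<in> paths d (Suc n) x. p (Suc n) = y}" and ?B = "{q \<in> paths d n x. adj d (n mod d + 1) (q n) y}"
  have "bij_betw (\<lambda>p. restrict p {..n}) ?A ?B"
  proof (rule bij_betw_byWitness[where f' = "\<lambda>q. q(Suc n := y)"])
    show "\<forall>p\<in>?A. (restrict p {..n})(Suc n := y) = p"
      by (auto simp: fun_eq_iff paths_def PiE_iff extensional_def le_Suc_eq)
    show "\<forall>q\<in>?B. restrict (q(Suc n := y)) {..n} = q"
      by (auto simp: fun_eq_iff paths_def PiE_iff extensional_def)
    show "(\<lambda>p. restrict p {..n}) ` ?A \<subseteq> ?B"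
      by (auto simp: paths_def PiE_iff)
    show "(\<lambda>q. q(Suc n := y)) ` ?B \<subseteq> ?A"
      using y by (auto simp: paths_def PiE_iff extensional_def less_Suc_eq le_Suc_eq)
  qed
  then have "card ?A = card ?B" by (rule bij_betw_same_card)
  also have "?B = (\<Union>z\<in>{z \<in> arrangements d. adj d (n mod d + 1) z y}. {p \<in> paths d n x. p n = z})"
    using paths_arr[of _ d n x n] by auto
  also have "card \<dots> = (\<Sum>z\<in>{z \<in> arrangements d. adj d (n mod d + 1) z y}. card {p \<in> paths d n x. p n = z})"
    by (rule card_UN_disjoint) auto
  also have "\<dots> = (\<Sum>z\<in>arrangements d. if adj d (n mod d + 1) z y then card {p \<in> paths d n x. p n = z} else 0)"
    by (simp add: sum.inter_filter)
  finally show ?thesis .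
qed

lemma step_index: "(d :: nat) \<ge> 1 \<Longrightarrow> n mod d + 1 \<in> {1..d}"
  using mod_less_divisor[of d n] by (auto simp: Suc_le_eq)

lemma thorp_prob_count:
  assumes d: "d \<ge> 1" and x: "x \<in> arrangements d" and y: "y \<in> arrangements d"
  shows "thorp_prob d n x y = card {p \<in> paths d n x. p n = y} / (2 ^ (2 ^ (d - 1))) ^ n"
  using y
proof (induction n arbitrary: y)
  case 0
  have "{p \<in> paths d 0 x. p 0 = y} = (if x = y then {restrict (\<lambda>_. x) {..0}} else {})"
    using x by (auto simp: paths_def PiE_iff fun_eq_iff extensional_def)
  then show ?case by simp
next
  case (Suc n)
  let ?Q = "2 ^ (2 ^ (d - 1)) :: real"
  have "thorp_prob d (Suc n) x y = (\<Sum>z\<in>arrangements d.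
      real (card {p \<in> paths d n x. p n = z}) / ?Q ^ n * (if adj d (n mod d + 1) z y then 1 / ?Q else 0))"
    using Suc step_index[OF d] by (simp add: kernel_value)
  also have "\<dots> = (\<Sum>z\<in>arrangements d.
      real (if adj d (n mod d + 1) z y then card {p \<in> paths d n x. p n = z} else 0)) / ?Q ^ Suc n"
    unfolding sum_divide_distrib by (intro sum.cong) (auto simp: field_simps)
  finally show ?case by (simp add: card_paths_Suc[OF Suc.prems])
qed

section \<open>Double stochasticity and composition of transition probabilities\<close>

lemma thorp_prob_nonneg: "thorp_prob d n x y \<ge> 0"
  by (induction n arbitrary: y) (auto intro!: sum_nonneg mult_nonneg_nonneg simp: kernel_def)

lemma thorp_prob_row_sum:
  assumes d: "d \<ge> 1" and x: "x \<in> arrangements d"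
  shows "(\<Sum>y\<in>arrangements d. thorp_prob d n x y) = 1"
proof (induction n)
  case 0
  then show ?case using x by simp
next
  case (Suc n)
  have "(\<Sum>y\<in>arrangements d. thorp_prob d (Suc n) x y)
     = (\<Sum>z\<in>arrangements d. thorp_prob d n x z * (\<Sum>y\<in>arrangements d. kernel d (n mod d + 1) z y))"
    unfolding thorp_prob.simps sum_distrib_left by (rule sum.swap)
  also have "\<dots> = 1" using Suc kernel_sum[OF _ step_index[OF d]] by simp
  finally show ?case .
qed

lemma thorp_prob_col_sum:
  assumes d: "d \<ge> 1" and y: "y \<in> arrangements d"
  shows "(\<Sum>x\<in>arrangements d. thorp_prob d n x y) = 1"
  using y
proof (induction n arbitrary: y)
  case 0
  then show ?case by simp
next
  case (Suc n)
  note j = step_index[OF d, of n]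
  have "(\<Sum>x\<in>arrangements d. thorp_prob d (Suc n) x y)
     = (\<Sum>z\<in>arrangements d. (\<Sum>x\<in>arrangements d. thorp_prob d n x z) * kernel d (n mod d + 1) z y)"
    unfolding thorp_prob.simps sum_distrib_right by (rule sum.swap)
  also have "\<dots> = (\<Sum>z\<in>arrangements d. kernel d (n mod d + 1) y z)"
    using Suc.IH by (intro sum.cong) (simp_all only: mult_1 kernel_sym[OF _ Suc.prems j])
  also have "\<dots> = 1" by (rule kernel_sum[OF Suc.prems j])
  finally show ?case .
qed

text \<open>The intermediate time is a multiple of \<open>d\<close>, so the cycle of kernels starts
  afresh there.\<close>

lemma chapman_kolmogorov:
  assumes y: "y \<in> arrangements d"
  shows "thorp_prob d (m * d + n) x y = (\<Sum>z\<in>arrangements d. thorp_prob d (m * d) x z * thorp_prob d n z y)"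
  using y
proof (induction n arbitrary: y)
  case 0
  then show ?case by (simp add: if_distrib cong: if_cong)
next
  case (Suc n)
  have "thorp_prob d (m * d + Suc n) x y
     = (\<Sum>w\<in>arrangements d. (\<Sum>z\<in>arrangements d. thorp_prob d (m * d) x z * thorp_prob d n z w) * kernel d (n mod d + 1) w y)"
    using Suc.IH by simp
  also have "\<dots> = (\<Sum>z\<in>arrangements d. thorp_prob d (m * d) x z * (\<Sum>w\<in>arrangements d. thorp_prob d n z w * kernel d (n mod d + 1) w y))"
    unfolding sum_distrib_left sum_distrib_right by (subst sum.swap) (simp add: mult.assoc)
  finally show ?case by simp
qed

lemma card_paths:
  assumes d: "d \<ge> 1" and x: "x \<in> arrangements d"
  shows "real (card (paths d n x)) = (2 ^ (2 ^ (d - 1))) ^ n"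
proof -
  have "paths d n x = (\<Union>y\<in>arrangements d. {p \<in> paths d n x. p n = y})"
    using paths_arr[of _ d n x n] by auto
  also have "card \<dots> = (\<Sum>y\<in>arrangements d. card {p \<in> paths d n x. p n = y})"
    by (rule card_UN_disjoint) auto
  finally have "real (card (paths d n x)) = (\<Sum>y\<in>arrangements d. real (card {p \<in> paths d n x. p n = y}))"
    by simp
  also have "\<dots> = (\<Sum>y\<in>arrangements d. thorp_prob d n x y * (2 ^ (2 ^ (d - 1))) ^ n)"
    using d x by (intro sum.cong) (auto simp: thorp_prob_count)
  also have "\<dots> = (2 ^ (2 ^ (d - 1))) ^ n"
    unfolding sum_distrib_right[symmetric] using thorp_prob_row_sum[OF d x] by simp
  finally show ?thesis .
qed

text \<open>The round model assumes neither independent nor fair coins, so every nonempty set of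
  paths qualifies. The coin of a step is read off from two consecutive arrangements.\<close>

lemma thorp_round_paths:
  assumes d: "d \<ge> 1" and S: "S \<subseteq> paths d (m * d) x" "S \<noteq> {}" and i: "i < m"
  shows "thorp_round d S (\<lambda>s p. inv_into (cards d) (p (i * d + s)))
     (\<lambda>s p v. p (i * d + s) (inv_into (cards d) (p (i * d + s - 1)) v) \<noteq> v)"
proof
  show "finite S" using S(1) by (rule finite_subset) simp
  show "S \<noteq> {}" "1 \<le> d" using S d by auto
  have le: "i * d + s \<le> m * d" if "s \<le> d" for s
  proof -
    have "i * d + d \<le> m * d" using i mult_le_mono1[of "Suc i" m d] by simp
    then show ?thesis using that by simp
  qed
  have arr: "p (i * d + s) \<in> arrangements d" if "p \<in> S" "s \<le> d" for p s
    using that S le by (auto intro: paths_arr)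
  have adj: "adj d (Suc s) (p (i * d + s)) (p (i * d + Suc s))" if "p \<in> S" "s < d" for p s
  proof -
    have "i * d + s < m * d" using le[of "Suc s"] that by simp
    then have "adj d ((i * d + s) mod d + 1) (p (i * d + s)) (p (Suc (i * d + s)))"
      using that S by (intro paths_adj) auto
    then show ?thesis using that by simp
  qed
  fix p s v
  assume p: "p \<in> S"
  show "bij_betw (inv_into (cards d) (p (i * d + s))) (hypercube d) (cards d)" if "s \<le> d"
    using arr[OF p that] by (intro bij_betw_inv_into arrangement_bij)
  show "(p (i * d + s) (inv_into (cards d) (p (i * d + s - 1)) (flip s v)) \<noteq> flip s v)
      = (p (i * d + s) (inv_into (cards d) (p (i * d + s - 1)) v) \<noteq> v)"
    if s: "s \<in> {1..d}" and v: "v \<in> hypercube d"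
  proof -
    obtain s' where s': "s = Suc s'" using s by (cases s) auto
    show ?thesis
      using adj_inverse(1)[OF arr[OF p, of s'] arr[OF p, of s] s _ v] adj[OF p, of s'] s s' by simp
  qed
  show "inv_into (cards d) (p (i * d + Suc s)) v = inv_into (cards d) (p (i * d + s))
        (if p (i * d + Suc s) (inv_into (cards d) (p (i * d + Suc s - 1)) v) \<noteq> v then flip (Suc s) v else v)"
    if s: "s < d" and v: "v \<in> hypercube d"
    using adj_inverse(2)[OF arr[OF p, of s] arr[OF p, of "Suc s"] _ adj[OF p s] v] s by simp
qed

text \<open>The entropy of the path rises from 0 to \<open>ln (card S)\<close>, and a round adds at
  most the entropy of its coins, that is the full value minus \<open>\<kappa>\<close>. So the costs
  sum to at most the logarithm of the ratio of all paths to those in \<open>S\<close>.\<close>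

lemma round_costs:
  assumes d: "d \<ge> 1" and x: "x \<in> arrangements d" and S: "S \<subseteq> paths d (m * d) x" "S \<noteq> {}"
  defines "D \<equiv> \<lambda>i. ln (fact (2 ^ d)) - entr S (\<lambda>p. p (i * d))"
  obtains \<kappa> where "\<And>i. i < m \<Longrightarrow> 0 \<le> \<kappa> i" "\<And>i. i < m \<Longrightarrow> D (Suc i) \<le> D i + \<kappa> i"
    "\<And>i. i < m \<Longrightarrow> D (Suc i) \<le> (1 - 1 / (288 * real d ^ 2)) * D i + 3 * real d * \<kappa> i"
    "(\<Sum>i<m. \<kappa> i) \<le> real (m * (d * 2 ^ (d - 1))) * ln 2 - ln (real (card S))"
proof -
  define Yf where "Yf i = (\<lambda>s (p :: nat \<Rightarrow> nat \<Rightarrow> nat \<Rightarrow> nat). inv_into (cards d) (p (i * d + s)))" for i :: nat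
  define cf where "cf i = (\<lambda>s (p :: nat \<Rightarrow> nat \<Rightarrow> nat \<Rightarrow> nat) v. p (i * d + s) (inv_into (cards d) (p (i * d + s - 1)) v) \<noteq> v)" for i :: nat
  define cost where "cost i = thorp_round.\<kappa> d S (Yf i) (cf i)" for i
  define E where "E i = entr S (\<lambda>p. restrict p {..i * d})" for i
  have finS: "finite S" using S(1) by (rule finite_subset) simp
  have main: "0 \<le> cost i \<and> D (Suc i) \<le> D i + cost i \<and>
      D (Suc i) \<le> (1 - 1 / (288 * real d ^ 2)) * D i + 3 * real d * cost i \<and>
      E (Suc i) \<le> E i + (real (d * 2 ^ (d - 1)) * ln 2 - cost i)" if i: "i < m" for i
  proof -
    interpret thorp_round d S "Yf i" "cf i"
      unfolding Yf_def cf_def using thorp_round_paths[OF d S i] .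
    have le: "i * d + s \<le> m * d" if "s \<le> d" for s
    proof -
      have "i * d + d \<le> m * d" using i mult_le_mono1[of "Suc i" m d] by simp
      then show ?thesis using that by simp
    qed
    have arr: "p (i * d + s) \<in> arrangements d" if "p \<in> S" "s \<le> d" for p s
      using that S le by (auto intro: paths_arr)
    have Yf_eq: "Yf i s p v = inv_into (cards d) (p (i * d + s)) v" for s p v by (simp add: Yf_def)
    have same: "p (i * d + s) = p' (i * d + s) \<longleftrightarrow> cont s V p = cont s V p'"
      if "p \<in> S" "p' \<in> S" "s \<le> d" for p p' s
      unfolding cont_eq_iff Yf_eq using arrangement_eqI[OF arr[OF that(1,3)] arr[OF that(2,3)]] by auto
    have def: "deficit s = ln (fact (2 ^ d)) - entr S (\<lambda>p. p (i * d + s))" if "s \<le> d" for s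
    proof -
      have "entr S (cont s V) = entr S (\<lambda>p. p (i * d + s))"
        by (rule entr_eq[OF finS]) (use same that in blast)
      then show ?thesis by (simp add: deficit_def)
    qed
    have D: "D i = deficit 0" "D (Suc i) = deficit d"
      using def[of 0] def[of d] by (simp_all add: D_def add.commute)
    have kappa: "cost i = real (card (coin_sites d)) * ln 2 - centr S (coins (coin_sites d)) (cont 0 V)"
      by (simp add: cost_def \<kappa>_def)
    have "E (Suc i) \<le> entr S (\<lambda>p. (coins (coin_sites d) p, restrict p {..i * d}))"
      unfolding E_def
    proof (rule entr_mono[OF finS])
      fix p p' assume p: "p \<in> S" "p' \<in> S"
        and eq: "(coins (coin_sites d) p, restrict p {..i * d}) = (coins (coin_sites d) p', restrict p' {..i * d})"
      have ag: "agree d V p p'"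
        using eq by (intro agree_coins[OF closed_upto_V p, of d "coin_sites d"]) (auto simp: in_coin_sites)
      have low: "p t = p' t" if "t \<le> i * d" for t
        using eq that unfolding prod.inject restrict_eq_iff by auto
      have "cont 0 V p = cont 0 V p'" using same[OF p, of 0] low[of "i * d"] by simp
      then have "\<forall>v\<in>V. Yf i 0 p v = Yf i 0 p' v" by (simp add: cont_eq_iff)
      then have Ys: "cont s V p = cont s V p'" if "s \<le> d" for s
        using Y_agree[OF ag closed_upto_V p] that by (auto simp: cont_eq_iff)
      have "p t = p' t" if t: "t \<le> Suc i * d" for t
      proof (cases "t \<le> i * d")
        case False
        then obtain s where s: "t = i * d + s" using le_Suc_ex[of "i * d" t] by auto
        then have "s \<le> d" using t by simp
        then show ?thesis using same[OF p, of s] Ys[of s] s by simp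
      qed (rule low)
      then show "restrict p {..Suc i * d} = restrict p' {..Suc i * d}"
        unfolding restrict_eq_iff by simp
    qed
    also have "\<dots> = centr S (coins (coin_sites d)) (\<lambda>p. restrict p {..i * d}) + E i"
      by (simp add: centr_def E_def)
    also have "centr S (coins (coin_sites d)) (\<lambda>p. restrict p {..i * d}) \<le> centr S (coins (coin_sites d)) (cont 0 V)"
    proof (rule centr_anti[OF finS])
      fix p p' assume p: "p \<in> S" "p' \<in> S" and eq: "restrict p {..i * d} = restrict p' {..i * d}"
      then have "p (i * d) = p' (i * d)" unfolding restrict_eq_iff by auto
      then show "cont 0 V p = cont 0 V p'" using same[OF p, of 0] by simp
    qed
    finally have "E (Suc i) \<le> E i + (real (d * 2 ^ (d - 1)) * ln 2 - cost i)"
      unfolding kappa card_coin_sites by simp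
    moreover have "0 \<le> cost i" using \<kappa>_nonneg by (simp add: cost_def)
    moreover have "D (Suc i) \<le> D i + cost i" unfolding D using deficit_le by (simp add: cost_def)
    moreover have "D (Suc i) \<le> (1 - 1 / (288 * real d ^ 2)) * D i + 3 * real d * cost i"
      unfolding D using robust_contraction by (simp add: cost_def)
    ultimately show ?thesis by blast
  qed
  have "E n \<le> E 0 + real n * (real (d * 2 ^ (d - 1)) * ln 2) - (\<Sum>i<n. cost i)" if "n \<le> m" for n
    using that
  proof (induction n)
    case (Suc n)
    then show ?case using main[of n] by (simp add: algebra_simps)
  qed simp
  from this[of m] have "(\<Sum>i<m. cost i) \<le> E 0 - E m + real (m * (d * 2 ^ (d - 1))) * ln 2" by simp
  moreover have "E 0 = 0"
    unfolding E_def
  proof (rule entr_const[OF finS])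
    fix p p' assume "p \<in> S" "p' \<in> S"
    then have "p 0 = x" "p' 0 = x" using S by (auto simp: paths_def)
    then show "restrict p {..0 * d} = restrict p' {..0 * d}" unfolding restrict_eq_iff by simp
  qed
  moreover have "E m = ln (real (card S))"
    unfolding E_def
  proof (rule entr_inj[OF finS], rule inj_onI)
    fix p p' assume p: "p \<in> S" "p' \<in> S" and eq: "restrict p {..m * d} = restrict p' {..m * d}"
    have "restrict p {..m * d} = p" "restrict p' {..m * d} = p'"
      using p S by (auto simp: paths_def PiE_restrict subset_iff)
    then show "p = p'" using eq by metis
  qed
  ultimately have "(\<Sum>i<m. cost i) \<le> real (m * (d * 2 ^ (d - 1))) * ln 2 - ln (real (card S))" by simp
  from that[OF _ _ _ this] main show thesis by blast
qed

text \<open>\<open>6912 * d ^ 4 = 4 * d * (2 * (3 * d) * (288 * d\<^sup>2))\<close>: the growth rate \<open>c / (2 * A)\<close> of \<open>bridge_cost\<close>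
  for \<open>c = 1 / (288 * d\<^sup>2)\<close> and \<open>A = 3 * d\<close> must act until \<open>(ln N!)\<^sup>2 \<le> 2 ^ (4 * d)\<close> is exceeded.\<close>

definition rounds :: "nat \<Rightarrow> nat" where "rounds d = 6912 * d ^ 4"

section \<open>Quantitative bounds and uniform mixing\<close>

lemma ln_fact_le: "ln (fact (2 ^ d) :: real) \<le> 2 ^ (2 * d)"
proof -
  let ?N = "2 ^ d :: nat"
  have "ln (fact ?N :: real) \<le> ln (real ?N ^ ?N)"
    using fact_le_power[of ?N] by (intro ln_mono) auto
  also have "\<dots> = real ?N * ln (real ?N)" by (simp add: ln_realpow)
  also have "\<dots> \<le> real ?N * real ?N"
    using ln_le_minus_one[of "real ?N"] by (intro mult_left_mono) auto
  also have "\<dots> = 2 ^ (2 * d)" by (simp add: power_mult power2_eq_square flip: power_mult_distrib power_add mult_2)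
  finally show ?thesis .
qed

lemma ln_fact_pos: "d \<ge> 1 \<Longrightarrow> ln (fact (2 ^ d) :: real) > 0"
proof -
  assume "d \<ge> 1"
  then have "(2::nat) ^ 1 \<le> 2 ^ d" by (intro power_increasing) auto
  then have "(2 :: real) \<le> real (fact (2 ^ d))"
    using fact_ge_self[of "2 ^ d"] by (metis numeral_le_real_of_nat_iff order.trans power_one_right)
  then show ?thesis by (simp add: ln_gt_zero)
qed

text \<open>Both endpoints are constant on the set \<open>S\<close> of paths from \<open>z\<close>
  to \<open>y\<close>, so the deficit equals \<open>\<Lambda>\<close> at both ends. The forced cost
  \<open>\<Lambda> - 1\<close> is at most minus the logarithm of the transition probability;
  exponentiate.\<close>

lemma density_bound:
  assumes d: "d \<ge> 1" and z: "z \<in> arrangements d" and y: "y \<in> arrangements d"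
  shows "thorp_prob d (rounds d * d) z y * fact (2 ^ d) \<le> exp 1"
proof -
  define m where "m = rounds d"
  define S where "S = {p \<in> paths d (m * d) z. p (m * d) = y}"
  define \<Lambda> where "\<Lambda> = ln (fact (2 ^ d) :: real)"
  define Q :: real where "Q = (2 ^ (2 ^ (d - 1))) ^ (m * d)"
  have p: "thorp_prob d (m * d) z y = card S / Q"
    unfolding S_def Q_def by (rule thorp_prob_count[OF d z y])
  show ?thesis
  proof (cases "S = {}")
    case True
    then show ?thesis using p by (simp add: m_def)
  next
    case False
    have sub: "S \<subseteq> paths d (m * d) z" by (auto simp: S_def)
    have finS: "finite S" using sub by (rule finite_subset) simp
    let ?D = "\<lambda>i. ln (fact (2 ^ d)) - entr S (\<lambda>p. p (i * d))"
    obtain \<kappa> where \<kappa>: "\<And>i. i < m \<Longrightarrow> 0 \<le> \<kappa> i" "\<And>i. i < m \<Longrightarrow> ?D (Suc i) \<le> ?D i + \<kappa> i"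
      "\<And>i. i < m \<Longrightarrow> ?D (Suc i) \<le> (1 - 1 / (288 * real d ^ 2)) * ?D i + 3 * real d * \<kappa> i"
      "(\<Sum>i<m. \<kappa> i) \<le> real (m * (d * 2 ^ (d - 1))) * ln 2 - ln (real (card S))"
      using round_costs[OF d z sub False] by blast
    have "entr S (\<lambda>p. p (0 * d)) = 0" "entr S (\<lambda>p. p (m * d)) = 0"
      by (rule entr_const[OF finS]; auto simp: S_def paths_def)+
    then have ends: "?D 0 = \<Lambda>" "?D m = \<Lambda>" by (simp_all add: \<Lambda>_def)
    have d1: "real d \<ge> 1" using d by simp
    have q: "1 / (288 * real d ^ 2) / (2 * (3 * real d)) = 1 / real (1728 * d ^ 3)"
      by (simp add: power2_eq_square power3_eq_cube)
    have "\<Lambda>\<^sup>2 \<le> (2 ^ (2 * d))\<^sup>2"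
      using ln_fact_le[of d] ln_fact_pos[OF d] by (intro power_mono) (auto simp: \<Lambda>_def)
    also have "\<dots> = 2 ^ (4 * d)" by (simp flip: power_mult)
    \<comment> \<open>Bernoulli's inequality gives \<open>(1 + 1 / k) ^ k \<ge> 2\<close> for
      \<open>k = 1728 * d ^ 3\<close>; \<open>4 * d\<close> such blocks make up the
      \<open>6912 * d ^ 4\<close> rounds.\<close>
    also have "\<dots> \<le> ((1 + 1 / real (1728 * d ^ 3)) ^ (1728 * d ^ 3)) ^ (4 * d)"
    proof (rule power_mono)
      have "1 + real (1728 * d ^ 3) * (1 / real (1728 * d ^ 3)) \<le> (1 + 1 / real (1728 * d ^ 3)) ^ (1728 * d ^ 3)"
      proof (rule Bernoulli_inequality)
        have "0 \<le> 1 / real (1728 * d ^ 3)" by simp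
        then show "- 1 \<le> 1 / real (1728 * d ^ 3)" by linarith
      qed
      then show "2 \<le> (1 + 1 / real (1728 * d ^ 3)) ^ (1728 * d ^ 3)" using d by simp
    qed simp
    also have "\<dots> = (1 + 1 / (288 * real d ^ 2) / (2 * (3 * real d))) ^ m"
      unfolding q power_mult[symmetric] by (simp add: m_def rounds_def power_numeral_reduce mult_ac)
    finally have long: "\<Lambda>\<^sup>2 \<le> (1 + 1 / (288 * real d ^ 2) / (2 * (3 * real d))) ^ m" .
    have "\<Lambda> - 1 \<le> (\<Sum>i<m. \<kappa> i)"
    proof (rule bridge_cost[where D = ?D and c = "1 / (288 * real d ^ 2)" and A = "3 * real d"])
      show "0 < \<Lambda>" using ln_fact_pos[OF d] by (simp add: \<Lambda>_def)
      have "1 \<le> real d ^ 2" using d1 by simp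
      then have "1 \<le> 288 * real d ^ 2" by linarith
      then show "1 / (288 * real d ^ 2) \<le> 1" "0 < 1 / (288 * real d ^ 2)"
        using d by (auto simp: divide_le_eq)
    qed (use \<kappa> ends long d1 in auto)
    also have "\<dots> \<le> ln Q - ln (real (card S))"
      using \<kappa>(4) by (simp add: Q_def ln_realpow mult_ac)
    also have "\<dots> = - ln (real (card S) / Q)"
      using finS False by (simp add: ln_div Q_def card_gt_0_iff)
    finally have "ln (real (card S) / Q) + \<Lambda> \<le> 1" by simp
    then have "exp (ln (real (card S) / Q) + \<Lambda>) \<le> exp 1" by simp
    moreover have "real (card S) / Q > 0" using finS False by (simp add: Q_def card_gt_0_iff)
    ultimately show ?thesis using p by (simp add: exp_add \<Lambda>_def m_def)
  qed
qed

text \<open>For the set of all paths the entropy budget leaves no room for costs, so every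
  \<open>\<kappa>\<close> vanishes and the deficit decays geometrically. The target is the square of
  \<open>1 / 24\<close>, as the final estimate wants.\<close>

lemma hellinger_bound:
  assumes d: "d \<ge> 1" and x: "x \<in> arrangements d"
  shows "(\<Sum>y\<in>arrangements d. (sqrt (thorp_prob d (rounds d * d) x y) - sqrt (1 / fact (2 ^ d)))\<^sup>2) \<le> 1 / 576"
proof -
  define m where "m = rounds d"
  define S where "S = paths d (m * d) x"
  define c where "c = 1 / (288 * real d ^ 2)"
  let ?D = "\<lambda>i. ln (fact (2 ^ d)) - entr S (\<lambda>p. p (i * d))"
  have cardS: "real (card S) = (2 ^ (2 ^ (d - 1))) ^ (m * d)" using card_paths[OF d x] by (simp add: S_def)
  then have "real (card S) \<noteq> 0" by simp
  then have Sne: "S \<noteq> {}" by auto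
  have finS: "finite S" by (simp add: S_def)
  obtain \<kappa> where \<kappa>: "\<And>i. i < m \<Longrightarrow> 0 \<le> \<kappa> i" "\<And>i. i < m \<Longrightarrow> ?D (Suc i) \<le> ?D i + \<kappa> i"
      "\<And>i. i < m \<Longrightarrow> ?D (Suc i) \<le> (1 - 1 / (288 * real d ^ 2)) * ?D i + 3 * real d * \<kappa> i"
      "(\<Sum>i<m. \<kappa> i) \<le> real (m * (d * 2 ^ (d - 1))) * ln 2 - ln (real (card S))"
    using round_costs[OF d x _ Sne] by (auto simp: S_def)
  have "(\<Sum>i<m. \<kappa> i) \<le> 0" using \<kappa>(4) by (simp add: cardS ln_realpow mult_ac)
  then have "(\<Sum>i<m. \<kappa> i) = 0" using \<kappa>(1) sum_nonneg[of "{..<m}" \<kappa>] by force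
  then have \<kappa>0: "\<kappa> i = 0" if "i < m" for i
    using \<kappa>(1) that sum_nonneg_eq_0_iff[of "{..<m}" \<kappa>] by auto
  have d1: "1 \<le> real d" using d by simp
  have "1 \<le> real d ^ 2" using d1 by simp
  then have "1 \<le> 288 * real d ^ 2" by linarith
  then have c: "0 \<le> 1 - c" by (auto simp: c_def divide_le_eq)
  have decay: "?D i \<le> (1 - c) ^ i * ?D 0" if "i \<le> m" for i
    using that
  proof (induction i)
    case (Suc i)
    have "?D (Suc i) \<le> (1 - c) * ?D i" using \<kappa>(3)[of i] \<kappa>0[of i] Suc.prems by (simp add: c_def)
    also have "\<dots> \<le> (1 - c) * ((1 - c) ^ i * ?D 0)" using Suc c by (intro mult_left_mono) auto
    finally show ?case by simp
  qed simp
  have "entr S (\<lambda>p. p (0 * d)) = 0"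
    by (rule entr_const[OF finS]) (auto simp: S_def paths_def)
  then have D0: "?D 0 \<le> 2 ^ (2 * d)" "0 \<le> ?D 0" using ln_fact_le[of d] ln_fact_pos[OF d] by auto
  have e2: "(2 :: real) \<le> exp 1" using exp_ge_add_one_self[of 1] by simp
  have "(1 - c) ^ m \<le> exp (- c) ^ m" using exp_ge_add_one_self[of "- c"] c by (intro power_mono) auto
  also have "\<dots> = exp (- (real m * c))" by (simp flip: exp_of_nat_mult)
  \<comment> \<open>\<open>6912 / 288 = 24\<close>; the decay easily beats the initial deficit,
    which is at most \<open>2 ^ (2 * d)\<close>.\<close>
  also have "real m * c = 24 * real d ^ 2"
    using d by (simp add: m_def rounds_def c_def power4_eq_xxxx power2_eq_square field_simps)
  also have "exp (- (24 * real d ^ 2)) \<le> exp (- (24 * real d))"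
    using d1 by (simp add: power2_eq_square)
  finally have A: "(1 - c) ^ m \<le> exp (- (24 * real d))" .
  have "(2 :: real) ^ (2 * d) \<le> exp 1 ^ (2 * d)" using e2 by (intro power_mono) auto
  also have "\<dots> = exp (2 * real d)" by (simp flip: exp_of_nat_mult)
  finally have B: "?D 0 \<le> exp (2 * real d)" using D0 by simp
  have "?D m \<le> (1 - c) ^ m * ?D 0" by (rule decay) simp
  also have "\<dots> \<le> exp (- (24 * real d)) * exp (2 * real d)"
    using A B D0 by (intro mult_mono) auto
  also have "\<dots> = exp (- (22 * real d))" by (simp flip: exp_add)
  also have "\<dots> \<le> exp (- real 22)" using d1 by simp
  also have "\<dots> = 1 / exp 1 ^ 22" by (simp add: exp_minus inverse_eq_divide flip: exp_of_nat_mult)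
  also have "\<dots> \<le> 1 / 2 ^ 22" using e2 by (intro divide_left_mono power_mono) auto
  also have "\<dots> \<le> 1 / (576 :: real)" by simp
  finally have Dm: "?D m \<le> 1 / 576" .
  let ?f = "\<lambda>p. p (m * d)" and ?g = "\<lambda>_ :: nat \<Rightarrow> nat \<Rightarrow> nat \<Rightarrow> nat. ()"
  have img: "?g ` S = {()}" using Sne by auto
  have "(\<Sum>z\<in>?g ` S. hel (arrangements d) (\<lambda>b. freq S (\<lambda>p. (?f p, ?g p)) (b, z)) (\<lambda>b. freq S ?g z / real (fact (2 ^ d))))
      \<le> ln (real (fact (2 ^ d))) - centr S ?f ?g"
    using paths_arr[of _ d "m * d" x "m * d"]
    by (intro deficit_ge_hel finS Sne) (auto simp: card_arrangements S_def)
  note this[unfolded img]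
  moreover have "centr S ?f ?g = entr S ?f"
  proof -
    have "entr S (\<lambda>p. (?f p, ?g p)) = entr S ?f" by (rule entr_eq[OF finS]) auto
    moreover have "entr S ?g = 0" by (rule entr_const[OF finS]) auto
    ultimately show ?thesis by (simp add: centr_def)
  qed
  moreover have "freq S ?g () = 1" using Sne finS by (simp add: freq_def)
  moreover have "freq S (\<lambda>p. (?f p, ?g p)) (y, ()) = thorp_prob d (m * d) x y" if "y \<in> arrangements d" for y
    using thorp_prob_count[OF d x that, of "m * d"] by (simp add: freq_def cardS) (simp add: S_def)
  ultimately have "hel (arrangements d) (thorp_prob d (m * d) x) (\<lambda>_. 1 / fact (2 ^ d)) \<le> ?D m"
    by (simp add: hel_def)
  then show ?thesis using Dm by (simp add: hel_def m_def)
qed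

text \<open>The first half of the time gives closeness on average, the second a density of at most
  \<open>exp 1 \<le> 3\<close>; pairing them makes the estimate pointwise.\<close>

lemma uniform_closeness:
  assumes d: "d \<ge> 1" and x: "x \<in> arrangements d" and y: "y \<in> arrangements d"
  shows "\<bar>thorp_prob d (rounds d * d + rounds d * d) x y * real (card (arrangements d)) - 1\<bar> \<le> 1 / 4"
proof -
  define N :: real where "N = fact (2 ^ d)"
  define n where "n = rounds d * d"
  let ?A = "arrangements d"
  let ?a = "thorp_prob d n x" and ?b = "\<lambda>z. thorp_prob d n z y"
  have N: "N > 0" "real (card ?A) = N" by (simp_all add: N_def card_arrangements)
  \<comment> \<open>Centering at \<open>1 / N\<close> subtracts exactly the column sum of the second
    factor, which is 1.\<close>
  have "(\<Sum>z\<in>?A. (?a z - 1 / N) * (?b z * N)) = thorp_prob d (n + n) x y * N - (\<Sum>z\<in>?A. ?b z)"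
    using N unfolding n_def chapman_kolmogorov[OF y]
    by (simp add: left_diff_distrib sum_subtractf sum_distrib_right mult.assoc)
  then have "\<bar>thorp_prob d (n + n) x y * N - 1\<bar> = \<bar>\<Sum>z\<in>?A. (?a z - 1 / N) * (?b z * N)\<bar>"
    using thorp_prob_col_sum[OF d y] by simp
  also have "\<dots> \<le> (\<Sum>z\<in>?A. \<bar>(?a z - 1 / N) * (?b z * N)\<bar>)" by (rule sum_abs)
  also have "\<dots> \<le> (\<Sum>z\<in>?A. \<bar>?a z - 1 / N\<bar> * 3)"
  proof (rule sum_mono)
    fix z assume z: "z \<in> ?A"
    have "?b z * N \<le> 3" using density_bound[OF d z y] exp_le by (simp add: n_def N_def)
    moreover have "0 \<le> ?b z * N" using N thorp_prob_nonneg by simp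
    ultimately show "\<bar>(?a z - 1 / N) * (?b z * N)\<bar> \<le> \<bar>?a z - 1 / N\<bar> * 3"
      unfolding abs_mult by (intro mult_left_mono) auto
  qed
  \<comment> \<open>Writing a difference as the difference of roots times their sum prepares
    Cauchy-Schwarz: the factors have norms at most \<open>1 / 24\<close> and 2.\<close>
  also have "\<dots> = 3 * (\<Sum>z\<in>?A. \<bar>sqrt (?a z) - sqrt (1 / N)\<bar> * (sqrt (?a z) + sqrt (1 / N)))"
  proof -
    have "\<bar>?a z - 1 / N\<bar> = \<bar>sqrt (?a z) - sqrt (1 / N)\<bar> * (sqrt (?a z) + sqrt (1 / N))" for z
    proof -
      have "?a z - 1 / N = (sqrt (?a z) - sqrt (1 / N)) * (sqrt (?a z) + sqrt (1 / N))"
        using thorp_prob_nonneg[of d n x z] N by (simp add: algebra_simps)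
      then show ?thesis using thorp_prob_nonneg[of d n x z] N by (simp add: abs_mult)
    qed
    then show ?thesis by (simp add: sum_distrib_left mult.commute)
  qed
  also have "\<dots> \<le> 3 * (1 / 24 * 2)"
  proof (rule mult_left_mono)
    have sq: "(\<Sum>z\<in>?A. (sqrt (?a z) + sqrt (1 / N))\<^sup>2) \<le> 4"
    proof -
      have "(\<Sum>z\<in>?A. (sqrt (?a z) + sqrt (1 / N))\<^sup>2) \<le> (\<Sum>z\<in>?A. 2 * ?a z + 2 * (1 / N))"
      proof (rule sum_mono)
        fix z
        have "(sqrt (?a z) + sqrt (1 / N))\<^sup>2 \<le> 2 * (sqrt (?a z))\<^sup>2 + 2 * (sqrt (1 / N))\<^sup>2"
          using square_diff_triangle[of "sqrt (?a z)" "- sqrt (1 / N)" 0] by simp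
        then show "(sqrt (?a z) + sqrt (1 / N))\<^sup>2 \<le> 2 * ?a z + 2 * (1 / N)"
          using thorp_prob_nonneg[of d n x z] N by simp
      qed
      also have "\<dots> = 4" using N thorp_prob_row_sum[OF d x, of n]
        by (simp add: sum.distrib flip: sum_distrib_left)
      finally show ?thesis .
    qed
    have "(\<Sum>z\<in>?A. \<bar>sqrt (?a z) - sqrt (1 / N)\<bar> * (sqrt (?a z) + sqrt (1 / N)))\<^sup>2
       \<le> (\<Sum>z\<in>?A. \<bar>sqrt (?a z) - sqrt (1 / N)\<bar>\<^sup>2) * (\<Sum>z\<in>?A. (sqrt (?a z) + sqrt (1 / N))\<^sup>2)"
      by (rule Cauchy_Schwarz_ineq_sum)
    also have "\<dots> \<le> (1 / 576) * 4"
      using hellinger_bound[OF d x] sq by (intro mult_mono) (auto simp: n_def N_def sum_nonneg)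
    also have "\<dots> = (1 / 24 * 2)\<^sup>2" by (simp add: power2_eq_square)
    finally show "(\<Sum>z\<in>?A. \<bar>sqrt (?a z) - sqrt (1 / N)\<bar> * (sqrt (?a z) + sqrt (1 / N))) \<le> 1 / 24 * 2"
      by (rule power2_le_imp_le) simp
  qed simp
  also have "\<dots> = 1 / 4" by simp
  finally show ?thesis using N by (simp add: n_def)
qed

theorem theorem1:
  "\<exists>C::real. C > 0 \<and>
     (\<forall>d::nat. d \<ge> 1 \<longrightarrow> ereal_of_enat (mixing_time d) \<le> ereal (C * real d ^ 44))"
proof (intro exI[of _ 13824] conjI allI impI)
  fix d :: nat assume d: "d \<ge> 1"
  define n where "n = rounds d * d + rounds d * d"
  have "mixing_time d \<le> enat n"
    unfolding mixing_time_def n_def using uniform_closeness[OF d] by (intro Inf_lower) auto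
  then have "ereal_of_enat (mixing_time d) \<le> ereal_of_enat (enat n)"
    by (simp only: ereal_of_enat_le_iff)
  also have "\<dots> = ereal (real n)" by simp
  \<comment> \<open>\<open>13824 = 2 * 6912\<close>: two stretches of \<open>rounds d\<close> rounds
    with \<open>d\<close> steps each.\<close>
  also have "real n = 13824 * real d ^ 5" by (simp add: n_def rounds_def power_numeral_reduce)
  also have "\<dots> \<le> 13824 * real d ^ 44" using d by (intro mult_left_mono power_increasing) auto
  finally show "ereal_of_enat (mixing_time d) \<le> ereal (13824 * real d ^ 44)" by simp
qed simp

end
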